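(* One can build a T-estimator $\hat s$ of the intensity $s$ (with respect to Lebesgue measure on $[0,1)^2$) of a Poisson process with the following properties. Let the intensity $s$ be such that $\sqrt{s}\in BV([0,1)^2)\cap\mathbb{L}_p([0,1)^2,dx)$ for some $p>2$, so that the coefficients $(\beta_j)_{j\ge1}$ of the expansion of $\sqrt{s}$ in the Haar basis satisfy $$\sum_{j>n}\beta_j^2\le A^2n^{-\delta}\quad\text{for all } n\ge1$$ with $\delta=1/2-1/p$ and some $A\ge1$. Let $R=|\sqrt{s}|_{BV}$. Then $$\mathbb{E}_s\left[H^2(s,\hat s)\right]\le C\left[\sqrt{\gamma(R^2\vee\gamma)}\wedge A^{2/(1+\delta)}\right]\quad\text{with}\quad\gamma=\delta^{-1}\left[\frac{\log\left(\delta[A\vee R]^2\right)}{\log2}\vee1\right],$$ where $C$ is a universal constant.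
   Context: $\lambda$ is Lebesgue measure on $[0,1)^2$, $\mathbb{L}_1^+(\lambda)$ the nonnegative elements of $\mathbb{L}_1(\lambda)$; $a\vee b=\max(a,b)$, $a\wedge b=\min(a,b)$. A Poisson process with intensity $s\in\mathbb{L}_1^+(\lambda)$ is a point process $\boldsymbol{X}=\{X_1,\dots,X_N\}$ with $N$ Poisson with parameter $\int s\,d\lambda$ and, conditionally on $N$, the $X_i$ i.i.d. with density $s/\int s\,d\lambda$; $\mathbb{E}_s$ is the corresponding expectation. $\mathbb{P}_\mu$ refers to a Poisson process with finite mean measure $\mu$. For finite measures $H^2(\mu,\mu')=\frac12\int(\sqrt{d\mu/d\nu}-\sqrt{d\mu'/d\nu})^2d\nu$ ($\nu$ any dominating measure); $\mu_t=t\cdot\lambda$, $H(t,u)=H(\mu_t,\mu_u)=2^{-1/2}\|\sqrt t-\sqrt u\|_2$, with $\|\cdot\|_2$ the norm of $\mathbb{L}_2(\lambda)$. $BV([0,1)^2)$ is the space of functions of bounded variation on $[0,1)^2$ and $|f|_{BV}$ its usual semi-norm (total variation). The (two-dimensional, isotropic, orthonormal) Haar wavelet basis $\{\varphi_{j,\boldsymbol{k}}, j\ge-1,\boldsymbol{k}\in\Lambda(j)\}$ of $\mathbb{L}_2([0,1)^2,dx)$ is re-indexed as a single sequence $(\varphi_j)_{j\ge1}$ by increasing resolution level, and $\sqrt{s}=\sum_{j\ge1}\beta_j\varphi_j$. T-estimators. A subset $S'$ of a metric space $(M,d)$ is a D-model with parameters $\eta,D,B'>0$ if $|S'\cap\mathcal{B}(t,x\eta)|\le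 B'\exp[Dx^2]$ for all $x\ge2$, $t\in M$ (open balls). Take a countable family of D-models $S_m$ in $(\mathbb{L}_1^+(\lambda),H)$ with parameters $\eta_m,D_m,B'$ such that $D_m\ge1/2$, $\eta_m^2\ge84D_m/5$ and $\sum_m\exp[-\eta_m^2/84]<\infty$; let $S=\bigcup_mS_m$, $\eta(t)=\inf\{\eta_m : S_m\ni t\}$. For each pair of distinct $t,u\in S$ take a test $\psi_{t,u}(\boldsymbol{X})\in\{t,u\}$ with $\mathbb{P}_\mu[\psi_{t,u}=u]\le\exp[-(H^2(t,u)-\eta^2(t)+\eta^2(u))/4]$ whenever $H(\mu,\mu_t)\le H(t,u)/4$, $\mathbb{P}_\mu[\psi_{t,u}=t]\le\exp[-(H^2(t,u)-\eta^2(u)+\eta^2(t))/4]$ whenever $H(\mu,\mu_u)\le H(t,u)/4$, and $\mathbb{P}_\mu[\psi_{t,u}=u]\le\exp[(16H^2(\mu,\mu_t)+\eta^2(t)-\eta^2(u))/4]$ for all finite measures $\mu$ (such tests exist). A T-estimator is a measurable minimizer over $t\in S$ of $\mathcal{D}_{\boldsymbol{X}}(t)=\sup\{H(t,u) : u\in S,u\ne t,\psi_{t,u}(\boldsymbol{X})=u\}$ ($\sup\emptyset=0$). *)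

theory Defs
  imports "HOL-Probability.Probability"
begin

type_synonym point = "real \<times> real"

definition unit_square :: "point set" where
  "unit_square = {0..<1} \<times> {0..<1}"

definition lam :: "point measure" where
  "lam = restrict_space lborel unit_square"

text \<open>
  Elements of the spaces of (classes of) functions on the unit square are represented by functions;
  two functions represent the same element iff they agree \<^term>\<open>lam\<close>-almost everywhere.
\<close>

definition L1_plus :: "(point \<Rightarrow> real) set" where
  "L1_plus = {t. integrable lam t \<and> (AE x in lam. 0 \<le> t x)}"

definition in_Lp :: "real \<Rightarrow> (point \<Rightarrow> real) \<Rightarrow> bool" where
  "in_Lp p f \<longleftrightarrow> f \<in> borel_measurable lam \<and> integrable lam (\<lambda>x. \<bar>f x\<bar> powr p)"

definition intensity_measure :: "(point \<Rightarrow> real) \<Rightarrow> point measure" where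
  "intensity_measure t = density lam (\<lambda>x. ennreal (t x))"

definition finite_measures :: "point measure set" where
  "finite_measures = {\<mu>. finite_measure \<mu> \<and> sets \<mu> = sets lam}"


subsection \<open>Hellinger distance\<close>

definition hellinger_sq_wrt :: "'a measure \<Rightarrow> 'a measure \<Rightarrow> 'a measure \<Rightarrow> real" where
  "hellinger_sq_wrt \<nu> \<mu> \<mu>' =
    1/2 * (\<integral>x. (sqrt (enn2real (RN_deriv \<nu> \<mu> x)) - sqrt (enn2real (RN_deriv \<nu> \<mu>' x)))\<^sup>2 \<partial>\<nu>)"

definition measure_sum :: "'a measure \<Rightarrow> 'a measure \<Rightarrow> 'a measure" where
  "measure_sum \<mu> \<mu>' = measure_of (space \<mu>) (sets \<mu>) (\<lambda>A. emeasure \<mu> A + emeasure \<mu>' A)"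

text \<open>The integral does not depend on the dominating measure; the sum of the two measures is used.\<close>

definition hellinger :: "'a measure \<Rightarrow> 'a measure \<Rightarrow> real" where
  "hellinger \<mu> \<mu>' = sqrt (hellinger_sq_wrt (measure_sum \<mu> \<mu>') \<mu> \<mu>')"

definition hell :: "(point \<Rightarrow> real) \<Rightarrow> (point \<Rightarrow> real) \<Rightarrow> real" where
  "hell t u = hellinger (intensity_measure t) (intensity_measure u)"


subsection \<open>Poisson processes\<close>

text \<open>
  A point configuration is a finite multiset of points, since the mean measure may have atoms.
  The \<open>\<sigma>\<close>-algebra is generated by the counting maps of the measurable sets.
\<close>

definition config_space :: "point multiset measure" where
  "config_space = sigma {X. set_mset X \<subseteq> unit_square}
     {{X. set_mset X \<subseteq> unit_square \<and> size (filter_mset (\<lambda>x. x \<in> A) X) = n} | A n. A \<in> sets lam}"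

text \<open>
  Law of the Poisson process with finite mean measure \<open>\<mu>\<close>: the number \<open>N\<close> of points is Poisson
  distributed with parameter \<open>\<mu>(space)\<close>, and independently of \<open>N\<close> the points are i.i.d. with law
  \<open>\<mu> / \<mu>(space)\<close>; the first \<open>N\<close> of them form the configuration. The case \<open>\<mu> = 0\<close> is separate
  because the library's Poisson distribution requires a positive parameter.
\<close>

definition poisson_process :: "point measure \<Rightarrow> point multiset measure" where
  "poisson_process \<mu> =
    (if measure \<mu> (space \<mu>) = 0 then return config_space {#}
     else distr (measure_pmf (poisson_pmf (measure \<mu> (space \<mu>)))
                   \<Otimes>\<^sub>M (\<Pi>\<^sub>M i\<in>(UNIV :: nat set). uniform_measure \<mu> (space \<mu>)))
            config_space
            (\<lambda>(N, x). mset (map x [0..<N])))"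


subsection \<open>Functions of bounded variation\<close>

text \<open>
  \<open>C\<^sup>1\<close> vector fields with compact support in the open square, of Euclidean norm at most 1
  (the norm of the product type is Euclidean).
\<close>

definition test_fields :: "(point \<Rightarrow> point) set" where
  "test_fields = {v. (\<exists>v'. (\<forall>x. (v has_derivative blinfun_apply (v' x)) (at x)) \<and> continuous_on UNIV v')
      \<and> (\<exists>K. compact K \<and> K \<subseteq> {0<..<1} \<times> {0<..<1} \<and> (\<forall>x. x \<notin> K \<longrightarrow> v x = 0))
      \<and> (\<forall>x. norm (v x) \<le> 1)}"

definition divergence :: "(point \<Rightarrow> point) \<Rightarrow> point \<Rightarrow> real" where
  "divergence v x = (\<Sum>b\<in>Basis. frechet_derivative v (at x) b \<bullet> b)"

definition total_variation :: "(point \<Rightarrow> real) \<Rightarrow> ereal" where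
  "total_variation f = (SUP v\<in>test_fields. ereal (\<integral>x. f x * divergence v x \<partial>lam))"

definition BV :: "(point \<Rightarrow> real) set" where
  "BV = {f. integrable lam f \<and> total_variation f < \<infinity>}"

definition BV_seminorm :: "(point \<Rightarrow> real) \<Rightarrow> real" where
  "BV_seminorm f = real_of_ereal (total_variation f)"


subsection \<open>The isotropic Haar basis\<close>

definition haar_father :: "real \<Rightarrow> real" where
  "haar_father = indicator {0..<1}"

definition haar_mother :: "real \<Rightarrow> real" where
  "haar_mother x = indicator {0..<1/2} x - indicator {1/2..<1} x"

datatype orientation = Horizontal | Vertical | Diagonal

text \<open>\<open>Scaling\<close> is the constant function, the only element of level \<open>-1\<close>.\<close>

datatype haar_index = Scaling | Wavelet (scale: nat) nat nat orientation

definition haar_indices :: "haar_index set" where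
  "haar_indices = insert Scaling {Wavelet j k l e | j k l e. k < 2 ^ j \<and> l < 2 ^ j}"

fun level :: "haar_index \<Rightarrow> int" where
  "level Scaling = -1"
| "level (Wavelet j k l e) = int j"

fun haar :: "haar_index \<Rightarrow> point \<Rightarrow> real" where
  "haar Scaling (x, y) = haar_father x * haar_father y"
| "haar (Wavelet j k l Horizontal) (x, y) =
     2 ^ j * haar_mother (2 ^ j * x - real k) * haar_father (2 ^ j * y - real l)"
| "haar (Wavelet j k l Vertical) (x, y) =
     2 ^ j * haar_father (2 ^ j * x - real k) * haar_mother (2 ^ j * y - real l)"
| "haar (Wavelet j k l Diagonal) (x, y) =
     2 ^ j * haar_mother (2 ^ j * x - real k) * haar_mother (2 ^ j * y - real l)"

text \<open>Re-indexing by the integers \<open>j \<ge> 1\<close>, in any order compatible with the resolution levels.\<close>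

definition haar_enumeration :: "(nat \<Rightarrow> haar_index) \<Rightarrow> bool" where
  "haar_enumeration \<iota> \<longleftrightarrow> bij_betw \<iota> {1..} haar_indices \<and>
     (\<forall>i j. 1 \<le> i \<longrightarrow> i \<le> j \<longrightarrow> level (\<iota> i) \<le> level (\<iota> j))"

definition haar_coeff :: "(nat \<Rightarrow> haar_index) \<Rightarrow> (point \<Rightarrow> real) \<Rightarrow> nat \<Rightarrow> real" where
  "haar_coeff \<iota> f j = (\<integral>x. f x * haar (\<iota> j) x \<partial>lam)"


subsection \<open>T-estimators\<close>

definition D_model ::
  "'a set \<Rightarrow> ('a \<Rightarrow> 'a \<Rightarrow> real) \<Rightarrow> real \<Rightarrow> real \<Rightarrow> real \<Rightarrow> 'a set \<Rightarrow> bool" where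
  "D_model M d \<eta> D B' S' \<longleftrightarrow> S' \<subseteq> M \<and> \<eta> > 0 \<and> D > 0 \<and> B' > 0 \<and>
     (\<forall>x\<ge>2. \<forall>t\<in>M. finite {u\<in>S'. d t u < x * \<eta>} \<and>
        real (card {u\<in>S'. d t u < x * \<eta>}) \<le> B' * exp (D * x\<^sup>2))"

text \<open>
  The last conjunct: the union of the models contains at most one representative of each class of
  almost everywhere equal functions, so that it is in bijection with a set of elements of the
  metric space.
\<close>

definition model_family ::
  "nat set \<Rightarrow> (nat \<Rightarrow> (point \<Rightarrow> real) set) \<Rightarrow> (nat \<Rightarrow> real) \<Rightarrow> (nat \<Rightarrow> real) \<Rightarrow> real \<Rightarrow> bool" where
  "model_family I S \<eta> D B' \<longleftrightarrow>
     (\<forall>m\<in>I. D_model L1_plus hell (\<eta> m) (D m) B' (S m)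
        \<and> D m \<ge> 1/2 \<and> (\<eta> m)\<^sup>2 \<ge> 84 * D m / 5) \<and>
     (\<lambda>m. exp (- (\<eta> m)\<^sup>2 / 84)) summable_on I \<and>
     (\<forall>t\<in>(\<Union>m\<in>I. S m). \<forall>u\<in>(\<Union>m\<in>I. S m). (AE x in lam. t x = u x) \<longrightarrow> t = u)"

definition eta_of ::
  "nat set \<Rightarrow> (nat \<Rightarrow> (point \<Rightarrow> real) set) \<Rightarrow> (nat \<Rightarrow> real) \<Rightarrow> (point \<Rightarrow> real) \<Rightarrow> real" where
  "eta_of I S \<eta> t = Inf {\<eta> m | m. m \<in> I \<and> t \<in> S m}"

text \<open>The tests are indexed by unordered pairs, hence the symmetry of \<open>\<psi>\<close>.\<close>

definition test_family ::
  "(point \<Rightarrow> real) set \<Rightarrow> ((point \<Rightarrow> real) \<Rightarrow> real) \<Rightarrow>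
   ((point \<Rightarrow> real) \<Rightarrow> (point \<Rightarrow> real) \<Rightarrow> point multiset \<Rightarrow> (point \<Rightarrow> real)) \<Rightarrow> bool" where
  "test_family T e \<psi> \<longleftrightarrow> (\<forall>t\<in>T. \<forall>u\<in>T. t \<noteq> u \<longrightarrow>
     \<psi> t u \<in> config_space \<rightarrow>\<^sub>M count_space {t, u} \<and>
     \<psi> t u = \<psi> u t \<and>
     (\<forall>\<mu>\<in>finite_measures.
        (hellinger \<mu> (intensity_measure t) \<le> hell t u / 4 \<longrightarrow>
          measure (poisson_process \<mu>) {X\<in>space config_space. \<psi> t u X = u}
            \<le> exp (- ((hell t u)\<^sup>2 - (e t)\<^sup>2 + (e u)\<^sup>2) / 4)) \<and>
        (hellinger \<mu> (intensity_measure u) \<le> hell t u / 4 \<longrightarrow>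
          measure (poisson_process \<mu>) {X\<in>space config_space. \<psi> t u X = t}
            \<le> exp (- ((hell t u)\<^sup>2 - (e u)\<^sup>2 + (e t)\<^sup>2) / 4)) \<and>
        measure (poisson_process \<mu>) {X\<in>space config_space. \<psi> t u X = u}
          \<le> exp ((16 * (hellinger \<mu> (intensity_measure t))\<^sup>2 + (e t)\<^sup>2 - (e u)\<^sup>2) / 4)))"

text \<open>Values in \<^typ>\<open>ennreal\<close>, where the supremum of the empty set is 0.\<close>

definition T_criterion ::
  "(point \<Rightarrow> real) set \<Rightarrow>
   ((point \<Rightarrow> real) \<Rightarrow> (point \<Rightarrow> real) \<Rightarrow> point multiset \<Rightarrow> (point \<Rightarrow> real)) \<Rightarrow>
   point multiset \<Rightarrow> (point \<Rightarrow> real) \<Rightarrow> ennreal" where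
  "T_criterion T \<psi> X t = (SUP u\<in>{u\<in>T. u \<noteq> t \<and> \<psi> t u X = u}. ennreal (hell t u))"

text \<open>
  The union of the models is countable, so measurability refers to its discrete \<open>\<sigma>\<close>-algebra;
  it includes that the estimator takes its values in this union.
\<close>

definition T_estimator :: "(point multiset \<Rightarrow> (point \<Rightarrow> real)) \<Rightarrow> bool" where
  "T_estimator est \<longleftrightarrow> (\<exists>I S \<eta> D B' \<psi>. let T = (\<Union>m\<in>I. S m) in
     model_family I S \<eta> D B' \<and>
     test_family T (eta_of I S \<eta>) \<psi> \<and>
     est \<in> config_space \<rightarrow>\<^sub>M count_space T \<and>
     (\<forall>X\<in>space config_space. \<forall>t\<in>T. T_criterion T \<psi> X (est X) \<le> T_criterion T \<psi> X t))"


subsection \<open>Basic facts: existence of enumerations, Poisson laws, Hellinger distance of intensities\<close>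

fun orientation_num :: "orientation \<Rightarrow> nat" where "orientation_num Horizontal = 0" | "orientation_num Vertical = 1" | "orientation_num Diagonal = 2"
fun haar_key :: "haar_index \<Rightarrow> nat" where "haar_key Scaling = 0"
| "haar_key (Wavelet j k l e) = 4 ^ j + (3 * (l * 2 ^ j + k) + orientation_num e)"

lemma orientation_num_le: "orientation_num e < 3" by (cases e) auto
lemma orientation_num_inj: "orientation_num e = orientation_num e' \<Longrightarrow> e = e'" by (cases e; cases e') auto

lemma haar_key_less: "(x::nat) < y \<Longrightarrow> c < 3 \<Longrightarrow> 3 * x + c < 3 * y" by linarith

lemma haar_key_ub: assumes "k < 2^j" "l < 2^j" shows "haar_key (Wavelet j k l e) < 4 ^ Suc j"
proof -
  have "l * 2^j + k < (l+1) * 2^j" using assms by simp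
  also have "\<dots> \<le> 2^j * 2^j" using assms by (intro mult_right_mono) auto
  also have "\<dots> = (4::nat)^j" by (simp add: power_mult_distrib[symmetric])
  finally have "3 * (l * 2 ^ j + k) + orientation_num e < 3 * 4^j" by (intro haar_key_less orientation_num_le)
  then show ?thesis by simp
qed

lemma haar_key_level: assumes "a \<in> haar_indices" "b \<in> haar_indices" "haar_key a \<le> haar_key b" shows "level a \<le> level b"
proof (cases a)
  case Scaling then show ?thesis by (cases b) auto
next
  case (Wavelet j k l e)
  note a = this
  show ?thesis
  proof (cases b)
    case Scaling then show ?thesis using assms a by simp
  next
    case (Wavelet j' k' l' e')
    have "4^j \<le> haar_key a" using a by simp
    also have "haar_key a \<le> haar_key b" by fact
    also have "haar_key b < 4 ^ Suc j'" using haar_key_ub assms Wavelet by (auto simp: haar_indices_def simp del: haar_key.simps)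
    finally have "(4::nat)^j < 4 ^ Suc j'" .
    then have "j < Suc j'" by (rule power_less_imp_less_exp[rotated]) simp
    then show ?thesis using a Wavelet by simp
  qed
qed

lemma haar_key_mod3: "3 * (x::nat) + c = 3 * y + d \<Longrightarrow> c < 3 \<Longrightarrow> d < 3 \<Longrightarrow> c = d" by presburger

lemma haar_key_inj: "inj_on haar_key haar_indices"
proof (rule inj_onI)
  fix a b assume A: "a \<in> haar_indices" "b \<in> haar_indices" "haar_key a = haar_key b"
  have lev: "level a = level b" using haar_key_level[of a b] haar_key_level[of b a] A by simp
  show "a = b"
  proof (cases a)
    case Scaling then show ?thesis using lev by (cases b) auto
  next
    case (Wavelet j k l e)
    note a = this
    obtain k' l' e' where b: "b = Wavelet j k' l' e'" using lev a by (cases b) auto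
    have kl: "k < 2^j" "l < 2^j" "k' < 2^j" "l' < 2^j" using A a b by (auto simp: haar_indices_def)
    have q: "3 * (l * 2 ^ j + k) + orientation_num e = 3 * (l' * 2 ^ j + k') + orientation_num e'" using A a b by simp
    have o: "orientation_num e = orientation_num e'" using haar_key_mod3[OF q orientation_num_le orientation_num_le] by simp
    then have "l * 2 ^ j + k = l' * 2 ^ j + k'" using q by simp
    moreover from this have "(l * 2 ^ j + k) div 2^j = (l' * 2 ^ j + k') div 2^j" by (rule arg_cong)
    then have "l = l'" using kl by (subst (asm) (1 2) div_mult_self3) auto
    ultimately show ?thesis using a b orientation_num_inj[OF o] by simp
  qed
qed

lemma ex_haar_enumeration: "\<exists>\<iota>. haar_enumeration \<iota>"
proof -
  let ?K = "haar_key ` haar_indices"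
  have "infinite (range (\<lambda>j. Wavelet j 0 0 Horizontal))"
    by (rule range_inj_infinite) (auto intro: injI)
  moreover have "range (\<lambda>j. Wavelet j 0 0 Horizontal) \<subseteq> haar_indices" by (auto simp: haar_indices_def)
  ultimately have "infinite haar_indices" using finite_subset by blast
  then have inf: "infinite ?K" using haar_key_inj finite_image_iff by blast
  define \<iota> where "\<iota> i = inv_into haar_indices haar_key (enumerate ?K (i - 1))" for i
  have b0: "bij_betw (\<lambda>i. i - 1) {1::nat..} UNIV"
    by (rule bij_betw_byWitness[where f'=Suc]) auto
  have b1: "bij_betw (enumerate ?K) UNIV ?K" by (rule bij_enumerate[OF inf])
  have b2: "bij_betw (inv_into haar_indices haar_key) ?K haar_indices"
    by (rule bij_betw_inv_into) (simp add: bij_betw_def haar_key_inj)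
  have "bij_betw \<iota> {1..} haar_indices"
    using bij_betw_trans[OF bij_betw_trans[OF b0 b1] b2] by (simp add: \<iota>_def[abs_def] comp_def)
  moreover have "level (\<iota> i) \<le> level (\<iota> j)" if "1 \<le> i" "i \<le> j" for i j
  proof (rule haar_key_level)
    have in1: "enumerate ?K n \<in> ?K" for n by (rule enumerate_in_set[OF inf])
    show "\<iota> i \<in> haar_indices" "\<iota> j \<in> haar_indices" unfolding \<iota>_def using in1 inv_into_into by metis+
    show "haar_key (\<iota> i) \<le> haar_key (\<iota> j)" unfolding \<iota>_def
      using f_inv_into_f[OF in1] enumerate_mono_le_iff[OF inf] that by (metis diff_le_mono)
  qed
  ultimately show ?thesis unfolding haar_enumeration_def by blast
qed

lemma config_space_generator: "{{X. set_mset X \<subseteq> unit_square \<and> size (filter_mset (\<lambda>x. x \<in> A) X) = n} | A n. A \<in> sets lam}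
   \<subseteq> Pow {X. set_mset X \<subseteq> unit_square}" by auto

lemma space_lam: "space lam = unit_square"
  by (simp add: lam_def space_restrict_space)

lemma space_config: "space config_space = {X. set_mset X \<subseteq> unit_square}"
  unfolding config_space_def by (rule space_measure_of[OF config_space_generator])

lemma measurable_config:
  assumes "sets M = sets lam"
  shows "(\<lambda>x. mset (map x [0..<N])) \<in> (\<Pi>\<^sub>M i\<in>(UNIV :: nat set). M) \<rightarrow>\<^sub>M config_space"
  unfolding config_space_def
proof (rule measurable_measure_of[OF config_space_generator])
  have sp: "space M = unit_square" using sets_eq_imp_space_eq[OF assms] space_lam by simp
  show "(\<lambda>x. mset (map x [0..<N])) \<in> space (\<Pi>\<^sub>M i\<in>(UNIV :: nat set). M) \<rightarrow> {X. set_mset X \<subseteq> unit_square}"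
    by (auto simp only: space_PiM sp Pi_iff PiE_iff mem_Collect_eq set_mset_mset set_map subset_iff image_iff)
  fix Y assume "Y \<in> {{X. set_mset X \<subseteq> unit_square \<and> size (filter_mset (\<lambda>x. x \<in> A) X) = n} | A n. A \<in> sets lam}"
  then obtain A n where Y: "Y = {X. set_mset X \<subseteq> unit_square \<and> size (filter_mset (\<lambda>x. x \<in> A) X) = n}" and A: "A \<in> sets M"
    using assms by auto
  have *: "size (filter_mset (\<lambda>x. x \<in> A) (mset (map x [0..<N]))) = (\<Sum>i<N. if x i \<in> A then 1 else 0)" for x :: "nat \<Rightarrow> point"
    by (induction N) auto
  have "(\<lambda>x. mset (map x [0..<N])) -` Y \<inter> space (\<Pi>\<^sub>M i\<in>(UNIV :: nat set). M)
    = {x\<in>space (\<Pi>\<^sub>M i\<in>(UNIV :: nat set). M). (\<Sum>i<N. if x i \<in> A then 1 else 0) = n}"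
    unfolding Y using * by (auto simp: space_PiM sp)
  also have "\<dots> \<in> sets (\<Pi>\<^sub>M i\<in>(UNIV :: nat set). M)"
    using A by measurable
  finally show "(\<lambda>x. mset (map x [0..<N])) -` Y \<inter> space (\<Pi>\<^sub>M i\<in>(UNIV :: nat set). M) \<in> sets (\<Pi>\<^sub>M i\<in>(UNIV :: nat set). M)" .
qed

lemma prob_space_poisson_process:
  assumes "\<mu> \<in> finite_measures" shows "prob_space (poisson_process \<mu>)"
proof -
  have s: "sets \<mu> = sets lam" and f: "finite_measure \<mu>" using assms by (auto simp: finite_measures_def)
  interpret finite_measure \<mu> by fact
  show ?thesis
  proof (cases "measure \<mu> (space \<mu>) = 0")
    case True then show ?thesis unfolding poisson_process_def
      by (auto intro!: prob_space_return simp: space_config)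
  next
    case False
    let ?U = "uniform_measure \<mu> (space \<mu>)"
    have U: "prob_space ?U" by (rule prob_space_uniform_measure) (use False in \<open>auto simp: measure_def\<close>)
    interpret P: product_prob_space "\<lambda>_::nat. ?U" UNIV
      using U by (auto intro!: product_prob_spaceI)
    have "prob_space (\<Pi>\<^sub>M i\<in>(UNIV :: nat set). ?U)" by (rule P.prob_space_axioms)
    then interpret Q: pair_prob_space "measure_pmf (poisson_pmf (measure \<mu> (space \<mu>)))" "\<Pi>\<^sub>M i\<in>(UNIV :: nat set). ?U"
      unfolding pair_prob_space_def pair_sigma_finite_def
      by (auto intro!: prob_space_measure_pmf prob_space_imp_sigma_finite)
    have "(\<lambda>(N, x). mset (map x [0..<N])) \<in> count_space UNIV \<Otimes>\<^sub>M (\<Pi>\<^sub>M i\<in>(UNIV :: nat set). ?U) \<rightarrow>\<^sub>M config_space"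
      by (rule measurable_pair_measure_countable1) (auto intro!: measurable_config[simplified] simp: s)
    then have "(\<lambda>(N, x). mset (map x [0..<N])) \<in> measure_pmf (poisson_pmf (measure \<mu> (space \<mu>))) \<Otimes>\<^sub>M (\<Pi>\<^sub>M i\<in>(UNIV :: nat set). ?U) \<rightarrow>\<^sub>M config_space"
      by (subst measurable_cong_sets[OF sets_pair_measure_cong[OF sets_measure_pmf_count_space refl] refl])
    then show ?thesis unfolding poisson_process_def using False
      by (simp only: if_False) (rule Q.prob_space_distr)
  qed
qed

lemma measure_sum_density:
  assumes [measurable]: "f \<in> borel_measurable M" "g \<in> borel_measurable M"
  shows "measure_sum (density M f) (density M g) = density M (\<lambda>x. f x + g x)"
proof (rule measure_eqI)
  show ss: "sets (measure_sum (density M f) (density M g)) = sets (density M (\<lambda>x. f x + g x))"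
    unfolding measure_sum_def by (simp add: sets.sigma_sets_eq)
  fix A assume "A \<in> sets (measure_sum (density M f) (density M g))"
  then have A: "A \<in> sets M" using ss by simp
  have "emeasure (measure_sum (density M f) (density M g)) A = emeasure (density M f) A + emeasure (density M g) A"
  proof (rule emeasure_measure_of[OF measure_sum_def])
    show "sets (density M f) \<subseteq> Pow (space (density M f))" using sets.space_closed by simp
    show "A \<in> sets (measure_sum (density M f) (density M g))" by fact
    show "positive (sets (measure_sum (density M f) (density M g))) (\<lambda>A. emeasure (density M f) A + emeasure (density M g) A)"
      by (simp add: positive_def)
    show "countably_additive (sets (measure_sum (density M f) (density M g))) (\<lambda>A. emeasure (density M f) A + emeasure (density M g) A)"
      unfolding countably_additive_def
      using ss by (auto simp: suminf_add[symmetric] suminf_emeasure)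
  qed
  also have "\<dots> = emeasure (density M (\<lambda>x. f x + g x)) A"
    using A by (simp add: emeasure_density nn_integral_add[symmetric] distrib_right)
  finally show "emeasure (measure_sum (density M f) (density M g)) A = emeasure (density M (\<lambda>x. f x + g x)) A" .
qed

lemma hell_eq:
  assumes "t \<in> L1_plus" "u \<in> L1_plus"
  shows "hell t u = sqrt (1/2 * (\<integral>x. (sqrt (t x) - sqrt (u x))\<^sup>2 \<partial>lam))"
proof -
  have [measurable]: "t \<in> borel_measurable lam" "u \<in> borel_measurable lam"
    and p: "AE x in lam. 0 \<le> t x" "AE x in lam. 0 \<le> u x"
    using assms by (auto simp: L1_plus_def)
  define w where "w x = max 0 (t x) + max 0 (u x)" for x
  have [measurable]: "w \<in> borel_measurable lam" unfolding w_def by measurable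
  define N where "N = density lam (\<lambda>x. ennreal (w x))"
  have N: "measure_sum (intensity_measure t) (intensity_measure u) = N"
    unfolding intensity_measure_def N_def w_def
    by (subst measure_sum_density) (auto simp: ennreal_plus[symmetric] max_def ennreal_neg simp del: ennreal_plus intro!: arg_cong2[where f=density])
  have fin: "integrable lam w" using assms unfolding w_def L1_plus_def by auto
  have w0: "w x \<ge> 0" for x by (simp add: w_def)
  have "finite_measure N" unfolding N_def
    using fin w0 by (intro finite_measureI) (auto simp: emeasure_density real_integrable_def)
  then interpret finite_measure N .
  have rn: "AE x in N. RN_deriv N (intensity_measure v) x = ennreal (v x / w x)"
    if [measurable]: "v \<in> borel_measurable lam" and v: "\<And>x. max 0 (v x) \<le> w x" for v
  proof -
    have "density N (\<lambda>x. ennreal (v x / w x)) = intensity_measure v"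
      unfolding N_def intensity_measure_def
    proof (subst density_density_eq)
      have "ennreal (w x) * ennreal (v x / w x) = ennreal (v x)" for x
        using v[of x] w0[of x] by (cases "w x = 0") (auto simp: ennreal_mult'[symmetric] ennreal_neg)
      then show "density lam (\<lambda>x. ennreal (w x) * ennreal (v x / w x)) = density lam (\<lambda>x. ennreal (v x))" by simp
    qed auto
    moreover have "(\<lambda>x. ennreal (v x / w x)) \<in> borel_measurable N" unfolding N_def by simp
    ultimately show ?thesis by (auto intro!: AE_symmetric[OF RN_deriv_unique])
  qed
  have "hellinger_sq_wrt N (intensity_measure t) (intensity_measure u)
     = 1/2 * (\<integral>x. (sqrt (max 0 (t x / w x)) - sqrt (max 0 (u x / w x)))\<^sup>2 \<partial>N)"
    unfolding hellinger_sq_wrt_def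
  proof (intro arg_cong2[where f="(*)"] refl integral_cong_AE)
    show "AE x in N. (sqrt (enn2real (RN_deriv N (intensity_measure t) x)) - sqrt (enn2real (RN_deriv N (intensity_measure u) x)))\<^sup>2
      = (sqrt (max 0 (t x / w x)) - sqrt (max 0 (u x / w x)))\<^sup>2"
    proof -
      have e: "enn2real (ennreal r) = max 0 r" for r by (cases "r \<ge> 0") (auto simp: ennreal_neg)
      show ?thesis
        using rn[of t] rn[of u] by (auto simp: w_def e)
    qed
  qed (auto simp: N_def)
  also have "\<dots> = 1/2 * (\<integral>x. w x * (sqrt (max 0 (t x / w x)) - sqrt (max 0 (u x / w x)))\<^sup>2 \<partial>lam)"
    unfolding N_def using w0 by (subst integral_density) auto
  also have "\<dots> = 1/2 * (\<integral>x. (sqrt (t x) - sqrt (u x))\<^sup>2 \<partial>lam)"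
  proof (intro arg_cong2[where f="(*)"] refl integral_cong_AE)
    show "AE x in lam. w x * (sqrt (max 0 (t x / w x)) - sqrt (max 0 (u x / w x)))\<^sup>2 = (sqrt (t x) - sqrt (u x))\<^sup>2"
      using p
    proof eventually_elim
      case (elim x)
      show ?case
      proof (cases "w x = 0")
        case True then show ?thesis using elim by (auto simp: w_def)
      next
        case False
        with w0[of x] have "w x > 0" by simp
        then show ?thesis using elim
          by (simp add: real_sqrt_divide diff_divide_distrib[symmetric] power_divide)
      qed
    qed
  qed auto
  finally show ?thesis by (simp add: hell_def hellinger_def N)
qed

end

theory Submission
  imports Defs
begin

text \<open>
  Squares of piecewise constant functions on dyadic quadtrees, with values in a lattice, are used as
  candidates for the intensity; the complexity of a candidate is its number of leaves. The whole
  construction takes place in a single discrete model. It is obtained by thinning the candidates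
  greedily until two of them have Hellinger distance at least \<open>50 sqrt k\<close>, where \<open>k\<close> is the larger complexity
  (\<open>model_exists\<close>). Then a ball of radius \<open>r\<close> contains either one point of the model or only points of
  complexity \<open>O(r\<^sup>2)\<close>, and there are only \<open>exp (O(r\<^sup>2))\<close> of those near any given function (\<open>tree_count\<close>); so
  the model is a D-model with absolute constants. What thinning loses at a candidate is of the order of its
  complexity, which a penalized estimator would pay anyway.
  
  For one model the penalties in the tests are constant and cancel. The tests compare the likelihoods of
  two interior points of the segment between \<open>sqrt t\<close> and \<open>sqrt u\<close>, whose ratio is bounded; a Chernoff bound
  gives the required errors for all Poisson processes near \<open>t\<close> or \<open>u\<close> (\<open>lr_ratio_drift\<close>, \<open>lr_test_family\<close>).
  The T-estimator then has risk at most a constant times \<open>1 + H\<^sup>2(s,t)\<close> for each point \<open>t\<close> of the model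
  (\<open>T_criterion_risk\<close>), hence at most a constant times the squared distance of \<open>sqrt s\<close> to a tree function plus
  its number of leaves, for every tree.
  
  It remains to find two trees. The full tree of depth \<open>J\<close> has \<open>4\<^sup>J\<close> leaves and its error is the tail
  of the Haar expansion plus rounding; \<open>4\<^sup>J\<close> close to the power \<open>2/(1 + \<delta>)\<close> of \<open>A\<close> gives the second term of the minimum. For
  the first term, squares are split only as long as the variation of the dyadic averages on them exceeds
  \<open>\<epsilon>\<close>, down to depth \<open>J\<close> (\<open>tree_approx\<close>). This takes \<open>O(J R / \<epsilon>)\<close> leaves, since variations of disjoint squares add
  up, and costs \<open>O(\<epsilon> R)\<close>, since in dimension two the variation on a square controls the \<open>L\<^sub>2\<close>-oscillation
  (\<open>grid_Poincare\<close>). With \<open>\<epsilon> = sqrt J\<close> both are of order \<open>R sqrt J\<close>, and depth \<open>J\<close> of order \<open>\<gamma>\<close> makes the remaining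
  tail at most \<open>\<gamma>\<close>.
  
  Bounded variation enters only through the bound \<open>2R\<close> on the variation of dyadic averages
  (\<open>BV_dyadic_TV\<close>), proved by testing with smooth approximations of the relevant step functions.
  Together with the bound that integrability to the power \<open>p\<close> gives for single Haar coefficients it also
  yields the decay of the tails (\<open>haar_tail_exists\<close>).
\<close>

section \<open>Hellinger distances of measures with densities\<close>

lemma sq_diff_le: "(p - q)\<^sup>2 \<le> 2 * p\<^sup>2 + 2 * (q::real)\<^sup>2"
  using zero_le_power2[of "p + q"] by (simp add: power2_eq_square algebra_simps)

lemma square_integrable_diff:
  fixes p q :: "'a \<Rightarrow> real"
  assumes [measurable]: "p \<in> borel_measurable M" "q \<in> borel_measurable M"
    and i: "integrable M (\<lambda>x. (p x)\<^sup>2)" "integrable M (\<lambda>x. (q x)\<^sup>2)"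
  shows "integrable M (\<lambda>x. (p x - q x)\<^sup>2)"
proof (rule Bochner_Integration.integrable_bound)
  show "integrable M (\<lambda>x. 2 * (p x)\<^sup>2 + 2 * (q x)\<^sup>2)" using i by simp
  show "AE x in M. norm ((p x - q x)\<^sup>2) \<le> norm (2 * (p x)\<^sup>2 + 2 * (q x)\<^sup>2)"
    by (intro AE_I2) (simp add: sq_diff_le)
qed measurable

text \<open>
  The Hellinger integral does not depend on the dominating measure. Here it is moved from
  \<^term>\<open>measure_sum\<close> of the two measures to a measure \<open>M\<close> that may carry more mass; this is what
  allows three measures to be compared on one common \<open>M\<close>.
\<close>

lemma hellinger_density:
  fixes f g :: "'a \<Rightarrow> real"
  assumes f: "integrable M f" "\<And>x. 0 \<le> f x" and g: "integrable M g" "\<And>x. 0 \<le> g x"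
  shows "hellinger (density M (\<lambda>x. ennreal (f x))) (density M (\<lambda>x. ennreal (g x)))
    = sqrt (1/2 * (\<integral>x. (sqrt (f x) - sqrt (g x))\<^sup>2 \<partial>M))"
proof -
  have [measurable]: "f \<in> borel_measurable M" "g \<in> borel_measurable M"
    using f g by auto
  define w where "w x = f x + g x" for x
  have [measurable]: "w \<in> borel_measurable M" unfolding w_def by measurable
  have w0: "w x \<ge> 0" for x using f g by (simp add: w_def)
  define N where "N = density M (\<lambda>x. ennreal (w x))"
  have N: "measure_sum (density M (\<lambda>x. ennreal (f x))) (density M (\<lambda>x. ennreal (g x))) = N"
    unfolding N_def w_def using f g
    by (subst measure_sum_density) (auto simp: ennreal_plus[symmetric] simp del: ennreal_plus)
  have "integrable M w" using f g unfolding w_def by auto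
  then have "finite_measure N" unfolding N_def
    using w0 by (intro finite_measureI) (auto simp: emeasure_density real_integrable_def)
  then interpret finite_measure N .
  have rn: "AE x in N. RN_deriv N (density M (\<lambda>x. ennreal (v x))) x = ennreal (v x / w x)"
    if [measurable]: "v \<in> borel_measurable M" and v: "\<And>x. 0 \<le> v x" "\<And>x. v x \<le> w x" for v
  proof -
    have "ennreal (w x) * ennreal (v x / w x) = ennreal (v x)" for x
      using v[of x] w0[of x] by (cases "w x = 0") (auto simp: ennreal_mult'[symmetric])
    then have "density N (\<lambda>x. ennreal (v x / w x)) = density M (\<lambda>x. ennreal (v x))"
      unfolding N_def by (subst density_density_eq) auto
    moreover have "(\<lambda>x. ennreal (v x / w x)) \<in> borel_measurable N" unfolding N_def by simp
    ultimately show ?thesis by (auto intro!: AE_symmetric[OF RN_deriv_unique])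
  qed
  have rnf: "AE x in N. RN_deriv N (density M (\<lambda>x. ennreal (f x))) x = ennreal (f x / w x)"
    and rng: "AE x in N. RN_deriv N (density M (\<lambda>x. ennreal (g x))) x = ennreal (g x / w x)"
    using f g by (auto intro!: rn) (auto simp: w_def)
  have "hellinger_sq_wrt N (density M (\<lambda>x. ennreal (f x))) (density M (\<lambda>x. ennreal (g x)))
     = 1/2 * (\<integral>x. (sqrt (f x / w x) - sqrt (g x / w x))\<^sup>2 \<partial>N)"
    unfolding hellinger_sq_wrt_def
  proof (intro arg_cong2[where f="(*)"] refl integral_cong_AE)
    show "AE x in N. (sqrt (enn2real (RN_deriv N (density M (\<lambda>x. ennreal (f x))) x))
         - sqrt (enn2real (RN_deriv N (density M (\<lambda>x. ennreal (g x))) x)))\<^sup>2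
      = (sqrt (f x / w x) - sqrt (g x / w x))\<^sup>2"
      using rnf rng by eventually_elim (use f g w0 in simp)
  qed (auto simp: N_def)
  also have "\<dots> = 1/2 * (\<integral>x. w x * (sqrt (f x / w x) - sqrt (g x / w x))\<^sup>2 \<partial>M)"
    unfolding N_def using w0 by (subst integral_density) auto
  also have "(\<lambda>x. w x * (sqrt (f x / w x) - sqrt (g x / w x))\<^sup>2) = (\<lambda>x. (sqrt (f x) - sqrt (g x))\<^sup>2)"
  proof
    fix x
    show "w x * (sqrt (f x / w x) - sqrt (g x / w x))\<^sup>2 = (sqrt (f x) - sqrt (g x))\<^sup>2"
    proof (cases "w x = 0")
      case True
      then have "f x = 0 \<and> g x = 0" using f(2)[of x] g(2)[of x] by (simp add: w_def)
      then show ?thesis by simp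
    next
      case False
      with w0[of x] have "w x > 0" by simp
      then show ?thesis
        by (simp add: real_sqrt_divide diff_divide_distrib[symmetric] power_divide)
    qed
  qed
  finally show ?thesis by (simp add: hellinger_def N)
qed

section \<open>The likelihood ratio of two points inside a segment\<close>

text \<open>
  With \<open>a = sqrt t\<close> and \<open>b = sqrt u\<close> this is \<open>w / v\<close> for the points \<open>v = (3a + b)/4\<close> and
  \<open>w = (a + 3b)/4\<close> of the segment from \<open>a\<close> to \<open>b\<close> in \<open>L\<^sub>2\<close>. Moving away from the end points bounds
  the ratio by \<open>1/3\<close> and \<open>3\<close>, which makes the test robust. The value 1 where both intensities
  vanish matters: a measure that is not absolutely continuous may put points there.
\<close>

definition lr_ratio :: "(point \<Rightarrow> real) \<Rightarrow> (point \<Rightarrow> real) \<Rightarrow> point \<Rightarrow> real" where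
  "lr_ratio t u x = (if sqrt (t x) + sqrt (u x) = 0 then 1
     else (sqrt (t x) + 3 * sqrt (u x)) / (3 * sqrt (t x) + sqrt (u x)))"

text \<open>
  Half of the difference of the squared norms of \<open>w\<close> and \<open>v\<close>.
\<close>

definition lr_center :: "(point \<Rightarrow> real) \<Rightarrow> (point \<Rightarrow> real) \<Rightarrow> real" where
  "lr_center t u = (\<integral>x. u x - t x \<partial>lam) / 4"

lemma ratio_bounds:
  assumes "0 \<le> p" "0 \<le> q" "p + q \<noteq> (0::real)"
  shows "1/3 \<le> (p + 3 * q) / (3 * p + q)" "(p + 3 * q) / (3 * p + q) \<le> 3"
proof -
  have "0 < 3 * p + q" using assms by linarith
  then show "1/3 \<le> (p + 3 * q) / (3 * p + q)" "(p + 3 * q) / (3 * p + q) \<le> 3"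
    using assms by (simp_all add: pos_le_divide_eq pos_divide_le_eq)
qed

lemma lr_ratio_bounds:
  assumes "0 \<le> t x" "0 \<le> u x"
  shows "1/3 \<le> lr_ratio t u x" "lr_ratio t u x \<le> 3"
proof -
  show "1/3 \<le> lr_ratio t u x" "lr_ratio t u x \<le> 3"
    using ratio_bounds[of "sqrt (t x)" "sqrt (u x)"] assms by (auto simp: lr_ratio_def)
qed

lemma lr_ratio_swap:
  assumes "0 \<le> t x" "0 \<le> u x"
  shows "lr_ratio u t x = inverse (lr_ratio t u x)"
  using assms by (auto simp: lr_ratio_def add.commute)

lemma lr_center_swap: "integrable lam t \<Longrightarrow> integrable lam u \<Longrightarrow> lr_center u t = - lr_center t u"
  by (simp add: lr_center_def Bochner_Integration.integral_diff field_simps)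

text \<open>
  Expanding \<open>f\<^sup>2\<close> around \<open>v\<^sup>2\<close> gives two terms that are linear in the ratio and thus computable
  through \<open>w = r v\<close>, and the term \<open>(r - 1)(f - v)\<^sup>2\<close>, for which \<open>r \<le> 3\<close> is used. The weights \<open>1/4\<close> and
  \<open>3/4\<close> are such that all terms that contain \<open>f\<close> recombine into \<open>2(f - a)\<^sup>2\<close>. The factor \<open>l\<close> is the
  square root of the density of Lebesgue measure with respect to a dominating measure.
\<close>

lemma lr_ratio_pointwise:
  fixes f l :: real
  assumes t: "0 \<le> t x" "0 \<le> u x" and l: "0 \<le> l"
  defines "a \<equiv> l * sqrt (t x)" and "b \<equiv> l * sqrt (u x)"
  shows "(lr_ratio t u x - 1) * f\<^sup>2
     \<le> (b\<^sup>2 - a\<^sup>2) / 4 - (b - a)\<^sup>2 / 4 + 2 * (f - a)\<^sup>2"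
proof -
  define r where "r = lr_ratio t u x"
  have r: "r \<le> 3" using lr_ratio_bounds[of t x u] t by (simp add: r_def)
  have ra: "r * (3 * a + b) = a + 3 * b"
  proof (cases "sqrt (t x) + sqrt (u x) = 0")
    case True
    then have "t x = 0" "u x = 0" using t by (auto simp: add_nonneg_eq_0_iff)
    then show ?thesis by (simp add: a_def b_def)
  next
    case False
    then have "3 * sqrt (t x) + sqrt (u x) \<noteq> 0" using t by (auto simp: add_nonneg_eq_0_iff)
    then show ?thesis using False by (simp add: r_def lr_ratio_def a_def b_def field_simps)
  qed
  define v where "v = (3 * a + b) / 4"
  have rv: "r * v = (a + 3 * b) / 4" using ra by (simp add: v_def)
  have "(r - 1) * f\<^sup>2 = (r - 1) * v * (v + 2 * (f - v)) + (r - 1) * (f - v)\<^sup>2"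
    by (simp add: power2_eq_square algebra_simps)
  also have "(r - 1) * v = (b - a) / 2" using rv by (simp add: left_diff_distrib v_def field_simps)
  also have "(r - 1) * (f - v)\<^sup>2 \<le> 2 * (f - v)\<^sup>2"
    using r by (intro mult_right_mono) auto
  also have "(b - a) / 2 * (v + 2 * (f - v)) + 2 * (f - v)\<^sup>2
    = (b\<^sup>2 - a\<^sup>2) / 4 - (b - a)\<^sup>2 / 4 + 2 * (f - a)\<^sup>2"
    by (simp add: v_def power2_eq_square field_simps)
  finally show ?thesis by (simp add: r_def)
qed


lemma emeasure_measure_sum:
  assumes s: "sets \<mu>' = sets \<mu>" and A: "A \<in> sets \<mu>"
  shows "emeasure (measure_sum \<mu> \<mu>') A = emeasure \<mu> A + emeasure \<mu>' A"
proof (rule emeasure_measure_of[OF measure_sum_def])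
  have ss: "sets (measure_sum \<mu> \<mu>') = sets \<mu>"
    unfolding measure_sum_def by (simp add: sets.sigma_sets_eq)
  show "sets \<mu> \<subseteq> Pow (space \<mu>)" by (rule sets.space_closed)
  show "A \<in> sets (measure_sum \<mu> \<mu>')" using ss A by simp
  show "positive (sets (measure_sum \<mu> \<mu>')) (\<lambda>A. emeasure \<mu> A + emeasure \<mu>' A)"
    by (simp add: positive_def)
  show "countably_additive (sets (measure_sum \<mu> \<mu>')) (\<lambda>A. emeasure \<mu> A + emeasure \<mu>' A)"
    unfolding countably_additive_def
    using ss s by (auto simp: suminf_add[symmetric] suminf_emeasure)
qed

lemma sets_measure_sum: "sets (measure_sum \<mu> \<mu>') = sets \<mu>"
  unfolding measure_sum_def by (simp add: sets.sigma_sets_eq)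

lemma finite_measure_real_density:
  assumes n: "finite_measure \<nu>" and m: "finite_measure \<mu>"
    and s: "sets \<mu> = sets \<nu>" and le: "\<And>A. A \<in> sets \<nu> \<Longrightarrow> emeasure \<mu> A \<le> emeasure \<nu> A"
  obtains f :: "'a \<Rightarrow> real" where "f \<in> borel_measurable \<nu>" "\<And>x. 0 \<le> f x" "integrable \<nu> f"
    "\<mu> = density \<nu> (\<lambda>x. ennreal (f x))"
proof -
  interpret n: finite_measure \<nu> by fact
  interpret m: finite_measure \<mu> by fact
  have ac: "absolutely_continuous \<nu> \<mu>"
    unfolding absolutely_continuous_def using le s by (force simp: null_sets_def)
  have fin: "AE x in \<nu>. RN_deriv \<nu> \<mu> x \<noteq> \<infinity>"
    using n.RN_deriv_finite[OF m.sigma_finite_measure_axioms ac s] by simp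
  let ?f = "\<lambda>x. enn2real (RN_deriv \<nu> \<mu> x)"
  \<comment> \<open>finiteness of the measure makes the derivative finite almost everywhere, so it may be taken real\<close>
  have "density \<nu> (\<lambda>x. ennreal (?f x)) = density \<nu> (RN_deriv \<nu> \<mu>)"
    by (rule density_cong) (use fin in \<open>auto simp: less_top\<close>)
  also have "\<dots> = \<mu>" by (rule n.density_RN_deriv[OF ac s])
  finally have d: "\<mu> = density \<nu> (\<lambda>x. ennreal (?f x))" by simp
  have "(\<integral>\<^sup>+x. ennreal (?f x) \<partial>\<nu>) = emeasure \<mu> (space \<nu>)"
    by (subst d) (simp add: emeasure_density cong: nn_integral_cong)
  also have "\<dots> < \<infinity>" by (simp add: less_top[symmetric])
  finally have "integrable \<nu> ?f" by (intro integrableI_nonneg) auto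
  then show ?thesis by (intro that[OF _ _ _ d]) simp_all
qed

lemma finite_measure_lam: "finite_measure lam"
proof (rule finite_measureI)
  have "emeasure lborel unit_square \<le> emeasure lborel (cbox (0,0) (1,1) :: point set)"
  proof (rule emeasure_mono)
    show "unit_square \<subseteq> cbox (0,0) (1,1)" by (auto simp: unit_square_def cbox_Pair_eq)
  qed simp
  also have "\<dots> < \<infinity>" by (rule emeasure_lborel_cbox_finite)
  finally show "emeasure lam (space lam) \<noteq> \<infinity>"
    by (simp add: space_lam) (simp add: lam_def emeasure_restrict_space unit_square_def borel_prod[symmetric])
qed

lemma hellinger_sq_eq:
  assumes "hellinger \<mu> \<mu>' = sqrt (1/2 * I)" "0 \<le> I"
  shows "(hellinger \<mu> \<mu>')\<^sup>2 = I / 2"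
  using assms by simp

text \<open>
  The exponent in the Chernoff bound of the test. Integrating the pointwise inequality against a
  measure that dominates both \<open>\<mu>\<close> and Lebesgue measure gives
  \<open>lr_center - H\<^sup>2(t,u)/2 + 4 H\<^sup>2(\<mu>,t)\<close>, and the last term is at most \<open>H\<^sup>2(t,u)/4\<close>. The measure \<open>\<mu>\<close> may have
  a singular part.
\<close>

lemma lr_ratio_drift:
  assumes mu: "\<mu> \<in> finite_measures"
    and t: "integrable lam t" "\<And>x. 0 \<le> t x" and u: "integrable lam u" "\<And>x. 0 \<le> u x"
    and near: "hellinger \<mu> (intensity_measure t) \<le> hell t u / 4"
  shows "(\<integral>x. lr_ratio t u x - 1 \<partial>\<mu>) - lr_center t u \<le> - (hell t u)\<^sup>2 / 4"
proof -
  have sm: "sets \<mu> = sets lam" and fm: "finite_measure \<mu>" using mu by (auto simp: finite_measures_def)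
  interpret m: finite_measure \<mu> by fact
  interpret l: finite_measure lam by (rule finite_measure_lam)
  define \<nu> where "\<nu> = measure_sum \<mu> lam"
  have sn: "sets \<nu> = sets \<mu>" by (simp add: \<nu>_def sets_measure_sum)
  have en: "emeasure \<nu> A = emeasure \<mu> A + emeasure lam A" if "A \<in> sets lam" for A
    unfolding \<nu>_def by (rule emeasure_measure_sum) (use sm that in auto)
  have spm: "space \<mu> = space lam" "space \<nu> = space lam"
    using sets_eq_imp_space_eq[OF sm] sets_eq_imp_space_eq[OF sn] by auto
  have fn: "finite_measure \<nu>"
    using m.emeasure_finite[of "space lam"] l.emeasure_finite[of "space lam"]
    by (intro finite_measureI) (simp add: en spm)
  have le_mu: "emeasure \<mu> A \<le> emeasure \<nu> A" and le_lam: "emeasure lam A \<le> emeasure \<nu> A"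
    if "A \<in> sets \<nu>" for A
    using that en[of A] sm sn by simp_all
  obtain f where f[measurable]: "f \<in> borel_measurable \<nu>" and f0: "\<And>x. 0 \<le> f x"
    and fi: "integrable \<nu> f" and fd: "\<mu> = density \<nu> (\<lambda>x. ennreal (f x))"
    using finite_measure_real_density[OF fn fm sn[symmetric] le_mu] by blast
  obtain l where l[measurable]: "l \<in> borel_measurable \<nu>" and l0: "\<And>x. 0 \<le> l x"
    and li: "integrable \<nu> l" and ld: "lam = density \<nu> (\<lambda>x. ennreal (l x))"
    using finite_measure_real_density[OF fn finite_measure_lam _ le_lam] sm sn by blast
  have meas: "borel_measurable lam = (borel_measurable \<nu> :: (point \<Rightarrow> real) set)"
    by (rule measurable_cong_sets) (use sm sn in auto)
  have tm[measurable]: "t \<in> borel_measurable \<nu>" and um[measurable]: "u \<in> borel_measurable \<nu>"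
    using t u meas by auto
  have lam_int: "integral\<^sup>L lam h = (\<integral>x. l x * h x \<partial>\<nu>)" "integrable lam h \<longleftrightarrow> integrable \<nu> (\<lambda>x. l x * h x)"
    if [measurable]: "h \<in> borel_measurable \<nu>" for h :: "point \<Rightarrow> real"
  proof -
    show "integral\<^sup>L lam h = (\<integral>x. l x * h x \<partial>\<nu>)"
      by (subst ld, subst integral_density) (use l0 in auto)
    show "integrable lam h \<longleftrightarrow> integrable \<nu> (\<lambda>x. l x * h x)"
      by (subst ld, subst integrable_density) (use l0 in auto)
  qed
  have lt: "integrable \<nu> (\<lambda>x. l x * t x)" and lu: "integrable \<nu> (\<lambda>x. l x * u x)"
    using t u lam_int(2) tm um by auto
  define a where "a x = sqrt (l x) * sqrt (t x)" for x
  define b where "b x = sqrt (l x) * sqrt (u x)" for x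
  have am[measurable]: "a \<in> borel_measurable \<nu>" "b \<in> borel_measurable \<nu>"
    unfolding a_def b_def by measurable
  have a2: "(a x)\<^sup>2 = l x * t x" and b2: "(b x)\<^sup>2 = l x * u x" for x
    using l0 t u by (auto simp: a_def b_def power_mult_distrib)
  have ia: "integrable \<nu> (\<lambda>x. (a x)\<^sup>2)" and ib: "integrable \<nu> (\<lambda>x. (b x)\<^sup>2)"
    using lt lu by (simp_all add: a2 b2)
  have if2: "integrable \<nu> (\<lambda>x. (sqrt (f x))\<^sup>2)" using fi f0 by simp
  define If where "If = (\<integral>x. (sqrt (f x) - a x)\<^sup>2 \<partial>\<nu>)"
  define Ib where "Ib = (\<integral>x. (b x - a x)\<^sup>2 \<partial>\<nu>)"
  have It: "intensity_measure t = density \<nu> (\<lambda>x. ennreal (l x * t x))"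
    unfolding intensity_measure_def
    by (subst ld, subst density_density_eq) (use l0 t in \<open>auto simp: ennreal_mult'\<close>)
  have h1: "(hellinger \<mu> (intensity_measure t))\<^sup>2 = If / 2"
  proof (rule hellinger_sq_eq)
    show "hellinger \<mu> (intensity_measure t) = sqrt (1/2 * If)"
      unfolding It If_def a_def
      by (subst fd, subst hellinger_density) (use fi f0 lt l0 t in \<open>auto simp: real_sqrt_mult\<close>)
    show "0 \<le> If" by (simp add: If_def)
  qed
  have h2: "(hell t u)\<^sup>2 = Ib / 2"
  proof -
    have "hell t u = sqrt (1/2 * (\<integral>x. (sqrt (t x) - sqrt (u x))\<^sup>2 \<partial>lam))"
      by (rule hell_eq) (use t u in \<open>auto simp: L1_plus_def\<close>)
    also have "(\<integral>x. (sqrt (t x) - sqrt (u x))\<^sup>2 \<partial>lam) = Ib"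
      unfolding Ib_def
    proof (subst lam_int(1))
      have "l x * (sqrt (t x) - sqrt (u x))\<^sup>2 = (b x - a x)\<^sup>2" for x
      proof -
        have "b x - a x = sqrt (l x) * (sqrt (u x) - sqrt (t x))"
          by (simp add: a_def b_def right_diff_distrib)
        then show ?thesis using l0[of x] by (simp add: power_mult_distrib power2_commute)
      qed
      then show "(\<integral>x. l x * (sqrt (t x) - sqrt (u x))\<^sup>2 \<partial>\<nu>) = (\<integral>x. (b x - a x)\<^sup>2 \<partial>\<nu>)" by simp
    qed measurable
    finally show ?thesis by (simp add: Ib_def)
  qed
  have hn: "0 \<le> hellinger \<mu> (intensity_measure t)"
    by (simp add: hellinger_def hellinger_sq_wrt_def)
  have "(hellinger \<mu> (intensity_measure t))\<^sup>2 \<le> (hell t u / 4)\<^sup>2"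
    by (rule power_mono[OF near hn])
  then have le: "If \<le> Ib / 16" using h1 h2 by (simp add: power_divide)
  have c: "lr_center t u = (\<integral>x. (b x)\<^sup>2 - (a x)\<^sup>2 \<partial>\<nu>) / 4"
    unfolding lr_center_def by (subst lam_int(1)) (auto simp: a2 b2 right_diff_distrib)
  have rm[measurable]: "lr_ratio t u \<in> borel_measurable \<nu>"
    unfolding lr_ratio_def[abs_def] by measurable
  have "(\<integral>x. lr_ratio t u x - 1 \<partial>\<mu>) = (\<integral>x. f x * (lr_ratio t u x - 1) \<partial>\<nu>)"
    by (subst fd, subst integral_density) (use f0 in auto)
  also have "\<dots> \<le> (\<integral>x. ((b x)\<^sup>2 - (a x)\<^sup>2) / 4 - (b x - a x)\<^sup>2 / 4 + 2 * (sqrt (f x) - a x)\<^sup>2 \<partial>\<nu>)"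
  proof (rule integral_mono)
    show "integrable \<nu> (\<lambda>x. f x * (lr_ratio t u x - 1))"
    proof (rule Bochner_Integration.integrable_bound)
      show "integrable \<nu> (\<lambda>x. 2 * f x)" using fi by simp
      have "\<bar>lr_ratio t u x - 1\<bar> \<le> 2" for x
        using lr_ratio_bounds[of t x u] t u by (auto simp: abs_if)
      then show "AE x in \<nu>. norm (f x * (lr_ratio t u x - 1)) \<le> norm (2 * f x)"
        using f0 by (intro AE_I2) (simp add: abs_mult mult.commute mult_left_mono)
    qed measurable
    show "integrable \<nu> (\<lambda>x. ((b x)\<^sup>2 - (a x)\<^sup>2) / 4 - (b x - a x)\<^sup>2 / 4 + 2 * (sqrt (f x) - a x)\<^sup>2)"
      using ia ib if2 by (auto intro!: square_integrable_diff Bochner_Integration.integrable_add Bochner_Integration.integrable_diff)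
    show "f x * (lr_ratio t u x - 1)
      \<le> ((b x)\<^sup>2 - (a x)\<^sup>2) / 4 - (b x - a x)\<^sup>2 / 4 + 2 * (sqrt (f x) - a x)\<^sup>2" for x
      using lr_ratio_pointwise[of t x u "sqrt (l x)" "sqrt (f x)"] t u l0 f0
      by (simp add: a_def b_def mult.commute)
  qed
  also have "\<dots> = lr_center t u - Ib / 4 + 2 * If"
  proof -
    have "integrable \<nu> (\<lambda>x. (b x - a x)\<^sup>2)" "integrable \<nu> (\<lambda>x. (sqrt (f x) - a x)\<^sup>2)"
      using ia ib if2 by (auto intro!: square_integrable_diff)
    then show ?thesis unfolding c Ib_def If_def using ia ib by simp
  qed
  finally show ?thesis using le h2 by (simp add: field_simps)
qed


section \<open>Exponential moments of Poisson processes\<close>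

lemma measurable_config_count:
  assumes "A \<in> sets lam"
  shows "(\<lambda>X. size (filter_mset (\<lambda>x. x \<in> A) X)) \<in> config_space \<rightarrow>\<^sub>M count_space UNIV"
proof (subst measurable_count_space_eq2_countable, safe)
  fix n
  have "(\<lambda>X. size (filter_mset (\<lambda>x. x \<in> A) X)) -` {n} \<inter> space config_space
    = {X. set_mset X \<subseteq> unit_square \<and> size (filter_mset (\<lambda>x. x \<in> A) X) = n}"
    by (auto simp: space_config)
  also have "\<dots> \<in> sets config_space"
    unfolding config_space_def using assms config_space_generator
    by (subst sets_measure_of) (auto intro!: sigma_sets.Basic)
  finally show "(\<lambda>X. size (filter_mset (\<lambda>x. x \<in> A) X)) -` {n} \<inter> space config_space \<in> sets config_space" .
qed auto

text \<open>
  The \<open>\<sigma>\<close>-algebra is generated by counting maps, which are the sums of indicators; the general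
  case follows by the usual induction over nonnegative measurable functions.
\<close>

lemma measurable_config_sum_ennreal:
  fixes g :: "point \<Rightarrow> ennreal"
  assumes "g \<in> borel_measurable lam"
  shows "(\<lambda>X. \<Sum>x\<in>#X. g x) \<in> borel_measurable config_space"
  using assms
proof (induction rule: borel_measurable_induct)
  case (cong f g)
  have "(\<Sum>x\<in>#X. f x) = (\<Sum>x\<in>#X. g x)" if "X \<in> space config_space" for X
    using cong(3) that
    by (intro arg_cong[where f=sum_mset] image_mset_cong) (auto simp: space_config space_lam)
  then show ?case using cong(4) by (subst measurable_cong) auto
next
  case (set A)
  have "(\<Sum>x\<in>#X. indicator A x :: ennreal) = of_nat (size (filter_mset (\<lambda>x. x \<in> A) X))" for X
    by (induction X) (auto simp: indicator_def)
  then show ?case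
    using measurable_compose[OF measurable_config_count[OF set], of of_nat "borel :: ennreal measure"]
    by simp
next
  case (mult u c)
  have "(\<Sum>x\<in>#X. c * u x) = c * (\<Sum>x\<in>#X. u x)" for X
    by (simp add: sum_mset_distrib_left)
  then show ?case using mult by simp
next
  case (add u v)
  have "(\<Sum>x\<in>#X. v x + u x) = (\<Sum>x\<in>#X. v x) + (\<Sum>x\<in>#X. u x)" for X
    by (simp add: sum_mset.distrib)
  then show ?case using add by simp
next
  case (seq U)
  have U_mono: "U i x \<le> U j x" if "i \<le> j" for i j x
    by (rule le_funD[OF incseqD[OF seq(3) that]])
  have inc: "incseq (\<lambda>i. \<Sum>x\<in>#X. U i x)" for X
    by (intro monoI sum_mset_mono U_mono)
  have "(\<Sum>x\<in>#X. (SUP i. U i) x) = (SUP i. \<Sum>x\<in>#X. U i x)" for X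
  proof (induction X)
    case (add a X)
    have "incseq (\<lambda>i. U i a)" by (intro monoI U_mono)
    then show ?case using add inc[of X] by (simp add: ennreal_SUP_add image_comp)
  qed simp
  then show ?case using seq by simp
qed

lemma measurable_config_sum:
  fixes g :: "point \<Rightarrow> real"
  assumes [measurable]: "g \<in> borel_measurable lam"
  shows "(\<lambda>X. \<Sum>x\<in>#X. g x) \<in> borel_measurable config_space"
proof -
  have p: "0 \<le> (\<Sum>x\<in>#X. max 0 (h x))" for h :: "point \<Rightarrow> real" and X
    by (induction X) auto
  have e: "(\<Sum>x\<in>#X. ennreal (h x)) = ennreal (\<Sum>x\<in>#X. max 0 (h x))" for h :: "point \<Rightarrow> real" and X
  proof (induction X)
    case (add a X)
    have 1: "ennreal (h a) = ennreal (max 0 (h a))" by (simp add: max_def ennreal_neg)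
    have "(\<Sum>x\<in>#add_mset a X. ennreal (h x)) = ennreal (h a) + (\<Sum>x\<in>#X. ennreal (h x))"
      by simp
    also have "\<dots> = ennreal (max 0 (h a)) + ennreal (\<Sum>x\<in>#X. max 0 (h x))"
      by (simp only: add 1)
    also have "\<dots> = ennreal (max 0 (h a) + (\<Sum>x\<in>#X. max 0 (h x)))"
      by (rule ennreal_plus[symmetric]) (use p in auto)
    finally show ?case by simp
  qed simp
  have "(\<lambda>X. enn2real (\<Sum>x\<in>#X. ennreal (g x)) - enn2real (\<Sum>x\<in>#X. ennreal (- g x)))
    \<in> borel_measurable config_space"
    by (intro borel_measurable_diff measurable_compose[OF measurable_config_sum_ennreal]) auto
  moreover have "enn2real (\<Sum>x\<in>#X. ennreal (g x)) - enn2real (\<Sum>x\<in>#X. ennreal (- g x))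
    = (\<Sum>x\<in>#X. g x)" for X
  proof -
    have "(\<Sum>x\<in>#X. max 0 (g x)) - (\<Sum>x\<in>#X. max 0 (- g x)) = (\<Sum>x\<in>#X. g x)"
      by (induction X) (auto simp: max_def)
    then show ?thesis using p by (simp add: e)
  qed
  ultimately show ?thesis by simp
qed

text \<open>
  Given \<open>N\<close> points, the independent points contribute the \<open>N\<close>-th power of one mean value; summing
  against the Poisson weights gives an exponential series.
\<close>

lemma poisson_laplace:
  assumes mu: "\<mu> \<in> finite_measures" and [measurable]: "\<phi> \<in> borel_measurable lam"
    and b: "\<And>x. \<bar>\<phi> x\<bar> \<le> b"
  shows "(\<integral>\<^sup>+X. ennreal (exp (\<Sum>x\<in>#X. \<phi> x)) \<partial>poisson_process \<mu>)
    = ennreal (exp (\<integral>x. exp (\<phi> x) - 1 \<partial>\<mu>))"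
proof -
  have sm: "sets \<mu> = sets lam" and fm: "finite_measure \<mu>" using mu by (auto simp: finite_measures_def)
  interpret finite_measure \<mu> by fact
  have meas: "borel_measurable lam = (borel_measurable \<mu> :: (point \<Rightarrow> real) set)"
    by (rule measurable_cong_sets) (use sm in auto)
  have [measurable]: "\<phi> \<in> borel_measurable \<mu>" using assms(2) meas by simp
  have [measurable]: "(\<lambda>X. \<Sum>x\<in>#X. \<phi> x) \<in> borel_measurable config_space"
    by (rule measurable_config_sum) fact
  have bnd: "exp (\<phi> x) \<le> exp b" for x using b[of x] by simp
  have int: "integrable \<mu> (\<lambda>x. exp (\<phi> x))"
    by (rule integrable_const_bound[where B="exp b"]) (use bnd in auto)
  show ?thesis
  proof (cases "measure \<mu> (space \<mu>) = 0")
    case True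
    then have "emeasure \<mu> (space \<mu>) = 0" by (simp add: emeasure_eq_measure)
    then have "AE x in \<mu>. False" by (intro AE_I[where N="space \<mu>"]) auto
    then have "(\<integral>x. exp (\<phi> x) - 1 \<partial>\<mu>) = (\<integral>x. 0 \<partial>\<mu>)"
      by (intro integral_cong_AE) auto
    moreover have "(\<integral>\<^sup>+X. ennreal (exp (\<Sum>x\<in>#X. \<phi> x)) \<partial>return config_space {#}) = 1"
      by (subst nn_integral_return) (auto simp: space_config)
    ultimately show ?thesis using True by (simp add: poisson_process_def)
  next
    case False
    define m where "m = measure \<mu> (space \<mu>)"
    have m0: "m > 0" using False by (simp add: m_def zero_less_measure_iff)
    define q where "q = (\<integral>x. exp (\<phi> x) \<partial>\<mu>) / m"
    have q0: "0 \<le> q" using m0 by (simp add: q_def)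
    let ?U = "uniform_measure \<mu> (space \<mu>)"
    let ?P = "\<Pi>\<^sub>M i\<in>(UNIV :: nat set). ?U"
    let ?N = "measure_pmf (poisson_pmf m)"
    have U: "prob_space ?U" by (rule prob_space_uniform_measure) (use False in \<open>auto simp: measure_def\<close>)
    interpret P: product_prob_space "\<lambda>_::nat. ?U" UNIV
      using U by (auto intro!: product_prob_spaceI)
    interpret Q: prob_space ?P by (rule P.prob_space_axioms)
    have qU: "(\<integral>\<^sup>+x. ennreal (exp (\<phi> x)) \<partial>?U) = ennreal q"
    proof -
      have "(\<integral>\<^sup>+x. ennreal (exp (\<phi> x)) \<partial>?U)
        = (\<integral>\<^sup>+x. ennreal (exp (\<phi> x)) * indicator (space \<mu>) x \<partial>\<mu>) / emeasure \<mu> (space \<mu>)"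
        by (rule nn_integral_uniform_measure) auto
      also have "(\<integral>\<^sup>+x. ennreal (exp (\<phi> x)) * indicator (space \<mu>) x \<partial>\<mu>)
        = (\<integral>\<^sup>+x. ennreal (exp (\<phi> x)) \<partial>\<mu>)"
        by (rule nn_integral_cong) auto
      also have "\<dots> = ennreal (\<integral>x. exp (\<phi> x) \<partial>\<mu>)"
        by (rule nn_integral_eq_integral) (use int in auto)
      finally show ?thesis using m0 by (simp add: q_def m_def emeasure_eq_measure divide_ennreal)
    qed
    have inner: "(\<integral>\<^sup>+x. ennreal (exp (\<Sum>y\<in>#mset (map x [0..<n]). \<phi> y)) \<partial>?P) = ennreal q ^ n" for n
    proof -
      have s: "(\<Sum>y\<in>#mset (map x [0..<n]). \<phi> y) = (\<Sum>i<n. \<phi> (x i))" for x :: "nat \<Rightarrow> point"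
        by (induction n) auto
      have "(\<integral>\<^sup>+x. ennreal (exp (\<Sum>y\<in>#mset (map x [0..<n]). \<phi> y)) \<partial>?P)
        = (\<integral>\<^sup>+x. (\<Prod>i<n. ennreal (exp (\<phi> (restrict x {..<n} i)))) \<partial>?P)"
        by (rule nn_integral_cong) (simp only: s, simp add: exp_sum prod_ennreal)
      also have "\<dots> = (\<integral>\<^sup>+x. (\<Prod>i<n. ennreal (exp (\<phi> (x i)))) \<partial>distr ?P (\<Pi>\<^sub>M i\<in>{..<n}. ?U) (\<lambda>x. restrict x {..<n}))"
        by (subst nn_integral_distr) (auto intro!: measurable_restrict_subset)
      also have "\<dots> = (\<integral>\<^sup>+x. (\<Prod>i<n. ennreal (exp (\<phi> (x i)))) \<partial>(\<Pi>\<^sub>M i\<in>{..<n}. ?U))"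
        by (subst P.distr_PiM_restrict_finite) auto
      also have "\<dots> = (\<Prod>i<n. \<integral>\<^sup>+x. ennreal (exp (\<phi> x)) \<partial>?U)"
        by (subst P.product_nn_integral_prod) auto
      finally show ?thesis by (simp add: qU)
    qed
    have mc0: "(\<lambda>(N, x). mset (map x [0..<N])) \<in> count_space UNIV \<Otimes>\<^sub>M ?P \<rightarrow>\<^sub>M config_space"
      by (rule measurable_pair_measure_countable1) (auto intro!: measurable_config[simplified] simp: sm)
    then have mc[measurable]: "(\<lambda>(N, x). mset (map x [0..<N])) \<in> ?N \<Otimes>\<^sub>M ?P \<rightarrow>\<^sub>M config_space"
      by (subst measurable_cong_sets[OF sets_pair_measure_cong[OF sets_measure_pmf_count_space refl] refl])
    let ?F = "\<lambda>(N, x). ennreal (exp (\<Sum>y\<in>#mset (map x [0..<N]). \<phi> y))"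
    have Fm: "?F \<in> borel_measurable (?N \<Otimes>\<^sub>M ?P)"
    proof -
      have "(\<lambda>X. ennreal (exp (\<Sum>x\<in>#X. \<phi> x))) \<in> borel_measurable config_space" by measurable
      from measurable_compose[OF mc this] show ?thesis by (simp add: case_prod_beta')
    qed
    have "(\<integral>\<^sup>+X. ennreal (exp (\<Sum>x\<in>#X. \<phi> x)) \<partial>poisson_process \<mu>)
      = (\<integral>\<^sup>+z. ?F z \<partial>(?N \<Otimes>\<^sub>M ?P))"
      unfolding poisson_process_def m_def[symmetric] using m0
      by (simp only: if_False less_imp_neq[symmetric])
         (subst nn_integral_distr[OF mc], auto simp: case_prod_beta')
    also have "\<dots> = (\<integral>\<^sup>+n. \<integral>\<^sup>+x. ?F (n, x) \<partial>?P \<partial>?N)"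
      by (rule sigma_finite_measure.nn_integral_fst[symmetric, OF prob_space_imp_sigma_finite])
         (rule P.prob_space_axioms, rule Fm)
    also have "\<dots> = (\<integral>\<^sup>+n. ennreal q ^ n \<partial>?N)" using inner by simp
    also have "\<dots> = (\<integral>\<^sup>+n. ennreal (exp (- m) * ((m * q) ^ n / fact n)) \<partial>count_space UNIV)"
      using m0 q0 by (subst nn_integral_measure_pmf)
        (auto simp: ennreal_power ennreal_mult[symmetric] power_mult_distrib field_simps intro!: nn_integral_cong)
    also have "\<dots> = (\<Sum>n. ennreal (exp (- m) * ((m * q) ^ n / fact n)))"
      by (rule nn_integral_count_space_nat)
    also have "\<dots> = ennreal (exp (- m) * exp (m * q))"
    proof -
      have s: "(\<lambda>n. (m * q) ^ n / fact n) sums exp (m * q)"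
        using exp_converges[of "m * q"] by (simp add: divide_inverse mult.commute)
      show ?thesis
        by (rule suminf_ennreal_eq) (use m0 q0 sums_mult[OF s] in auto)
    qed
    also have "exp (- m) * exp (m * q) = exp (\<integral>x. exp (\<phi> x) - 1 \<partial>\<mu>)"
      using m0 int by (simp add: exp_add[symmetric] q_def m_def)
    finally show ?thesis .
  qed
qed

lemma poisson_chernoff:
  assumes mu: "\<mu> \<in> finite_measures" and [measurable]: "\<phi> \<in> borel_measurable lam"
    and b: "\<And>x. \<bar>\<phi> x\<bar> \<le> b"
    and E: "E \<subseteq> {X \<in> space config_space. (\<Sum>x\<in>#X. \<phi> x) \<ge> c}"
  shows "measure (poisson_process \<mu>) E \<le> exp ((\<integral>x. exp (\<phi> x) - 1 \<partial>\<mu>) - c)"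
proof -
  interpret prob_space "poisson_process \<mu>" by (rule prob_space_poisson_process[OF mu])
  have sp: "sets (poisson_process \<mu>) = sets config_space"
    by (simp add: poisson_process_def)
  have spc: "space (poisson_process \<mu>) = space config_space"
    by (rule sets_eq_imp_space_eq[OF sp])
  have m: "(\<lambda>X. \<Sum>x\<in>#X. \<phi> x) \<in> borel_measurable config_space"
    by (rule measurable_config_sum) fact
  have "measurable (poisson_process \<mu>) (borel :: real measure) = measurable config_space borel"
    by (rule measurable_cong_sets[OF sp refl])
  then have [measurable]: "(\<lambda>X. \<Sum>x\<in>#X. \<phi> x) \<in> borel_measurable (poisson_process \<mu>)" using m by simp
  let ?A = "{X \<in> space (poisson_process \<mu>). (\<Sum>x\<in>#X. \<phi> x) \<ge> c}"
  have "emeasure (poisson_process \<mu>) ?A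
    \<le> (\<integral>\<^sup>+X. ennreal (exp (- c)) * ennreal (exp (\<Sum>x\<in>#X. \<phi> x)) \<partial>poisson_process \<mu>)"
  proof -
    have "emeasure (poisson_process \<mu>) ?A = (\<integral>\<^sup>+X. indicator ?A X \<partial>poisson_process \<mu>)"
      by simp
    also have "\<dots> \<le> (\<integral>\<^sup>+X. ennreal (exp (- c)) * ennreal (exp (\<Sum>x\<in>#X. \<phi> x)) \<partial>poisson_process \<mu>)"
      by (intro nn_integral_mono)
         (auto simp: indicator_def ennreal_mult[symmetric] exp_add[symmetric])
    finally show ?thesis .
  qed
  also have "\<dots> = ennreal (exp (- c)) * ennreal (exp (\<integral>x. exp (\<phi> x) - 1 \<partial>\<mu>))"
    using poisson_laplace[OF mu assms(2) b] by (subst nn_integral_cmult) auto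
  also have "\<dots> = ennreal (exp ((\<integral>x. exp (\<phi> x) - 1 \<partial>\<mu>) - c))"
    by (simp add: ennreal_mult[symmetric] exp_diff exp_minus field_simps)
  finally have "measure (poisson_process \<mu>) ?A \<le> exp ((\<integral>x. exp (\<phi> x) - 1 \<partial>\<mu>) - c)"
    by (simp add: emeasure_eq_measure)
  moreover have "measure (poisson_process \<mu>) E \<le> measure (poisson_process \<mu>) ?A"
  proof (rule finite_measure_mono)
    show "E \<subseteq> ?A" using E spc by auto
    show "?A \<in> events" by measurable
  qed
  ultimately show ?thesis by simp
qed


section \<open>The tests\<close>

definition lr_stat :: "(point \<Rightarrow> real) \<Rightarrow> (point \<Rightarrow> real) \<Rightarrow> point multiset \<Rightarrow> real" where
  "lr_stat t u X = (\<Sum>x\<in>#X. ln (lr_ratio t u x)) - lr_center t u"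

text \<open>
  Ties are broken by an injective numbering of the model, because the test has to be a
  function of the unordered pair.
\<close>

definition lr_test :: "((point \<Rightarrow> real) \<Rightarrow> nat) \<Rightarrow> (point \<Rightarrow> real) \<Rightarrow> (point \<Rightarrow> real) \<Rightarrow> point multiset \<Rightarrow> (point \<Rightarrow> real)" where
  "lr_test idx t u X = (if lr_stat t u X > 0 then u else if lr_stat t u X < 0 then t
     else if idx t < idx u then t else u)"

text \<open>
  Intensities that are nonnegative everywhere. The likelihood ratios are evaluated at the points
  of a configuration whose law need not be absolutely continuous, so exceptional null sets are
  not harmless.
\<close>

definition pos_L1 :: "(point \<Rightarrow> real) set" where
  "pos_L1 = {t. integrable lam t \<and> (\<forall>x. 0 \<le> t x)}"

lemma pos_L1D: "t \<in> pos_L1 \<Longrightarrow> integrable lam t" "t \<in> pos_L1 \<Longrightarrow> 0 \<le> t x"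
  unfolding pos_L1_def by blast+

lemma pos_L1_subset: "pos_L1 \<subseteq> L1_plus"
  by (auto simp: pos_L1_def L1_plus_def)

lemma lr_stat_swap:
  assumes "t \<in> pos_L1" "u \<in> pos_L1"
  shows "lr_stat u t X = - lr_stat t u X"
proof -
  have "ln (lr_ratio u t x) = - ln (lr_ratio t u x)" for x
    using assms by (subst lr_ratio_swap) (simp_all add: pos_L1D ln_inverse)
  moreover have "(\<Sum>x\<in>#X. - f x) = - (\<Sum>x\<in>#X. f x :: real)" for f by (induction X) auto
  ultimately show ?thesis
    using lr_center_swap[of t u] assms by (simp add: lr_stat_def pos_L1D)
qed

lemma ln_lr_ratio_bound:
  assumes "t \<in> pos_L1" "u \<in> pos_L1"
  shows "\<bar>ln (lr_ratio t u x)\<bar> \<le> ln 3"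
proof -
  have b: "1/3 \<le> lr_ratio t u x" "lr_ratio t u x \<le> 3"
    using assms lr_ratio_bounds[of t x u] by (simp_all add: pos_L1D)
  then have "ln (1/3) \<le> ln (lr_ratio t u x)" "ln (lr_ratio t u x) \<le> ln 3"
    by (simp_all add: ln_le_cancel_iff)
  then show ?thesis by (simp add: ln_div abs_le_iff)
qed

lemma ln_lr_ratio_measurable:
  assumes "t \<in> pos_L1" "u \<in> pos_L1"
  shows "(\<lambda>x. ln (lr_ratio t u x)) \<in> borel_measurable lam"
proof -
  have [measurable]: "t \<in> borel_measurable lam" "u \<in> borel_measurable lam"
    using assms by (auto simp: pos_L1_def)
  show ?thesis unfolding lr_ratio_def by measurable
qed

lemma lr_stat_error:
  assumes mu: "\<mu> \<in> finite_measures" and tu: "t \<in> pos_L1" "u \<in> pos_L1"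
    and near: "hellinger \<mu> (intensity_measure t) \<le> hell t u / 4"
    and E: "E \<subseteq> {X \<in> space config_space. lr_stat t u X \<ge> 0}"
  shows "measure (poisson_process \<mu>) E \<le> exp (- (hell t u)\<^sup>2 / 4)"
proof -
  have "measure (poisson_process \<mu>) E
    \<le> exp ((\<integral>x. exp (ln (lr_ratio t u x)) - 1 \<partial>\<mu>) - lr_center t u)"
    by (rule poisson_chernoff[OF mu ln_lr_ratio_measurable[OF tu] ln_lr_ratio_bound[OF tu]])
       (use E in \<open>auto simp: lr_stat_def\<close>)
  also have "(\<lambda>x. exp (ln (lr_ratio t u x)) - 1) = (\<lambda>x. lr_ratio t u x - 1)"
  proof
    fix x have "lr_ratio t u x > 0" using lr_ratio_bounds(1)[of t x u] tu by (simp add: pos_L1D)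
    then show "exp (ln (lr_ratio t u x)) - 1 = lr_ratio t u x - 1" by simp
  qed
  also have "exp ((\<integral>x. lr_ratio t u x - 1 \<partial>\<mu>) - lr_center t u) \<le> exp (- (hell t u)\<^sup>2 / 4)"
    using lr_ratio_drift[OF mu _ _ _ _ near] tu by (simp add: pos_L1D)
  finally show ?thesis .
qed

lemma hell_commute: "t \<in> L1_plus \<Longrightarrow> u \<in> L1_plus \<Longrightarrow> hell t u = hell u t"
  by (simp add: hell_eq power2_commute)

text \<open>
  With a constant \<open>e\<close> the penalties cancel, so both error bounds are the Chernoff bound, and the
  right-hand side of the third requirement is at least 1.
\<close>

lemma lr_test_family:
  assumes T: "T \<subseteq> pos_L1" and idx: "inj_on idx T"
  shows "test_family T (\<lambda>_. e) (lr_test idx)"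
  unfolding test_family_def
proof (intro ballI impI conjI)
  fix t u assume t: "t \<in> T" and u: "u \<in> T" and tu: "t \<noteq> u"
  have p: "t \<in> pos_L1" "u \<in> pos_L1" using t u T by auto
  have ne: "idx t \<noteq> idx u" using idx t u tu by (auto dest: inj_onD)
  have [measurable]: "lr_stat t u \<in> borel_measurable config_space"
    unfolding lr_stat_def[abs_def]
    by (intro borel_measurable_diff measurable_config_sum ln_lr_ratio_measurable p) simp
  show "lr_test idx t u \<in> config_space \<rightarrow>\<^sub>M count_space {t, u}"
    unfolding lr_test_def[abs_def] by (intro measurable_If measurable_const) simp_all
  show "lr_test idx t u = lr_test idx u t"
    by (rule ext) (use ne tu lr_stat_swap[OF p] in \<open>auto simp: lr_test_def\<close>)
  fix \<mu> assume mu: "\<mu> \<in> finite_measures"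
  have hc: "hell t u = hell u t" using p pos_L1_subset by (auto intro: hell_commute)
  show "measure (poisson_process \<mu>) {X \<in> space config_space. lr_test idx t u X = u}
      \<le> exp (- ((hell t u)\<^sup>2 - e\<^sup>2 + e\<^sup>2) / 4)"
    if near: "hellinger \<mu> (intensity_measure t) \<le> hell t u / 4"
  proof -
    have "{X \<in> space config_space. lr_test idx t u X = u} \<subseteq> {X \<in> space config_space. lr_stat t u X \<ge> 0}"
      using tu by (auto simp: lr_test_def split: if_splits)
    from lr_stat_error[OF mu p near this] show ?thesis by simp
  qed
  show "measure (poisson_process \<mu>) {X \<in> space config_space. lr_test idx t u X = t}
      \<le> exp (- ((hell t u)\<^sup>2 - e\<^sup>2 + e\<^sup>2) / 4)"
    if near: "hellinger \<mu> (intensity_measure u) \<le> hell t u / 4"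
  proof -
    have "{X \<in> space config_space. lr_test idx t u X = t} \<subseteq> {X \<in> space config_space. lr_stat u t X \<ge> 0}"
      using tu lr_stat_swap[OF p] by (auto simp: lr_test_def split: if_splits)
    from lr_stat_error[OF mu p(2,1) _ this] near hc show ?thesis by simp
  qed
  have "measure (poisson_process \<mu>) {X \<in> space config_space. lr_test idx t u X = u} \<le> 1"
    using prob_space_poisson_process[OF mu] by (rule prob_space.prob_le_1)
  also have "1 \<le> exp ((16 * (hellinger \<mu> (intensity_measure t))\<^sup>2 + e\<^sup>2 - e\<^sup>2) / 4)" by simp
  finally show "measure (poisson_process \<mu>) {X \<in> space config_space. lr_test idx t u X = u}
    \<le> exp ((16 * (hellinger \<mu> (intensity_measure t))\<^sup>2 + e\<^sup>2 - e\<^sup>2) / 4)" .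
qed

section \<open>T-estimators over one model\<close>

lemma hell_sq:
  assumes "t \<in> L1_plus" "u \<in> L1_plus"
  shows "(hell t u)\<^sup>2 = 1/2 * (\<integral>x. (sqrt (t x) - sqrt (u x))\<^sup>2 \<partial>lam)"
  by (simp add: hell_eq[OF assms])

lemma hell_nonneg: "0 \<le> hell t u"
  by (simp add: hell_def hellinger_def hellinger_sq_wrt_def)

lemma L1_plus_sqrt_sq:
  assumes "t \<in> L1_plus"
  shows "integrable lam (\<lambda>x. (sqrt (t x))\<^sup>2)"
proof -
  have "integrable lam t" and p: "AE x in lam. 0 \<le> t x" using assms by (auto simp: L1_plus_def)
  moreover from this have [measurable]: "t \<in> borel_measurable lam" by auto
  moreover have "AE x in lam. t x = (sqrt (t x))\<^sup>2" using p by eventually_elim simp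
  ultimately show ?thesis using integrable_cong_AE[of t lam "\<lambda>x. (sqrt (t x))\<^sup>2"] by simp
qed

text \<open>
  The triangle inequality is needed only up to this factor, which avoids Minkowski's inequality.
\<close>

lemma hell_triangle_sq:
  assumes s: "s \<in> L1_plus" and t: "t \<in> L1_plus" and u: "u \<in> L1_plus"
  shows "(hell s u)\<^sup>2 \<le> 2 * (hell s t)\<^sup>2 + 2 * (hell t u)\<^sup>2"
proof -
  have m: "(\<lambda>x. sqrt (v x)) \<in> borel_measurable lam" if "v \<in> L1_plus" for v
    using that by (auto simp: L1_plus_def)
  have i: "integrable lam (\<lambda>x. (sqrt (v x) - sqrt (w x))\<^sup>2)" if "v \<in> L1_plus" "w \<in> L1_plus" for v w
    using that by (intro square_integrable_diff m L1_plus_sqrt_sq)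
  have "(\<integral>x. (sqrt (s x) - sqrt (u x))\<^sup>2 \<partial>lam)
    \<le> (\<integral>x. 2 * (sqrt (s x) - sqrt (t x))\<^sup>2 + 2 * (sqrt (t x) - sqrt (u x))\<^sup>2 \<partial>lam)"
  proof (rule integral_mono)
    show "(sqrt (s x) - sqrt (u x))\<^sup>2
      \<le> 2 * (sqrt (s x) - sqrt (t x))\<^sup>2 + 2 * (sqrt (t x) - sqrt (u x))\<^sup>2" for x
      using sq_diff_le[of "sqrt (s x) - sqrt (t x)" "sqrt (u x) - sqrt (t x)"]
      by (simp add: power2_commute)
  qed (use i s t u in auto)
  also have "\<dots> = 2 * (\<integral>x. (sqrt (s x) - sqrt (t x))\<^sup>2 \<partial>lam) + 2 * (\<integral>x. (sqrt (t x) - sqrt (u x))\<^sup>2 \<partial>lam)"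
    using i s t u by simp
  finally show ?thesis using s t u by (simp add: hell_sq)
qed

text \<open>
  The parameters are \<open>\<eta> = 10\<close>, \<open>D = B' = 1\<close>, for which \<open>\<eta>\<^sup>2 \<ge> 84 D / 5\<close> holds with room to spare.
\<close>

lemma D_model_10D:
  assumes "D_model L1_plus hell 10 1 1 T" "t \<in> L1_plus" "2 \<le> x"
  shows "finite {u \<in> T. hell t u < x * 10}" "real (card {u \<in> T. hell t u < x * 10}) \<le> exp (x\<^sup>2)"
  using assms by (auto simp: D_model_def)

text \<open>
  Sum over shells: the shell \<open>10 k \<le> H < 10 (k + 1)\<close> has at most \<open>exp ((k + 1)\<^sup>2)\<close> points, each of weight at
  most \<open>exp (-100 k\<^sup>2 / 8)\<close>.
\<close>

lemma D_model_exp_sum: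
  assumes D: "D_model L1_plus hell 10 1 1 T" and t: "t \<in> L1_plus"
    and F: "finite F" "F \<subseteq> {u \<in> T. 20 \<le> hell t u}"
  shows "(\<Sum>u\<in>F. exp (- (hell t u)\<^sup>2 / 8)) \<le> 2"
proof -
  define n where "n u = nat \<lfloor>hell t u / 10\<rfloor>" for u
  have n2: "2 \<le> n u" if "u \<in> F" for u
    using that F(2) unfolding n_def by (subst le_nat_iff) (auto simp: le_floor_iff)
  have nle: "real (n u) \<le> hell t u / 10" "hell t u / 10 < real (n u) + 1" for u
    using hell_nonneg[of t u] of_int_floor_le[of "hell t u / 10"] floor_correct[of "hell t u / 10"]
    unfolding n_def by (simp_all add: of_nat_nat)
  have e1: "exp (- real k) \<le> (1/2) ^ k" for k
  proof -
    have "(2::real) \<le> exp 1" using exp_ge_add_one_self[of 1] by simp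
    then have "exp (- 1) \<le> (1/2::real)" by (simp add: exp_minus field_simps)
    then have "exp (- 1) ^ k \<le> (1/2::real) ^ k" by (rule power_mono) simp
    then show ?thesis by (simp add: exp_of_nat_mult[symmetric])
  qed
  have shell: "(\<Sum>u\<in>{u\<in>F. n u = k}. exp (- (hell t u)\<^sup>2 / 8)) \<le> (1/2) ^ k" if k: "k \<in> n ` F" for k
  proof -
    have k2: "2 \<le> real k" using k n2 by force
    have "(\<Sum>u\<in>{u\<in>F. n u = k}. exp (- (hell t u)\<^sup>2 / 8))
      \<le> (\<Sum>u\<in>{u\<in>F. n u = k}. exp (- (10 * real k)\<^sup>2 / 8))"
    proof (rule sum_mono)
      fix u assume "u \<in> {u\<in>F. n u = k}"
      then have "(10 * real k)\<^sup>2 \<le> (hell t u)\<^sup>2" using nle[of u] by (intro power_mono) auto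
      then show "exp (- (hell t u)\<^sup>2 / 8) \<le> exp (- (10 * real k)\<^sup>2 / 8)" by simp
    qed
    also have "\<dots> = real (card {u\<in>F. n u = k}) * exp (- (10 * real k)\<^sup>2 / 8)" by simp
    also have "real (card {u\<in>F. n u = k}) \<le> exp ((real k + 1)\<^sup>2)"
    proof -
      have "card {u\<in>F. n u = k} \<le> card {u \<in> T. hell t u < (real k + 1) * 10}"
      proof (rule card_mono)
        show "finite {u \<in> T. hell t u < (real k + 1) * 10}"
          by (rule D_model_10D(1)[OF D t]) (use k2 in simp)
        show "{u\<in>F. n u = k} \<subseteq> {u \<in> T. hell t u < (real k + 1) * 10}"
          using nle F by fastforce
      qed
      also have "real (card {u \<in> T. hell t u < (real k + 1) * 10}) \<le> exp ((real k + 1)\<^sup>2)"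
        by (rule D_model_10D(2)[OF D t]) (use k2 in simp)
      finally show ?thesis by simp
    qed
    also have "exp ((real k + 1)\<^sup>2) * exp (- (10 * real k)\<^sup>2 / 8) \<le> exp (- real k)"
    proof -
      have "2 * real k \<le> real k * real k" using k2 by (intro mult_right_mono) auto
      moreover have "(real k + 1)\<^sup>2 = real k * real k + 2 * real k + 1"
        "(10 * real k)\<^sup>2 = 100 * (real k * real k)"
        by (simp_all add: power2_eq_square algebra_simps)
      ultimately have "(real k + 1)\<^sup>2 + - (10 * real k)\<^sup>2 / 8 \<le> - real k"
        using k2 by linarith
      then show ?thesis unfolding exp_add[symmetric] by (simp only: exp_le_cancel_iff)
    qed
    finally show ?thesis using e1[of k] by (simp add: mult_right_mono)
  qed
  have "(\<Sum>u\<in>F. exp (- (hell t u)\<^sup>2 / 8))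
    = (\<Sum>k\<in>n ` F. \<Sum>u\<in>{u\<in>F. n u = k}. exp (- (hell t u)\<^sup>2 / 8))"
    by (rule sum.image_gen[OF F(1)])
  also have "\<dots> \<le> (\<Sum>k\<in>n ` F. (1/2) ^ k)" by (intro sum_mono shell)
  also have "\<dots> \<le> (\<Sum>k. (1/2::real) ^ k)"
    by (rule sum_le_suminf) (use F in \<open>auto intro: summable_geometric\<close>)
  also have "\<dots> = 2" by (subst suminf_geometric) auto
  finally show ?thesis .
qed

text \<open>
  The space is exhausted by countably many balls around one point, each with finitely many points
  of the model.
\<close>

lemma D_model_countable:
  assumes D: "D_model L1_plus hell 10 1 1 T"
  shows "countable T"
proof (cases "T = {}")
  case False
  then obtain t where "t \<in> T" by blast
  then have t: "t \<in> L1_plus" using D by (auto simp: D_model_def)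
  have "T \<subseteq> (\<Union>n::nat. {u \<in> T. hell t u < (real n + 2) * 10})"
  proof
    fix u assume u: "u \<in> T"
    obtain n :: nat where "hell t u < real n" using reals_Archimedean2 by blast
    then have "hell t u < (real n + 2) * 10" by simp
    then show "u \<in> (\<Union>n::nat. {u \<in> T. hell t u < (real n + 2) * 10})" using u by blast
  qed
  moreover have "finite {u \<in> T. hell t u < (real n + 2) * 10}" for n :: nat
    by (rule D_model_10D(1)[OF D t]) simp
  ultimately show ?thesis
    by (meson countable_UN countable_finite countable_subset countableI_type)
qed simp

lemma test_familyD:
  assumes "test_family T e \<psi>" "t \<in> T" "u \<in> T" "t \<noteq> u"
  shows "\<psi> t u \<in> config_space \<rightarrow>\<^sub>M count_space {t, u}" "\<psi> t u = \<psi> u t"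
    "\<And>\<mu>. \<mu> \<in> finite_measures \<Longrightarrow> hellinger \<mu> (intensity_measure t) \<le> hell t u / 4 \<Longrightarrow>
      measure (poisson_process \<mu>) {X\<in>space config_space. \<psi> t u X = u}
            \<le> exp (- ((hell t u)\<^sup>2 - (e t)\<^sup>2 + (e u)\<^sup>2) / 4)"
  using assms unfolding test_family_def by blast+

lemma test_event_measurable:
  assumes "test_family T e \<psi>" "t \<in> T" "u \<in> T" "t \<noteq> u"
  shows "{X\<in>space config_space. \<psi> t u X = u} \<in> sets config_space"
proof -
  have "\<psi> t u -` {u} \<inter> space config_space \<in> sets config_space"
    by (rule measurable_sets[OF test_familyD(1)[OF assms]]) simp
  moreover have "\<psi> t u -` {u} \<inter> space config_space = {X\<in>space config_space. \<psi> t u X = u}" by auto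
  ultimately show ?thesis by simp
qed

lemma T_criterion_ge:
  assumes "u \<in> T" "u \<noteq> t" "\<psi> t u X = u"
  shows "ennreal (hell t u) \<le> T_criterion T \<psi> X t"
  unfolding T_criterion_def by (intro SUP_upper) (use assms in auto)

lemma T_criterion_measurable:
  assumes T: "countable T" and psi: "test_family T e \<psi>" and t: "t \<in> T"
  shows "(\<lambda>X. T_criterion T \<psi> X t) \<in> borel_measurable config_space"
proof -
  let ?g = "\<lambda>u X. if u \<noteq> t \<and> \<psi> t u X = u then ennreal (hell t u) else 0"
  have eq: "T_criterion T \<psi> X t = (SUP u\<in>T. ?g u X)" for X
  proof (rule antisym)
    show "T_criterion T \<psi> X t \<le> (SUP u\<in>T. ?g u X)"
      unfolding T_criterion_def
    proof (rule SUP_least)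
      fix u assume u: "u \<in> {u \<in> T. u \<noteq> t \<and> \<psi> t u X = u}"
      then have "ennreal (hell t u) = ?g u X" by simp
      also have "\<dots> \<le> (SUP u\<in>T. ?g u X)" using u by (intro SUP_upper) simp
      finally show "ennreal (hell t u) \<le> (SUP u\<in>T. ?g u X)" .
    qed
    show "(SUP u\<in>T. ?g u X) \<le> T_criterion T \<psi> X t"
    proof (rule SUP_least)
      fix u assume "u \<in> T"
      then show "?g u X \<le> T_criterion T \<psi> X t" by (simp add: T_criterion_ge)
    qed
  qed
  have "?g u \<in> borel_measurable config_space" if u: "u \<in> T" for u
  proof (cases "u = t")
    case False
    then show ?thesis
      using test_event_measurable[OF psi t u] by (intro measurable_If) auto
  qed simp
  then show ?thesis unfolding eq by (intro borel_measurable_SUP T)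
qed

text \<open>
  Whichever of the two points loses their comparison has a criterion at least their distance.
\<close>

lemma T_criterion_pair:
  assumes T: "T \<subseteq> L1_plus" and psi: "test_family T e \<psi>"
    and tu: "t \<in> T" "u \<in> T" and X: "X \<in> space config_space"
  shows "ennreal (hell t u) \<le> max (T_criterion T \<psi> X t) (T_criterion T \<psi> X u)"
proof (cases "t = u")
  case True
  have "t \<in> L1_plus" using T tu by auto
  then have "hell t t = 0" by (simp add: hell_eq)
  then show ?thesis using True by simp
next
  case False
  have "\<psi> t u X \<in> {t, u}"
    using measurable_space[OF test_familyD(1)[OF psi tu False] X] by simp
  then consider "\<psi> t u X = u" | "\<psi> u t X = t"
    using test_familyD(2)[OF psi tu False] by auto
  then show ?thesis
  proof cases
    case 1
    show ?thesis using T_criterion_ge[of u T t \<psi> X, OF tu(2) _ 1] False by (auto simp: le_max_iff_disj)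
  next
    case 2
    have "hell t u = hell u t" using T tu by (auto intro: hell_commute)
    then show ?thesis using T_criterion_ge[of t T u \<psi> X, OF tu(1) _ 2] False by (auto simp: le_max_iff_disj)
  qed
qed

text \<open>
  If some point has a finite criterion, every better point lies within that distance of it by
  \<open>T_criterion_pair\<close>, and balls meet the model in finite sets. Otherwise all criteria are infinite.
\<close>

lemma T_criterion_minimizer:
  assumes D: "D_model L1_plus hell 10 1 1 T" and ne: "T \<noteq> {}" and psi: "test_family T e \<psi>"
    and X: "X \<in> space config_space"
  shows "\<exists>t\<in>T. \<forall>u\<in>T. T_criterion T \<psi> X t \<le> T_criterion T \<psi> X u"
proof (cases "\<exists>t0\<in>T. T_criterion T \<psi> X t0 < top")
  case True
  have TL: "T \<subseteq> L1_plus" using D by (auto simp: D_model_def)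
  from True obtain t0 where t0: "t0 \<in> T" and fin: "T_criterion T \<psi> X t0 < top" by blast
  obtain m where m: "T_criterion T \<psi> X t0 = ennreal m" "0 \<le> m"
    using fin by (cases "T_criterion T \<psi> X t0") auto
  define K where "K = {t\<in>T. T_criterion T \<psi> X t \<le> T_criterion T \<psi> X t0}"
  have "K \<subseteq> {t\<in>T. hell t0 t < (m + 2) * 10}"
  proof
    fix t assume t: "t \<in> K"
    then have "ennreal (hell t0 t) \<le> max (T_criterion T \<psi> X t0) (T_criterion T \<psi> X t)"
      by (intro T_criterion_pair[OF TL psi t0 _ X]) (simp add: K_def)
    also have "\<dots> = ennreal m" using t by (simp add: K_def m(1)[symmetric] max_absorb1)
    finally have "hell t0 t \<le> m" using m(2) by simp
    then show "t \<in> {t\<in>T. hell t0 t < (m + 2) * 10}" using t m by (auto simp: K_def)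
  qed
  moreover have "finite {t\<in>T. hell t0 t < (m + 2) * 10}"
    by (rule D_model_10D(1)[OF D]) (use TL t0 m in auto)
  ultimately have "finite K" by (rule finite_subset)
  moreover have "t0 \<in> K" using t0 by (simp add: K_def)
  ultimately obtain t where t: "t \<in> K" "\<And>u. u \<in> K \<Longrightarrow> T_criterion T \<psi> X t \<le> T_criterion T \<psi> X u"
    using arg_min_if_finite(1)[of K] arg_min_least[of K] by (metis empty_iff)
  have "T_criterion T \<psi> X t \<le> T_criterion T \<psi> X u" if "u \<in> T" for u
    using t that by (cases "u \<in> K") (auto simp: K_def)
  then show ?thesis using t by (auto simp: K_def)
next
  case False
  then have "T_criterion T \<psi> X u = top" if "u \<in> T" for u using that by (simp add: less_top[symmetric])
  then show ?thesis using ne by auto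
qed

text \<open>
  Among the minimizers the one with the smallest number is taken; this makes the choice measurable.
\<close>

lemma T_estimator_exists:
  assumes D: "D_model L1_plus hell 10 1 1 T" and ne: "T \<noteq> {}" and psi: "test_family T (\<lambda>_. 10) \<psi>"
    and AEd: "\<And>t u. t \<in> T \<Longrightarrow> u \<in> T \<Longrightarrow> (AE x in lam. t x = u x) \<Longrightarrow> t = u"
  shows "\<exists>est. T_estimator est \<and> est \<in> config_space \<rightarrow>\<^sub>M count_space T \<and>
    (\<forall>X\<in>space config_space. \<forall>t\<in>T. T_criterion T \<psi> X (est X) \<le> T_criterion T \<psi> X t)"
proof -
  have c: "countable T" by (rule D_model_countable[OF D])
  define idx where "idx = to_nat_on T"
  have inj: "inj_on idx T" unfolding idx_def by (rule inj_on_to_nat_on[OF c])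
  define minimal where "minimal X t \<longleftrightarrow> (\<forall>u\<in>T. T_criterion T \<psi> X t \<le> T_criterion T \<psi> X u)" for X t
  define est where "est X = (ARG_MIN idx t. t \<in> T \<and> minimal X t)" for X
  have est: "est X \<in> T \<and> minimal X (est X)" "\<And>u. u \<in> T \<Longrightarrow> minimal X u \<Longrightarrow> idx (est X) \<le> idx u"
    if X: "X \<in> space config_space" for X
  proof -
    obtain t where "t \<in> T \<and> minimal X t"
      using T_criterion_minimizer[OF D ne psi X] unfolding minimal_def by blast
    from arg_min_nat_lemma[of "\<lambda>t. t \<in> T \<and> minimal X t", OF this, of idx]
    show "est X \<in> T \<and> minimal X (est X)" "\<And>u. u \<in> T \<Longrightarrow> minimal X u \<Longrightarrow> idx (est X) \<le> idx u"
      unfolding est_def by auto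
  qed
  have mm: "{X\<in>space config_space. minimal X t} \<in> sets config_space" if t: "t \<in> T" for t
  proof -
    have "{X\<in>space config_space. T_criterion T \<psi> X t \<le> T_criterion T \<psi> X u} \<in> sets config_space" if u: "u \<in> T" for u
      using T_criterion_measurable[OF c psi t] T_criterion_measurable[OF c psi u] by measurable
    then show ?thesis unfolding minimal_def by (intro sets.sets_Collect_countable_All' c)
  qed
  have meas: "est \<in> config_space \<rightarrow>\<^sub>M count_space T"
  proof (subst measurable_count_space_eq_countable[OF c], safe)
    fix t assume t: "t \<in> T"
    have "est -` {t} \<inter> space config_space = {X\<in>space config_space. minimal X t \<and>
       (\<forall>u\<in>{u\<in>T. idx u < idx t}. \<not> minimal X u)}" (is "_ = ?R")
    proof (intro set_eqI iffI)
      fix X assume "X \<in> est -` {t} \<inter> space config_space"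
      then show "X \<in> ?R" using est[of X] by (auto simp: not_le[symmetric])
    next
      fix X assume X: "X \<in> ?R"
      then have "idx (est X) \<le> idx t" "\<not> idx (est X) < idx t" "est X \<in> T" using est[of X] t by auto
      then have "est X = t" using inj t by (auto dest: inj_onD)
      then show "X \<in> est -` {t} \<inter> space config_space" using X by auto
    qed
    also have "\<dots> \<in> sets config_space"
    proof (intro sets.sets_Collect_conj mm t sets.sets_Collect_countable_All')
      show "countable {u\<in>T. idx u < idx t}" using c by (rule countable_subset[rotated]) auto
      fix u assume "u \<in> {u\<in>T. idx u < idx t}"
      then show "{X\<in>space config_space. \<not> minimal X u} \<in> sets config_space"
        by (intro sets.sets_Collect_neg mm) auto
    qed
    finally show "est -` {t} \<inter> space config_space \<in> sets config_space" .
  qed (use est c in auto)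
  have opt: "\<forall>X\<in>space config_space. \<forall>t\<in>T. T_criterion T \<psi> X (est X) \<le> T_criterion T \<psi> X t"
    using est(1) by (auto simp: minimal_def)
  have "T_estimator est"
    unfolding T_estimator_def Let_def
  proof (intro exI conjI)
    have eta: "eta_of {0} (\<lambda>_. T) (\<lambda>_. 10) t = 10" if "t \<in> T" for t
    proof -
      have "{(10::real) |m. m \<in> {0::nat} \<and> t \<in> T} = {10}" using that by auto
      then show ?thesis by (simp add: eta_of_def)
    qed
    have "test_family T (eta_of {0} (\<lambda>_. T) (\<lambda>_. 10)) \<psi> \<longleftrightarrow> test_family T (\<lambda>_. 10) \<psi>"
      unfolding test_family_def by (intro ball_cong refl) (simp add: eta)
    then show "test_family (\<Union>m\<in>{0::nat}. T) (eta_of {0} (\<lambda>_. T) (\<lambda>_. 10)) \<psi>" using psi by simp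
    show "model_family {0} (\<lambda>_. T) (\<lambda>_. 10) (\<lambda>_. 1) 1"
      unfolding model_family_def using D AEd by auto
    show "est \<in> config_space \<rightarrow>\<^sub>M count_space (\<Union>m\<in>{0::nat}. T)" using meas by simp
    show "\<forall>X\<in>space config_space. \<forall>t\<in>\<Union>m\<in>{0::nat}. T. T_criterion (\<Union>m\<in>{0::nat}. T) \<psi> X (est X)
        \<le> T_criterion (\<Union>m\<in>{0::nat}. T) \<psi> X t"
      using opt by simp
  qed
  then show ?thesis using meas opt by blast
qed


text \<open>
  Absorbs the factor \<open>h\<^sup>2\<close> by giving up half of the exponent: \<open>x exp (-x) \<le> 1\<close> for \<open>x = h\<^sup>2/8\<close>.
\<close>

lemma sq_exp_bound: "h\<^sup>2 * exp (- h\<^sup>2 / 4) \<le> 8 * exp (- (h::real)\<^sup>2 / 8)"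
proof -
  define x where "x = h\<^sup>2 / 8"
  have "x \<le> exp x" using exp_ge_add_one_self[of x] by linarith
  then have "x * exp (- x) \<le> 1" by (simp add: exp_minus field_simps)
  then have "8 * (x * exp (- x)) * exp (- x) \<le> 8 * 1 * exp (- x)"
    by (intro mult_right_mono) auto
  moreover have "exp (- x) * exp (- x) = exp (- h\<^sup>2 / 4)" by (simp add: x_def exp_add[symmetric])
  ultimately have "8 * x * exp (- h\<^sup>2 / 4) \<le> 8 * exp (- x)" by (simp only: mult.assoc mult_1_left)
  then show ?thesis by (simp add: x_def)
qed

text \<open>
  If \<open>H(t, est)\<close> exceeds \<open>2y\<close> with \<open>y \<ge> 4 H(s,t)\<close>, then \<open>t\<close> lost against some \<open>u\<close> at distance more than half of it.
  So the excess of the squared distance is at most the sum of \<open>4 H\<^sup>2(t,u)\<close> over the \<open>u\<close> with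
  \<open>H(t,u) > y\<close> that beat \<open>t\<close>, and each of them does so with probability at most \<open>exp (-H\<^sup>2(t,u)/4)\<close>.
\<close>

lemma T_criterion_risk:
  assumes D: "D_model L1_plus hell 10 1 1 T" and psi: "test_family T (\<lambda>_. 10) \<psi>"
    and est: "est \<in> config_space \<rightarrow>\<^sub>M count_space T"
    and opt: "\<forall>X\<in>space config_space. \<forall>t\<in>T. T_criterion T \<psi> X (est X) \<le> T_criterion T \<psi> X t"
    and s: "s \<in> L1_plus" and t: "t \<in> T"
  shows "(\<integral>\<^sup>+X. ennreal ((hell s (est X))\<^sup>2) \<partial>poisson_process (intensity_measure s))
    \<le> ennreal (4000 + 200 * (hell s t)\<^sup>2)"
proof -
  have TL: "T \<subseteq> L1_plus" using D by (auto simp: D_model_def)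
  have tL: "t \<in> L1_plus" using TL t by auto
  have c: "countable T" by (rule D_model_countable[OF D])
  let ?P = "poisson_process (intensity_measure s)"
  have mu: "intensity_measure s \<in> finite_measures"
  proof -
    have "integrable lam s" using s by (simp add: L1_plus_def)
    then have "(\<integral>\<^sup>+x. ennreal (s x) \<partial>lam) < \<infinity>"
      by (simp add: real_integrable_def less_top)
    then have "finite_measure (intensity_measure s)"
      using s unfolding intensity_measure_def
      by (intro finite_measureI) (auto simp: emeasure_density L1_plus_def cong: nn_integral_cong)
    then show ?thesis by (simp add: finite_measures_def intensity_measure_def)
  qed
  interpret prob_space ?P by (rule prob_space_poisson_process[OF mu])
  have setsP: "sets ?P = sets config_space" by (simp add: poisson_process_def)
  have spP: "space ?P = space config_space" by (rule sets_eq_imp_space_eq[OF setsP])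
  \<comment> \<open>beyond 20 = 2 eta the balls are controlled, beyond 4 H(s,t) the error bounds of the tests apply\<close>
  define y where "y = max 20 (4 * hell s t)"
  have y: "20 \<le> y" "4 * hell s t \<le> y" by (auto simp: y_def)
  define T' where "T' = {u\<in>T. y < hell t u}"
  define a where "a = from_nat_into T"
  define idx where "idx = to_nat_on T"
  have ai: "a (idx u) = u" if "u \<in> T" for u
    using from_nat_into_to_nat_on[OF c that] by (simp add: a_def idx_def)
  have inj: "inj_on idx T" unfolding idx_def by (rule inj_on_to_nat_on[OF c])
  have tne: "t \<notin> T'" using y tL by (auto simp: T'_def hell_eq)
  define excess where "excess n X = (if n \<in> idx ` T' \<and> \<psi> t (a n) X = a n then ennreal ((hell t (a n))\<^sup>2) else 0)" for n X
  define G where "G X = ennreal (2 * (hell s t)\<^sup>2 + 8 * y\<^sup>2) + 8 * (\<Sum>n. excess n X)" for X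
  have pw: "ennreal ((hell s (est X))\<^sup>2) \<le> G X" if X: "X \<in> space config_space" for X
  proof -
    have eT: "est X \<in> T" using measurable_space[OF est X] by simp
    then have eL: "est X \<in> L1_plus" using TL by auto
    define h where "h = hell t (est X)"
    have h0: "0 \<le> h" by (simp add: h_def hell_nonneg)
    have tri: "(hell s (est X))\<^sup>2 \<le> 2 * (hell s t)\<^sup>2 + 2 * h\<^sup>2"
      unfolding h_def by (rule hell_triangle_sq[OF s tL eL])
    have "ennreal (h\<^sup>2) \<le> ennreal (4 * y\<^sup>2) + 4 * (\<Sum>n. excess n X)"
    proof (cases "h \<le> 2 * y")
      case True
      then have "h\<^sup>2 \<le> (2 * y)\<^sup>2" using h0 by (intro power_mono)
      then have "ennreal (h\<^sup>2) \<le> ennreal (4 * y\<^sup>2)" by (intro ennreal_leI) (simp add: power_mult_distrib)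
      then show ?thesis by (simp add: add_increasing2)
    next
      case False
      have "ennreal (h / 2) < ennreal h" using False y by (simp add: ennreal_less_iff)
      also have "ennreal h \<le> max (T_criterion T \<psi> X t) (T_criterion T \<psi> X (est X))"
        unfolding h_def by (rule T_criterion_pair[OF TL psi t eT X])
      also have "\<dots> = T_criterion T \<psi> X t" using opt X t by (simp add: max_absorb1)
      finally obtain u where u: "u \<in> T" "u \<noteq> t" "\<psi> t u X = u" "ennreal (h / 2) < ennreal (hell t u)"
        unfolding T_criterion_def less_SUP_iff by auto
      have hu: "h / 2 < hell t u" using u(4) h0 by (simp add: ennreal_less_iff)
      then have uT': "u \<in> T'" using False u y by (simp add: T'_def)
      have "h\<^sup>2 \<le> (2 * hell t u)\<^sup>2" using hu h0 by (intro power_mono) auto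
      then have "ennreal (h\<^sup>2) \<le> ennreal (4 * (hell t u)\<^sup>2)"
        by (intro ennreal_leI) (simp add: power_mult_distrib)
      also have "\<dots> = 4 * excess (idx u) X"
        using imageI[OF uT', of idx] u(3) ai[OF u(1)] by (simp add: excess_def ennreal_mult)
      also have "excess (idx u) X \<le> (\<Sum>n. excess n X)"
        using sum_le_suminf[of "\<lambda>n. excess n X" "{idx u}"] by simp
      finally have "ennreal (h\<^sup>2) \<le> 4 * (\<Sum>n. excess n X)" by (simp add: mult_left_mono)
      then show ?thesis by (simp add: add_increasing)
    qed
    then have "2 * ennreal (h\<^sup>2) \<le> 2 * (ennreal (4 * y\<^sup>2) + 4 * (\<Sum>n. excess n X))"
      by (intro mult_left_mono) auto
    also have "\<dots> = ennreal (8 * y\<^sup>2) + 8 * (\<Sum>n. excess n X)"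
      by (simp add: distrib_left ennreal_mult mult.assoc[symmetric])
    finally have h2: "2 * ennreal (h\<^sup>2) \<le> ennreal (8 * y\<^sup>2) + 8 * (\<Sum>n. excess n X)" .
    have "ennreal ((hell s (est X))\<^sup>2) \<le> ennreal (2 * (hell s t)\<^sup>2 + 2 * h\<^sup>2)"
      using tri by (rule ennreal_leI)
    also have "\<dots> = ennreal (2 * (hell s t)\<^sup>2) + 2 * ennreal (h\<^sup>2)"
      by (simp add: ennreal_plus ennreal_mult)
    also have "\<dots> \<le> ennreal (2 * (hell s t)\<^sup>2) + (ennreal (8 * y\<^sup>2) + 8 * (\<Sum>n. excess n X))"
      using h2 by (rule add_left_mono)
    also have "\<dots> = G X" by (simp add: G_def ennreal_plus add.assoc)
    finally show ?thesis .
  qed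
  have ev: "{X\<in>space config_space. \<psi> t u X = u} \<in> events" if "u \<in> T'" for u
    using test_event_measurable[OF psi t, of u] that tne by (auto simp: T'_def setsP)
  have termm: "excess n \<in> borel_measurable ?P" for n
  proof (cases "n \<in> idx ` T'")
    case True
    then obtain u where u: "u \<in> T'" "a n = u" using ai by (auto simp: T'_def)
    have "{X\<in>space ?P. n \<in> idx ` T' \<and> \<psi> t (a n) X = a n} \<in> events"
      using ev[OF u(1)] u True by (simp add: spP)
    then show ?thesis unfolding excess_def[abs_def] by (intro measurable_If) auto
  next
    case False
    then show ?thesis unfolding excess_def[abs_def] by simp
  qed
  define b where "b n = (if n \<in> idx ` T' then ennreal (8 * exp (- (hell t (a n))\<^sup>2 / 8)) else 0)" for n
  have termi: "(\<integral>\<^sup>+X. excess n X \<partial>?P) \<le> b n" for n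
  proof (cases "n \<in> idx ` T'")
    case True
    then obtain u where u: "u \<in> T'" "a n = u" using ai by (auto simp: T'_def)
    let ?E = "{X\<in>space config_space. \<psi> t u X = u}"
    have "(\<integral>\<^sup>+X. excess n X \<partial>?P) = (\<integral>\<^sup>+X. ennreal ((hell t u)\<^sup>2) * indicator ?E X \<partial>?P)"
      by (rule nn_integral_cong) (use True u in \<open>auto simp: excess_def indicator_def spP\<close>)
    also have "\<dots> = ennreal ((hell t u)\<^sup>2) * ennreal (measure ?P ?E)"
      using ev[OF u(1)] by (simp add: nn_integral_cmult_indicator emeasure_eq_measure)
    also have "\<dots> = ennreal ((hell t u)\<^sup>2 * measure ?P ?E)" by (simp add: ennreal_mult)
    also have "\<dots> \<le> ennreal (8 * exp (- (hell t u)\<^sup>2 / 8))"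
    proof (rule ennreal_leI)
      have "hellinger (intensity_measure s) (intensity_measure t) \<le> hell t u / 4"
        using u y by (simp add: T'_def hell_def[symmetric])
      then have "measure ?P ?E \<le> exp (- ((hell t u)\<^sup>2 - 10\<^sup>2 + 10\<^sup>2) / 4)"
        using u tne by (intro test_familyD(3)[OF psi t _ _ mu]) (auto simp: T'_def)
      then have "(hell t u)\<^sup>2 * measure ?P ?E \<le> (hell t u)\<^sup>2 * exp (- (hell t u)\<^sup>2 / 4)"
        by (intro mult_left_mono) auto
      also have "\<dots> \<le> 8 * exp (- (hell t u)\<^sup>2 / 8)" by (rule sq_exp_bound)
      finally show "(hell t u)\<^sup>2 * measure ?P ?E \<le> 8 * exp (- (hell t u)\<^sup>2 / 8)" .
    qed
    finally show ?thesis using True u by (simp add: b_def)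
  next
    case False
    then show ?thesis by (simp add: excess_def)
  qed
  have bsum: "(\<Sum>n. b n) \<le> ennreal 16"
    unfolding suminf_eq_SUP
  proof (rule SUP_least)
    fix m :: nat
    define F where "F = {u\<in>T'. idx u < m}"
    have injF: "inj_on idx F" using inj by (rule inj_on_subset) (auto simp: F_def T'_def)
    have imF: "idx ` F = {n\<in>{..<m}. n \<in> idx ` T'}" by (auto simp: F_def)
    then have "finite (idx ` F)" by simp
    then have finF: "finite F" using injF by (rule finite_imageD)
    have "(\<Sum>n<m. b n) = (\<Sum>n\<in>idx ` F. ennreal (8 * exp (- (hell t (a n))\<^sup>2 / 8)))"
      unfolding imF b_def by (rule sum.inter_filter[symmetric]) simp
    also have "\<dots> = (\<Sum>u\<in>F. ennreal (8 * exp (- (hell t u)\<^sup>2 / 8)))"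
      by (subst sum.reindex[OF injF]) (auto intro!: sum.cong simp: ai F_def T'_def)
    also have "\<dots> = ennreal (8 * (\<Sum>u\<in>F. exp (- (hell t u)\<^sup>2 / 8)))"
      by (simp add: sum_ennreal sum_distrib_left)
    also have "\<dots> \<le> ennreal 16"
    proof (rule ennreal_leI)
      have "(\<Sum>u\<in>F. exp (- (hell t u)\<^sup>2 / 8)) \<le> 2"
        by (rule D_model_exp_sum[OF D tL finF]) (use y in \<open>auto simp: F_def T'_def\<close>)
      then show "8 * (\<Sum>u\<in>F. exp (- (hell t u)\<^sup>2 / 8)) \<le> 16" by simp
    qed
    finally show "(\<Sum>n<m. b n) \<le> ennreal 16" .
  qed
  have y2: "y\<^sup>2 \<le> 400 + 16 * (hell s t)\<^sup>2"
    by (auto simp: y_def max_def power_mult_distrib)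
  have "(\<integral>\<^sup>+X. ennreal ((hell s (est X))\<^sup>2) \<partial>?P) \<le> (\<integral>\<^sup>+X. G X \<partial>?P)"
    by (intro nn_integral_mono pw) (simp add: spP)
  also have "\<dots> = ennreal (2 * (hell s t)\<^sup>2 + 8 * y\<^sup>2) + 8 * (\<Sum>n. \<integral>\<^sup>+X. excess n X \<partial>?P)"
    unfolding G_def using termm
    by (subst nn_integral_add) (auto simp: nn_integral_cmult nn_integral_suminf emeasure_space_1)
  also have "\<dots> \<le> ennreal (2 * (hell s t)\<^sup>2 + 8 * y\<^sup>2) + 8 * (\<Sum>n. b n)"
    by (intro add_left_mono mult_left_mono suminf_le termi) auto
  also have "\<dots> \<le> ennreal (2 * (hell s t)\<^sup>2 + 8 * y\<^sup>2) + 8 * ennreal 16"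
    by (intro add_left_mono mult_left_mono bsum) auto
  also have "\<dots> = ennreal (2 * (hell s t)\<^sup>2 + 8 * y\<^sup>2 + 128)"
  proof -
    have "8 * ennreal 16 = ennreal 128" by (simp add: ennreal_mult[symmetric] flip: ennreal_numeral)
    then show ?thesis by (simp add: ennreal_plus)
  qed
  also have "\<dots> \<le> ennreal (4000 + 200 * (hell s t)\<^sup>2)"
  proof (rule ennreal_leI)
    have "0 \<le> (hell s t)\<^sup>2" by simp
    then show "2 * (hell s t)\<^sup>2 + 8 * y\<^sup>2 + 128 \<le> 4000 + 200 * (hell s t)\<^sup>2" using y2 by linarith
  qed
  finally show ?thesis .
qed

section \<open>Self-similarity of the square\<close>

lemma unit_square_sets [measurable]: "unit_square \<in> sets borel"
  unfolding unit_square_def by (simp add: borel_prod[symmetric])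

lemma measure_lam: "measure lam unit_square = 1"
proof -
  have "emeasure lam unit_square = emeasure lborel unit_square"
    unfolding lam_def by (subst emeasure_restrict_space) auto
  also have "\<dots> = emeasure (lborel \<Otimes>\<^sub>M lborel) ({0..<1::real} \<times> {0..<1::real})"
    by (simp add: unit_square_def lborel_prod)
  also have "\<dots> = 1" by (subst lborel.emeasure_pair_measure_Times) auto
  finally show ?thesis by (simp add: measure_def)
qed

interpretation lam: prob_space lam
  by (rule prob_spaceI) (use measure_lam finite_measure.emeasure_eq_measure[OF finite_measure_lam, of unit_square]
    in \<open>simp add: space_lam\<close>)

lemma lam_measurable_iff:
  fixes f :: "point \<Rightarrow> real"
  shows "f \<in> borel_measurable lam \<longleftrightarrow> (\<lambda>z. indicator unit_square z * f z) \<in> borel_measurable borel"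
  unfolding lam_def by (subst borel_measurable_restrict_space_iff) (auto simp: mult.commute)

lemma lam_integrable_iff:
  fixes f :: "point \<Rightarrow> real"
  shows "integrable lam f \<longleftrightarrow> integrable lborel (\<lambda>z. indicator unit_square z * f z)"
  unfolding lam_def by (subst integrable_restrict_space) (auto simp: set_integrable_def)

lemma lam_integral_eq:
  fixes f :: "point \<Rightarrow> real"
  shows "integral\<^sup>L lam f = (\<integral>z. indicator unit_square z * f z \<partial>lborel)"
  unfolding lam_def by (subst integral_restrict_space) (auto simp: set_lebesgue_integral_def)

lemma lborel_half:
  fixes f :: "point \<Rightarrow> real"
  assumes [measurable]: "f \<in> borel_measurable borel"
  shows "integral\<^sup>L lborel f = (\<integral>z. f (p + z /\<^sub>R 2) \<partial>lborel) / 4"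
    and "integrable lborel f \<longleftrightarrow> integrable lborel (\<lambda>z. f (p + z /\<^sub>R 2))"
proof -
  let ?g = "\<lambda>z::point. p + (1/2) *\<^sub>R z"
  define M where "M = density (distr lborel borel ?g) (\<lambda>_. ennreal (1/4))"
  have [measurable]: "?g \<in> borel_measurable lborel" by simp
  have "lborel = density (distr lborel borel ?g) (\<lambda>_. ennreal (\<bar>1/2\<bar> ^ DIM(point)))"
    by (rule lborel_affine) simp
  also have "\<bar>1/2::real\<bar> ^ DIM(point) = 1/4" by (simp add: power2_eq_square)
  finally have l: "lborel = M" unfolding M_def .
  have h: "z /\<^sub>R 2 = (1/2) *\<^sub>R z" for z :: point by simp
  have "integral\<^sup>L lborel f = integral\<^sup>L M f" by (simp only: l[symmetric])
  also have "\<dots> = (\<integral>z. (1/4) *\<^sub>R f z \<partial>distr lborel borel ?g)"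
    unfolding M_def by (rule integral_density) simp_all
  also have "\<dots> = (\<integral>z. (1/4) *\<^sub>R f (?g z) \<partial>lborel)"
    by (rule integral_distr) simp_all
  also have "\<dots> = (\<integral>z. f (p + z /\<^sub>R 2) \<partial>lborel) / 4"
    unfolding h by (simp only: Bochner_Integration.integral_scaleR_right) simp
  finally show "integral\<^sup>L lborel f = (\<integral>z. f (p + z /\<^sub>R 2) \<partial>lborel) / 4" .
  have "integrable lborel f \<longleftrightarrow> integrable M f" by (simp only: l[symmetric])
  also have "\<dots> \<longleftrightarrow> integrable (distr lborel borel ?g) (\<lambda>z. (1/4) *\<^sub>R f z)"
    unfolding M_def by (rule integrable_density) simp_all
  also have "\<dots> \<longleftrightarrow> integrable lborel (\<lambda>z. (1/4) *\<^sub>R f (?g z))"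
    by (rule integrable_distr_eq) simp_all
  also have "\<dots> \<longleftrightarrow> integrable lborel (\<lambda>z. f (p + z /\<^sub>R 2))"
    unfolding h by (simp only: real_scaleR_def integrable_mult_left_iff) simp
  finally show "integrable lborel f \<longleftrightarrow> integrable lborel (\<lambda>z. f (p + z /\<^sub>R 2))" .
qed

text \<open>
  The restriction of \<open>f\<close> to a quadrant, blown up to the whole square. The factor \<open>1/2\<close> makes it an
  \<open>L\<^sub>2\<close>-isometry onto functions on that quadrant: the squared norm of \<open>f\<close> is the sum of those of
  its four quarters. Statements about dyadic levels are proved by induction along this operation.
\<close>

definition quarter :: "nat \<Rightarrow> nat \<Rightarrow> (point \<Rightarrow> real) \<Rightarrow> point \<Rightarrow> real" where
  "quarter a b f z = f ((fst z + real a) / 2, (snd z + real b) / 2) / 2"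

definition quadrant :: "nat \<Rightarrow> nat \<Rightarrow> point set" where
  "quadrant a b = {real a / 2 ..< (real a + 1) / 2} \<times> {real b / 2 ..< (real b + 1) / 2}"

lemma quadrant_sets [measurable]: "quadrant a b \<in> sets borel"
  unfolding quadrant_def by (simp add: borel_prod[symmetric])

lemma quadrant_half:
  "indicator (quadrant a b) ((real a / 2, real b / 2) + z /\<^sub>R 2) = (indicator unit_square z :: real)"
  by (cases z) (auto simp: quadrant_def unit_square_def indicator_def field_simps)

lemma unit_square_quadrants:
  "indicator unit_square z = (\<Sum>a<2. \<Sum>b<2. indicator (quadrant a b) z :: real)"
  by (cases z) (auto simp: quadrant_def unit_square_def indicator_def numeral_2_eq_2 field_simps)

lemma quadrant_subset: "a < 2 \<Longrightarrow> b < 2 \<Longrightarrow> quadrant a b \<subseteq> unit_square"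
  by (auto simp: quadrant_def unit_square_def numeral_2_eq_2 less_Suc_eq field_simps)

lemma quadrant_integral:
  fixes f :: "point \<Rightarrow> real"
  assumes f: "f \<in> borel_measurable lam" and ab: "a < 2" "b < 2"
  shows "quarter a b f \<in> borel_measurable lam"
    "(\<integral>z. indicator (quadrant a b) z * f z \<partial>lborel) = integral\<^sup>L lam (quarter a b f) / 2"
    "integrable lborel (\<lambda>z. indicator (quadrant a b) z * f z) \<longleftrightarrow> integrable lam (quarter a b f)"
proof -
  have "(\<lambda>z. indicator (quadrant a b) z * (indicator unit_square z * f z)) \<in> borel_measurable borel"
    using f[unfolded lam_measurable_iff] by measurable
  moreover have e: "indicator (quadrant a b) z * (indicator unit_square z * f z) = indicator (quadrant a b) z * f z" for z
    using quadrant_subset[OF ab] by (auto simp: indicator_def)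
  ultimately have [measurable]: "(\<lambda>z. indicator (quadrant a b) z * f z) \<in> borel_measurable borel" by simp
  have q: "indicator (quadrant a b) ((real a / 2, real b / 2) + z /\<^sub>R 2) * f ((real a / 2, real b / 2) + z /\<^sub>R 2)
    = 2 * (indicator unit_square z * quarter a b f z)" for z
  proof -
    have "(real a / 2, real b / 2) + z /\<^sub>R 2 = ((fst z + real a) / 2, (snd z + real b) / 2)"
      by (cases z) (simp add: field_simps)
    then have "f ((real a / 2, real b / 2) + z /\<^sub>R 2) = 2 * quarter a b f z" by (simp add: quarter_def)
    then show ?thesis unfolding quadrant_half by simp
  qed
  note h = lborel_half[of "\<lambda>z. indicator (quadrant a b) z * f z" "(real a / 2, real b / 2)", unfolded q]
  show "(\<integral>z. indicator (quadrant a b) z * f z \<partial>lborel) = integral\<^sup>L lam (quarter a b f) / 2"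
    using h(1) by (simp add: lam_integral_eq)
  show "integrable lborel (\<lambda>z. indicator (quadrant a b) z * f z) \<longleftrightarrow> integrable lam (quarter a b f)"
    using h(2) by (simp add: lam_integrable_iff)
  have "(\<lambda>z. (indicator (quadrant a b) ((real a / 2, real b / 2) + z /\<^sub>R 2) * f ((real a / 2, real b / 2) + z /\<^sub>R 2)) / 2)
    \<in> borel_measurable borel"
    by (intro borel_measurable_divide borel_measurable_const
      measurable_compose[of "\<lambda>z. (real a / 2, real b / 2) + z /\<^sub>R 2" borel borel "\<lambda>z. indicator (quadrant a b) z * f z"]) auto
  then show "quarter a b f \<in> borel_measurable lam" unfolding q lam_measurable_iff by simp
qed

lemma integrable_quarter:
  assumes f: "integrable lam f" and ab: "a < 2" "b < 2"
  shows "integrable lam (quarter a b f)"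
proof -
  have m: "f \<in> borel_measurable lam" using f by auto
  have "integrable lborel (\<lambda>z. indicator (quadrant a b) z *\<^sub>R (indicator unit_square z * f z))"
    using f[unfolded lam_integrable_iff] by (intro integrable_mult_indicator) auto
  moreover have "(\<lambda>z. indicator (quadrant a b) z *\<^sub>R (indicator unit_square z * f z))
    = (\<lambda>z. indicator (quadrant a b) z * f z)"
    by (rule ext) (use quadrant_subset[OF ab] in \<open>auto simp: indicator_def\<close>)
  ultimately show ?thesis unfolding quadrant_integral(3)[OF m ab, symmetric] by (simp only:)
qed

lemma integral_quarters:
  assumes f: "integrable lam f"
  shows "integral\<^sup>L lam f = (\<Sum>a<2. \<Sum>b<2. integral\<^sup>L lam (quarter a b f)) / 2"
proof -
  have m: "f \<in> borel_measurable lam" using f by auto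
  have i: "integrable lborel (\<lambda>z. indicator (quadrant a b) z * f z)" if "a < 2" "b < 2" for a b
    using integrable_quarter[OF f that] quadrant_integral(3)[OF m that] by (simp only:)
  have "integral\<^sup>L lam f = (\<integral>z. (\<Sum>a<2. \<Sum>b<2. indicator (quadrant a b) z * f z) \<partial>lborel)"
    unfolding lam_integral_eq unit_square_quadrants sum_distrib_right ..
  also have "\<dots> = (\<Sum>a<2. \<integral>z. (\<Sum>b<2. indicator (quadrant a b) z * f z) \<partial>lborel)"
    by (rule Bochner_Integration.integral_sum) (intro Bochner_Integration.integrable_sum i, simp_all)
  also have "\<dots> = (\<Sum>a<2. \<Sum>b<2. \<integral>z. indicator (quadrant a b) z * f z \<partial>lborel)"
    by (intro sum.cong refl Bochner_Integration.integral_sum i) simp_all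
  also have "\<dots> = (\<Sum>a<2. \<Sum>b<2. integral\<^sup>L lam (quarter a b f) / 2)"
    by (intro sum.cong refl quadrant_integral(2)[OF m]) simp_all
  finally show ?thesis by (simp only: sum_divide_distrib)
qed

definition L2 :: "(point \<Rightarrow> real) \<Rightarrow> bool" where
  "L2 f \<longleftrightarrow> f \<in> borel_measurable lam \<and> integrable lam (\<lambda>z. (f z)\<^sup>2)"

lemma L2_integrable: "L2 f \<Longrightarrow> integrable lam f"
  unfolding L2_def by (rule lam.square_integrable_imp_integrable) auto

lemma L2_diff: "L2 f \<Longrightarrow> L2 g \<Longrightarrow> L2 (\<lambda>z. f z - g z)"
  using square_integrable_diff[of f lam g] by (auto simp: L2_def)

lemma L2_const: "L2 (\<lambda>_. c)"
  by (simp add: L2_def)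

lemma quarter_sq: "quarter a b (\<lambda>z. (f z)\<^sup>2) = (\<lambda>z. 2 * (quarter a b f z)\<^sup>2)"
  by (rule ext) (simp add: quarter_def power_divide)

lemma L2_quarter: "L2 f \<Longrightarrow> a < 2 \<Longrightarrow> b < 2 \<Longrightarrow> L2 (quarter a b f)"
  using quadrant_integral(1)[of f a b] integrable_quarter[of "\<lambda>z. (f z)\<^sup>2" a b]
  by (simp add: L2_def quarter_sq)

lemma sq_quarters:
  assumes "L2 f"
  shows "(\<integral>z. (f z)\<^sup>2 \<partial>lam) = (\<Sum>a<2. \<Sum>b<2. \<integral>z. (quarter a b f z)\<^sup>2 \<partial>lam)"
  using assms integral_quarters[of "\<lambda>z. (f z)\<^sup>2"]
  by (simp add: L2_def quarter_sq sum_distrib_left[symmetric])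

text \<open>
  Nonnegativity of the variance, the unit square having measure 1.
\<close>

lemma mean_sq_le:
  assumes "L2 f"
  shows "(integral\<^sup>L lam f)\<^sup>2 \<le> (\<integral>z. (f z)\<^sup>2 \<partial>lam)"
proof -
  have "0 \<le> lam.variance f" by (intro Bochner_Integration.integral_nonneg) simp
  also have "lam.variance f = (\<integral>z. (f z)\<^sup>2 \<partial>lam) - (integral\<^sup>L lam f)\<^sup>2"
    by (rule lam.variance_eq) (use assms L2_integrable[OF assms] in \<open>simp_all add: L2_def\<close>)
  finally show ?thesis by simp
qed

lemma quarter_diff: "quarter a b (\<lambda>z. f z - g z) = (\<lambda>z. quarter a b f z - quarter a b g z)"
  by (rule ext) (simp add: quarter_def diff_divide_distrib)

section \<open>Quadtrees with lattice values and their number\<close>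

datatype vtree = Leaf nat | Node vtree vtree vtree vtree

instance vtree :: countable by countable_datatype

fun leaves :: "vtree \<Rightarrow> nat" where
  "leaves (Leaf z) = 1"
| "leaves (Node v00 v01 v10 v11) = leaves v00 + leaves v01 + leaves v10 + leaves v11"

text \<open>
  A leaf at depth \<open>d\<close> with label \<open>z\<close> is the value \<open>20 z\<close> times the \<open>L\<^sub>2\<close>-normalized indicator of its
  square, since every node multiplies by 2; hence the labels of a fixed tree are coordinates in a
  cubic lattice of mesh 20 with respect to an orthonormal system.
\<close>

fun tree_fun :: "vtree \<Rightarrow> point \<Rightarrow> real" where
  "tree_fun (Leaf z) p = 20 * real z"
| "tree_fun (Node v00 v01 v10 v11) p =
    2 * (if fst p < 1/2
      then (if snd p < 1/2 then tree_fun v00 (2 * fst p, 2 * snd p)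
            else tree_fun v01 (2 * fst p, 2 * snd p - 1))
      else (if snd p < 1/2 then tree_fun v10 (2 * fst p - 1, 2 * snd p)
            else tree_fun v11 (2 * fst p - 1, 2 * snd p - 1)))"

fun subtree :: "vtree \<Rightarrow> nat \<Rightarrow> nat \<Rightarrow> vtree" where
  "subtree (Node v00 v01 v10 v11) a b =
     (if a = 0 then if b = 0 then v00 else v01 else if b = 0 then v10 else v11)"
| "subtree (Leaf z) a b = Leaf z"

fun depth :: "vtree \<Rightarrow> nat" where
  "depth (Leaf z) = 0"
| "depth (Node v00 v01 v10 v11) = Suc (max (max (depth v00) (depth v01)) (max (depth v10) (depth v11)))"

lemma leaves_pos: "0 < leaves v" by (induction v) auto

lemma tree_fun_measurable [measurable]: "tree_fun v \<in> borel_measurable borel"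
proof (induction v)
  case (Node v00 v01 v10 v11)
  note [measurable] = Node
  have [measurable]: "(\<lambda>p::point. fst p) \<in> borel_measurable borel" "(\<lambda>p::point. snd p) \<in> borel_measurable borel"
    by (auto simp: borel_prod[symmetric])
  have c: "(\<lambda>p::point. (f p, g p)) \<in> borel_measurable borel" if "f \<in> borel_measurable borel" "g \<in> borel_measurable borel"
    for f g :: "point \<Rightarrow> real"
    using that by (simp add: borel_prod[symmetric])
  show ?case unfolding tree_fun.simps
    by (intro borel_measurable_times borel_measurable_const measurable_If
      measurable_compose[OF c Node.IH(1)] measurable_compose[OF c Node.IH(2)]
      measurable_compose[OF c Node.IH(3)] measurable_compose[OF c Node.IH(4)]) measurable
qed simp

lemma tree_fun_nonneg: "0 \<le> tree_fun v p"
  by (induction v p rule: tree_fun.induct) auto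

lemma tree_fun_bounded: "\<exists>B. \<forall>p. tree_fun v p \<le> B"
proof (induction v)
  case (Node v00 v01 v10 v11)
  then obtain B0 B1 B2 B3 where "\<forall>p. tree_fun v00 p \<le> B0" "\<forall>p. tree_fun v01 p \<le> B1"
    "\<forall>p. tree_fun v10 p \<le> B2" "\<forall>p. tree_fun v11 p \<le> B3" by blast
  then have "tree_fun (Node v00 v01 v10 v11) p \<le> 2 * max (max B0 B1) (max B2 B3)" for p
    by (simp add: le_max_iff_disj)
  then show ?case by blast
qed auto

lemma tree_fun_L2: "L2 (tree_fun v)"
proof -
  have m: "tree_fun v \<in> borel_measurable lam"
    unfolding lam_def by (intro measurable_restrict_space1) simp
  obtain B where B: "\<And>p. tree_fun v p \<le> B" using tree_fun_bounded by blast
  have "integrable lam (\<lambda>z. (tree_fun v z)\<^sup>2)"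
    by (rule lam.integrable_const_bound[where B="B\<^sup>2"])
       (use m B tree_fun_nonneg in \<open>auto intro!: power_mono\<close>)
  then show ?thesis using m by (simp add: L2_def)
qed

lemma quarter_tree_fun:
  assumes "z \<in> unit_square" "a < 2" "b < 2"
  shows "quarter a b (tree_fun (Node v00 v01 v10 v11)) z = tree_fun (subtree (Node v00 v01 v10 v11) a b) z"
proof -
  have "(2 * x + 2) / 2 - 1 = x" for x :: real by (simp add: field_simps)
  then show ?thesis
    using assms by (cases z) (auto simp: quarter_def unit_square_def numeral_2_eq_2 less_Suc_eq)
qed

definition tree_dist :: "(point \<Rightarrow> real) \<Rightarrow> vtree \<Rightarrow> real" where
  "tree_dist f v = (\<integral>z. (f z - tree_fun v z)\<^sup>2 \<partial>lam)"

lemma tree_dist_Node: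
  assumes "L2 f"
  shows "tree_dist f (Node v00 v01 v10 v11) = tree_dist (quarter 0 0 f) v00 + tree_dist (quarter 0 1 f) v01
    + tree_dist (quarter 1 0 f) v10 + tree_dist (quarter 1 1 f) v11"
proof -
  let ?v = "Node v00 v01 v10 v11"
  have "tree_dist f ?v = (\<Sum>a<2. \<Sum>b<2. \<integral>z. (quarter a b (\<lambda>z. f z - tree_fun ?v z) z)\<^sup>2 \<partial>lam)"
    unfolding tree_dist_def by (rule sq_quarters) (intro L2_diff assms tree_fun_L2)
  also have "\<dots> = (\<Sum>a<2. \<Sum>b<2. tree_dist (quarter a b f) (subtree ?v a b))"
    unfolding tree_dist_def quarter_diff
    by (intro sum.cong refl Bochner_Integration.integral_cong) (auto simp: quarter_tree_fun space_lam simp del: subtree.simps)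
  finally show ?thesis by (simp add: numeral_2_eq_2)
qed

text \<open>
  Projection onto the constants can only decrease the distance.
\<close>

lemma tree_dist_Leaf:
  assumes "L2 f"
  shows "(integral\<^sup>L lam f - 20 * real z)\<^sup>2 \<le> tree_dist f (Leaf z)"
  using mean_sq_le[OF L2_diff[OF assms L2_const[of "20 * real z"]]] L2_integrable[OF assms]
  by (simp add: tree_dist_def lam.prob_space)


text \<open>
  Labels on either side of \<open>y\<close> have distances at least \<open>0, 1, 2, ...\<close> from \<open>y\<close>, so each side is dominated by
  a geometric series with ratio \<open>1/2\<close>.
\<close>

lemma theta_sum:
  fixes y :: real
  assumes F: "finite F"
  shows "(\<Sum>z\<in>F. exp (- (y - real z)\<^sup>2)) \<le> 4"
proof -
  have half: "(\<Sum>z\<in>G. exp (- (y - real z)\<^sup>2)) \<le> 2"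
    if G: "finite G" and inj: "inj_on k G" and far: "\<And>z. z \<in> G \<Longrightarrow> real (k z) \<le> \<bar>y - real z\<bar>"
    for G and k :: "nat \<Rightarrow> nat"
  proof -
    have "(\<Sum>z\<in>G. exp (- (y - real z)\<^sup>2)) \<le> (\<Sum>z\<in>G. (1/2) ^ k z)"
    proof (rule sum_mono)
      fix z assume z: "z \<in> G"
      have "real (k z) \<le> real (k z) * real (k z)"
        by (cases "k z") (auto simp: algebra_simps)
      also have "\<dots> \<le> \<bar>y - real z\<bar> * \<bar>y - real z\<bar>"
        using far[OF z] by (intro mult_mono) auto
      finally have "real (k z) \<le> (y - real z)\<^sup>2" by (simp add: power2_eq_square)
      then have "exp (- (y - real z)\<^sup>2) \<le> exp (- 1) ^ k z"
        by (simp add: exp_of_nat_mult[symmetric])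
      also have "\<dots> \<le> (1/2) ^ k z"
      proof (rule power_mono)
        have "(2::real) \<le> exp 1" using exp_ge_add_one_self[of 1] by simp
        then show "exp (- 1) \<le> (1/2::real)" by (simp add: exp_minus field_simps)
      qed simp
      finally show "exp (- (y - real z)\<^sup>2) \<le> (1/2) ^ k z" .
    qed
    also have "\<dots> = (\<Sum>n\<in>k ` G. (1/2) ^ n)" by (simp add: sum.reindex[OF inj])
    also have "\<dots> \<le> (\<Sum>n. (1/2::real) ^ n)"
      by (rule sum_le_suminf) (use G in \<open>auto intro: summable_geometric\<close>)
    also have "\<dots> = 2" by (subst suminf_geometric) auto
    finally show ?thesis .
  qed
  have "(\<Sum>z\<in>F. exp (- (y - real z)\<^sup>2)) = (\<Sum>z\<in>{z\<in>F. y \<le> real z}. exp (- (y - real z)\<^sup>2))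
     + (\<Sum>z\<in>{z\<in>F. \<not> y \<le> real z}. exp (- (y - real z)\<^sup>2))"
    using F by (subst sum.union_disjoint[symmetric]) (auto intro!: sum.cong)
  also have "(\<Sum>z\<in>{z\<in>F. y \<le> real z}. exp (- (y - real z)\<^sup>2)) \<le> 2"
  proof (rule half[where k="\<lambda>z. z - nat \<lceil>y\<rceil>"])
    show "inj_on (\<lambda>z. z - nat \<lceil>y\<rceil>) {z\<in>F. y \<le> real z}"
    proof (rule inj_onI)
      fix a b assume a: "a \<in> {z\<in>F. y \<le> real z}" and b: "b \<in> {z\<in>F. y \<le> real z}"
        and e: "a - nat \<lceil>y\<rceil> = b - nat \<lceil>y\<rceil>"
      have "nat \<lceil>y\<rceil> \<le> a" "nat \<lceil>y\<rceil> \<le> b" using a b by (auto simp: ceiling_le_iff nat_le_iff)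
      then show "a = b" using e by linarith
    qed
    fix z assume z: "z \<in> {z\<in>F. y \<le> real z}"
    have "nat \<lceil>y\<rceil> \<le> z" using z by (auto simp: ceiling_le_iff nat_le_iff)
    moreover have "y \<le> real (nat \<lceil>y\<rceil>)" by (rule real_nat_ceiling_ge)
    ultimately show "real (z - nat \<lceil>y\<rceil>) \<le> \<bar>y - real z\<bar>" by (simp add: of_nat_diff)
  qed (use F in simp)
  also have "(\<Sum>z\<in>{z\<in>F. \<not> y \<le> real z}. exp (- (y - real z)\<^sup>2)) \<le> 2"
  proof (rule half[where k="\<lambda>z. nat \<lfloor>y\<rfloor> - z"])
    have le: "z \<le> nat \<lfloor>y\<rfloor>" if "\<not> y \<le> real z" for z
      using that by (simp add: le_nat_floor)
    show "inj_on (\<lambda>z. nat \<lfloor>y\<rfloor> - z) {z\<in>F. \<not> y \<le> real z}"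
    proof (rule inj_onI)
      fix a b assume "a \<in> {z\<in>F. \<not> y \<le> real z}" "b \<in> {z\<in>F. \<not> y \<le> real z}"
        and e: "nat \<lfloor>y\<rfloor> - a = nat \<lfloor>y\<rfloor> - b"
      then have "a \<le> nat \<lfloor>y\<rfloor>" "b \<le> nat \<lfloor>y\<rfloor>" using le by auto
      then show "a = b" using e by linarith
    qed
    fix z assume z: "z \<in> {z\<in>F. \<not> y \<le> real z}"
    then have "0 \<le> y" "z \<le> nat \<lfloor>y\<rfloor>" using le by auto
    then have "real (nat \<lfloor>y\<rfloor>) \<le> y" by (simp add: of_nat_floor)
    then show "real (nat \<lfloor>y\<rfloor> - z) \<le> \<bar>y - real z\<bar>" using \<open>z \<le> nat \<lfloor>y\<rfloor>\<close> by (simp add: of_nat_diff)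
  qed (use F in simp)
  finally show ?thesis by simp
qed

text \<open>
  Multiplicative along nodes, because both the number of leaves and the squared distance are
  additive over the four quarters.
\<close>

definition tree_weight :: "(point \<Rightarrow> real) \<Rightarrow> vtree \<Rightarrow> real" where
  "tree_weight f v = (1/16) ^ leaves v * exp (- tree_dist f v / 400)"

lemma tree_weight_pos: "0 < tree_weight f v"
  by (simp add: tree_weight_def)

lemma tree_weight_Node:
  assumes "L2 f"
  shows "tree_weight f (Node v00 v01 v10 v11) = tree_weight (quarter 0 0 f) v00 * tree_weight (quarter 0 1 f) v01
    * (tree_weight (quarter 1 0 f) v10 * tree_weight (quarter 1 1 f) v11)"
proof -
  have "exp (- tree_dist f (Node v00 v01 v10 v11) / 400) = exp (- tree_dist (quarter 0 0 f) v00 / 400)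
    * exp (- tree_dist (quarter 0 1 f) v01 / 400)
    * (exp (- tree_dist (quarter 1 0 f) v10 / 400) * exp (- tree_dist (quarter 1 1 f) v11 / 400))"
    unfolding tree_dist_Node[OF assms] exp_add[symmetric] by (rule arg_cong[where f=exp]) (simp add: field_simps)
  then show ?thesis by (simp add: tree_weight_def power_add)
qed

lemma tree_weight_sum_Leaf:
  assumes f: "L2 f" and F: "finite F" "F \<subseteq> range Leaf"
  shows "(\<Sum>v\<in>F. tree_weight f v) \<le> 1/4"
proof -
  obtain G where G: "F = Leaf ` G" using F(2) by (auto simp: subset_image_iff)
  have inj: "inj_on Leaf G" by (rule inj_onI) simp
  have finG: "finite G" using F(1) inj by (simp add: G finite_image_iff)
  have "(\<Sum>v\<in>F. tree_weight f v) = (\<Sum>z\<in>G. tree_weight f (Leaf z))"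
    by (simp add: G sum.reindex[OF inj])
  also have "\<dots> \<le> (\<Sum>z\<in>G. (1/16) * exp (- (integral\<^sup>L lam f / 20 - real z)\<^sup>2))"
  proof (rule sum_mono)
    fix z
    have "(integral\<^sup>L lam f / 20 - real z)\<^sup>2 = (integral\<^sup>L lam f - 20 * real z)\<^sup>2 / 400"
      by (simp add: power2_eq_square field_simps)
    also have "\<dots> \<le> tree_dist f (Leaf z) / 400" using tree_dist_Leaf[OF f] by (simp add: divide_right_mono)
    finally show "tree_weight f (Leaf z) \<le> (1/16) * exp (- (integral\<^sup>L lam f / 20 - real z)\<^sup>2)"
      by (simp add: tree_weight_def)
  qed
  also have "\<dots> = (1/16) * (\<Sum>z\<in>G. exp (- (integral\<^sup>L lam f / 20 - real z)\<^sup>2))"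
    by (simp only: sum_distrib_left)
  also have "\<dots> \<le> (1/16) * 4" by (intro mult_left_mono theta_sum finG) simp
  finally show ?thesis by simp
qed

text \<open>
  Writing \<open>w\<close> for the supremum over \<open>f\<close> of the total weight, multiplicativity gives
  \<open>w \<le> 1/4 + w\<^sup>4\<close> from one depth to the next, which keeps \<open>w\<close> below \<open>1/2\<close>. The weight \<open>1/16\<close> per leaf makes
  the first term small enough. Only finite families occur, so no summability has to be discussed.
\<close>

lemma tree_weight_sum_depth:
  assumes "finite F" "\<And>v. v \<in> F \<Longrightarrow> depth v \<le> d" "L2 f"
  shows "(\<Sum>v\<in>F. tree_weight f v) \<le> 1/2"
  using assms
proof (induction d arbitrary: F f)
  case 0
  have "F \<subseteq> range Leaf"
  proof
    fix v assume "v \<in> F"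
    then have "depth v \<le> 0" by (rule 0)
    then show "v \<in> range Leaf" by (cases v) auto
  qed
  then have "(\<Sum>v\<in>F. tree_weight f v) \<le> 1/4" using 0 by (intro tree_weight_sum_Leaf)
  then show ?case by simp
next
  case (Suc d)
  define L where "L = F \<inter> range Leaf"
  define N where "N = F - range Leaf"
  have F: "F = L \<union> N" "L \<inter> N = {}" by (auto simp: L_def N_def)
  have fin: "finite L" "finite N" using Suc.prems(1) by (auto simp: L_def N_def)
  have bL: "(\<Sum>v\<in>L. tree_weight f v) \<le> 1/4"
    by (rule tree_weight_sum_Leaf[OF Suc.prems(3) fin(1)]) (simp add: L_def)
  define P where "P a b = (\<lambda>v. subtree v a b) ` N" for a b
  have bP: "(\<Sum>v\<in>P a b. tree_weight (quarter a b f) v) \<le> 1/2" if "a < 2" "b < 2" for a b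
  proof (rule Suc.IH)
    show "finite (P a b)" using fin by (simp add: P_def)
    show "L2 (quarter a b f)" using L2_quarter[OF Suc.prems(3)] that by simp
    fix v assume "v \<in> P a b"
    then obtain w where w: "w \<in> F" "w \<notin> range Leaf" "v = subtree w a b" by (auto simp: P_def N_def)
    then show "depth v \<le> d" using Suc.prems(2)[OF w(1)] by (cases w) (auto split: if_splits)
  qed
  let ?Q = "(P 0 0 \<times> P 0 1) \<times> (P 1 0 \<times> P 1 1)"
  let ?node = "\<lambda>((v00, v01), (v10, v11)). Node v00 v01 v10 v11"
  have finQ: "finite ?Q" using fin by (simp add: P_def)
  have inj: "inj_on ?node ?Q" by (auto intro!: inj_onI)
  have "N \<subseteq> ?node ` ?Q"
  proof
    fix v assume v: "v \<in> N"
    then obtain v00 v01 v10 v11 where e: "v = Node v00 v01 v10 v11" by (cases v) (auto simp: N_def)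
    have s: "subtree v a b \<in> P a b" for a b using v by (simp add: P_def)
    have "((v00, v01), (v10, v11)) \<in> ?Q"
      using s[of 0 0] s[of 0 1] s[of 1 0] s[of 1 1] by (simp add: e)
    then show "v \<in> ?node ` ?Q" unfolding e by (rule rev_image_eqI) simp
  qed
  then have "(\<Sum>v\<in>N. tree_weight f v) \<le> (\<Sum>v\<in>?node ` ?Q. tree_weight f v)"
    by (intro sum_mono2 finite_imageI finQ less_imp_le[OF tree_weight_pos])
  also have "\<dots> = (\<Sum>q\<in>?Q. tree_weight f (?node q))" by (subst sum.reindex[OF inj]) (rule sum.cong, simp_all)
  also have "\<dots> = (\<Sum>((v00, v01), (v10, v11))\<in>?Q. (tree_weight (quarter 0 0 f) v00 * tree_weight (quarter 0 1 f) v01)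
    * (tree_weight (quarter 1 0 f) v10 * tree_weight (quarter 1 1 f) v11))"
    by (rule sum.cong) (auto simp: tree_weight_Node[OF Suc.prems(3)])
  also have "\<dots> = ((\<Sum>v\<in>P 0 0. tree_weight (quarter 0 0 f) v) * (\<Sum>v\<in>P 0 1. tree_weight (quarter 0 1 f) v))
    * ((\<Sum>v\<in>P 1 0. tree_weight (quarter 1 0 f) v) * (\<Sum>v\<in>P 1 1. tree_weight (quarter 1 1 f) v))"
    by (simp add: sum_product sum.cartesian_product case_prod_beta')
  also have "\<dots> \<le> ((1/2) * (1/2)) * ((1/2) * (1/2))"
    by (intro mult_mono bP sum_nonneg mult_nonneg_nonneg less_imp_le[OF tree_weight_pos]) simp_all
  finally have bN: "(\<Sum>v\<in>N. tree_weight f v) \<le> 1/16" by simp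
  have "(\<Sum>v\<in>F. tree_weight f v) = (\<Sum>v\<in>L. tree_weight f v) + (\<Sum>v\<in>N. tree_weight f v)"
    unfolding F(1) by (rule sum.union_disjoint[OF fin F(2)])
  then show ?case using bL bN by linarith
qed

text \<open>
  Every tree counted here has weight at least \<open>16\<^sup>-\<^sup>k exp (-\<rho>/400)\<close>. The labels are unbounded, so it is the
  distance to \<open>f\<close> that makes the number finite, uniformly in \<open>f\<close>.
\<close>

lemma tree_count:
  fixes k :: nat and \<rho> :: real
  assumes f: "L2 f"
  defines "A \<equiv> {v. leaves v \<le> k \<and> tree_dist f v \<le> \<rho>}"
  shows "finite A" "real (card A) \<le> 16 ^ k * exp (\<rho> / 400)"
proof -
  have fin: "real (card F) \<le> 16 ^ k * exp (\<rho> / 400)" if F: "finite F" "F \<subseteq> A" for F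
  proof -
    have d: "depth v \<le> Max (depth ` F)" if "v \<in> F" for v using F that by simp
    have "real (card F) * ((1/16) ^ k * exp (- \<rho> / 400)) = (\<Sum>v\<in>F. (1/16) ^ k * exp (- \<rho> / 400))" by simp
    also have "\<dots> \<le> (\<Sum>v\<in>F. tree_weight f v)"
      unfolding tree_weight_def
      by (intro sum_mono mult_mono power_decreasing) (use F in \<open>auto simp: A_def\<close>)
    also have "\<dots> \<le> 1" using tree_weight_sum_depth[OF F(1) d f] by simp
    finally have "real (card F) * ((1/16) ^ k * exp (- \<rho> / 400)) * (16 ^ k * exp (\<rho> / 400)) \<le> 1 * (16 ^ k * exp (\<rho> / 400))"
      by (intro mult_right_mono) auto
    moreover have "((1/16) ^ k * exp (- \<rho> / 400)) * (16 ^ k * exp (\<rho> / 400)) = (1::real)"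
      by (simp add: power_divide exp_minus)
    ultimately show ?thesis by (simp only: mult.assoc mult_1_left mult_1_right)
  qed
  have "card F \<le> nat \<lfloor>16 ^ k * exp (\<rho> / 400)\<rfloor>" if "F \<subseteq> A" "finite F" for F
    using fin[OF that(2,1)] by (simp add: le_nat_floor)
  then have "finite A \<and> card A \<le> nat \<lfloor>16 ^ k * exp (\<rho> / 400)\<rfloor>"
    by (intro finite_if_finite_subsets_card_bdd) auto
  then show "finite A" by blast
  then show "real (card A) \<le> 16 ^ k * exp (\<rho> / 400)" by (rule fin) simp
qed

section \<open>A separated model\<close>

text \<open>
  A greedy selection: \<open>u\<close> is kept if it is far from all elements that were kept before it.
\<close>

lemma separated_subset_exists:
  assumes wf: "wf r"
  shows "\<exists>S. \<forall>u. u \<in> S \<longleftrightarrow> u \<in> C \<and> (\<forall>v\<in>S. (v, u) \<in> r \<longrightarrow> far v u)"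
proof -
  define acc where "acc = wfrec r (\<lambda>f u. u \<in> C \<and> (\<forall>v. f v \<longrightarrow> (v, u) \<in> r \<longrightarrow> far v u))"
  have "acc u \<longleftrightarrow> u \<in> C \<and> (\<forall>v. acc v \<longrightarrow> (v, u) \<in> r \<longrightarrow> far v u)" for u
    unfolding acc_def by (subst wfrec[OF wf]) (auto simp: cut_apply)
  note acc = this
  have "u \<in> {u. acc u} \<longleftrightarrow> u \<in> C \<and> (\<forall>v\<in>{u. acc u}. (v, u) \<in> r \<longrightarrow> far v u)" for u
    using acc[of u] by (simp only: mem_Collect_eq Ball_def)
  then show ?thesis by blast
qed

definition tree_int :: "vtree \<Rightarrow> point \<Rightarrow> real" where
  "tree_int v z = (tree_fun v z)\<^sup>2"

lemma tree_int_pos_L1: "tree_int v \<in> pos_L1"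
  using tree_fun_L2[of v] by (simp add: pos_L1_def tree_int_def[abs_def] L2_def)

lemma sqrt_tree_int: "sqrt (tree_int v z) = tree_fun v z"
  by (simp add: tree_int_def tree_fun_nonneg)

lemma L2_sqrt: "t \<in> L1_plus \<Longrightarrow> L2 (\<lambda>z. sqrt (t z))"
  using L1_plus_sqrt_sq[of t] by (auto simp: L2_def L1_plus_def)

lemma hell_tree_int:
  assumes "t \<in> L1_plus"
  shows "(hell t (tree_int v))\<^sup>2 = tree_dist (\<lambda>z. sqrt (t z)) v / 2"
  using assms tree_int_pos_L1[of v] pos_L1_subset
  by (subst hell_sq) (auto simp: tree_dist_def sqrt_tree_int)

lemma sixteen_le_exp: "(16::real) \<le> exp 3"
proof -
  have "(13/8::real) \<le> exp (1/2)"
    using exp_lower_Taylor_quadratic[of "1/2"] by (simp add: power2_eq_square)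
  then have "(13/8::real) ^ 6 \<le> exp (1/2) ^ 6" by (intro power_mono) auto
  also have "exp (1/2) ^ 6 = (exp 3 :: real)" by (simp add: exp_of_nat_mult[symmetric])
  finally show ?thesis by (simp add: power_divide eval_nat_numeral)
qed

definition complexity :: "(point \<Rightarrow> real) \<Rightarrow> nat" where
  "complexity u = (LEAST k. \<exists>v. tree_int v = u \<and> leaves v = k)"

lemma complexity_witness:
  assumes "u \<in> range tree_int"
  shows "\<exists>v. tree_int v = u \<and> leaves v = complexity u"
proof -
  obtain w where "tree_int w = u" using assms by auto
  then have "\<exists>v. tree_int v = u \<and> leaves v = leaves w" by blast
  then show ?thesis unfolding complexity_def by (rule LeastI)
qed

lemma complexity_le: "complexity (tree_int v) \<le> leaves v"
  unfolding complexity_def by (rule Least_le) blast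

text \<open>
  Squares of tree functions are selected greedily in the order of complexity, keeping \<open>u\<close> only if
  it has distance at least \<open>50 sqrt (complexity u)\<close> from its predecessors. So selected points are that far
  apart, while a rejected point has a selected one close by, of no larger complexity.
  In a ball of radius \<open>r = 10 x\<close> with at least two selected points, all of them have complexity at
  most \<open>(2 r / 50)\<^sup>2 = 4 x\<^sup>2 / 25\<close>, and \<open>tree_count\<close> with squared \<open>L\<^sub>2\<close>-radius \<open>2 r\<^sup>2\<close> bounds their number by
  \<open>exp (12 x\<^sup>2 / 25 + x\<^sup>2 / 2)\<close>. The large constants 20 and 50 are there to make this at most \<open>exp x\<^sup>2\<close>.
\<close>

theorem model_exists:
  "\<exists>T. T \<noteq> {} \<and> T \<subseteq> pos_L1 \<and> D_model L1_plus hell 10 1 1 T \<and>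
     (\<forall>t\<in>T. \<forall>u\<in>T. (AE x in lam. t x = u x) \<longrightarrow> t = u) \<and>
     (\<forall>v. \<exists>u\<in>T. (hell (tree_int v) u)\<^sup>2 \<le> 2500 * real (leaves v))"
proof -
  define C where "C = range tree_int"
  have CL: "C \<subseteq> L1_plus" using tree_int_pos_L1 pos_L1_subset by (auto simp: C_def)
  define key where "key u = (complexity u, to_nat_on C u)" for u
  have cC: "countable C" by (simp add: C_def)
  define r where "r = inv_image (less_than <*lex*> less_than) key"
  have wf: "wf r" unfolding r_def by (intro wf_inv_image wf_lex_prod wf_less_than)
  obtain T where T: "\<And>u. u \<in> T \<longleftrightarrow> u \<in> C \<and> (\<forall>v\<in>T. (v, u) \<in> r \<longrightarrow> 2500 * real (complexity u) \<le> (hell v u)\<^sup>2)"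
    using separated_subset_exists[OF wf, of C "\<lambda>v u. 2500 * real (complexity u) \<le> (hell v u)\<^sup>2"] by auto
  have TC: "T \<subseteq> C" using T by blast
  have TL: "T \<subseteq> L1_plus" using TC CL by blast
  have sep: "2500 * real (complexity u) \<le> (hell v u)\<^sup>2" if u: "u \<in> T" and v: "v \<in> T" and ne: "u \<noteq> v" for u v
  proof -
    have "to_nat_on C u \<noteq> to_nat_on C v"
      using ne TC u v to_nat_on_inj[OF cC, of u v] by auto
    moreover have r_iff: "(v, u) \<in> r \<longleftrightarrow> complexity v < complexity u \<or>
      complexity v = complexity u \<and> to_nat_on C v < to_nat_on C u" for v u
      by (simp add: r_def key_def)
    \<comment> \<open>totality of the lexicographic order on complexity and number\<close>
    moreover have "b \<noteq> d \<Longrightarrow> (a < c \<or> a = c \<and> b < d) \<or> (c < a \<or> c = a \<and> d < b) \<and> c \<le> a"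
      for a b c d :: nat by arith
    ultimately have "(v, u) \<in> r \<or> (u, v) \<in> r \<and> complexity u \<le> complexity v" by metis
    then consider "(v, u) \<in> r" | "(u, v) \<in> r" "complexity u \<le> complexity v" by blast
    then show ?thesis
    proof cases
      case 1 then show ?thesis using T[of u] u v by blast
    next
      case 2
      then have "2500 * real (complexity v) \<le> (hell u v)\<^sup>2" using T[of v] u v by blast
      moreover have "hell u v = hell v u" using u v TL by (auto intro: hell_commute)
      ultimately show ?thesis using 2(2) by simp
    qed
  qed
  have cpos: "0 < complexity u" if "u \<in> T" for u
  proof -
    have "u \<in> range tree_int" using that TC by (auto simp: C_def)
    then obtain v where "leaves v = complexity u" using complexity_witness by blast
    then show ?thesis using leaves_pos[of v] by simp
  qed
  have cover: "\<exists>u\<in>T. (hell (tree_int v) u)\<^sup>2 \<le> 2500 * real (leaves v)" for v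
  proof (cases "tree_int v \<in> T")
    case True
    have "hell (tree_int v) (tree_int v) = 0" using True TL by (subst hell_eq) auto
    then show ?thesis using True by (intro bexI[of _ "tree_int v"]) auto
  next
    case False
    then obtain u where u: "u \<in> T" "\<not> 2500 * real (complexity (tree_int v)) \<le> (hell u (tree_int v))\<^sup>2"
      using T[of "tree_int v"] by (auto simp: C_def)
    have "hell u (tree_int v) = hell (tree_int v) u"
      using u TL CL by (intro hell_commute) (auto simp: C_def)
    then have "(hell (tree_int v) u)\<^sup>2 \<le> 2500 * real (complexity (tree_int v))" using u(2) by simp
    also have "\<dots> \<le> 2500 * real (leaves v)" using complexity_le[of v] by simp
    finally show ?thesis using u(1) by blast
  qed
  have AEd: "t = u" if t: "t \<in> T" and u: "u \<in> T" and ae: "AE x in lam. t x = u x" for t u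
  proof (rule ccontr)
    assume ne: "t \<noteq> u"
    have "hell u t = sqrt (1/2 * (\<integral>x. (sqrt (u x) - sqrt (t x))\<^sup>2 \<partial>lam))"
      using t u TL by (intro hell_eq) auto
    also have "(\<integral>x. (sqrt (u x) - sqrt (t x))\<^sup>2 \<partial>lam) = (\<integral>x. 0 \<partial>lam)"
    proof (rule integral_cong_AE)
      have "t \<in> borel_measurable lam" "u \<in> borel_measurable lam" using t u TL by (auto simp: L1_plus_def)
      then show "(\<lambda>x. (sqrt (u x) - sqrt (t x))\<^sup>2) \<in> borel_measurable lam" by measurable
      show "AE x in lam. (sqrt (u x) - sqrt (t x))\<^sup>2 = 0" using ae by eventually_elim simp
    qed simp
    finally have "hell u t = 0" by simp
    then show False using sep[OF t u ne] cpos[OF t] by simp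
  qed
  have count: "finite {u\<in>T. hell t u < x * 10} \<and> real (card {u\<in>T. hell t u < x * 10}) \<le> 1 * exp (1 * x\<^sup>2)"
    if x: "2 \<le> x" and t: "t \<in> L1_plus" for t x
  proof -
    define B where "B = {u\<in>T. hell t u < x * 10}"
    have "finite B \<and> real (card B) \<le> exp (x\<^sup>2)"
    proof (cases "\<exists>u. B \<subseteq> {u}")
      case True
      then obtain u where "B \<subseteq> {u}" by blast
      moreover from this have "finite B" by (rule finite_subset) simp
      moreover have "card B \<le> card {u}" by (rule card_mono) (use \<open>B \<subseteq> {u}\<close> in simp_all)
      ultimately have "finite B" "real (card B) \<le> 1" by auto
      moreover have "1 \<le> exp (x\<^sup>2)" by simp
      ultimately show ?thesis by linarith
    next
      case False
      have far: "(hell t u)\<^sup>2 \<le> 100 * x\<^sup>2" if "u \<in> B" for u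
      proof -
        have "(hell t u)\<^sup>2 \<le> (x * 10)\<^sup>2" using that hell_nonneg by (intro power_mono) (auto simp: B_def)
        then show ?thesis by (simp add: power_mult_distrib)
      qed
      \<comment> \<open>two points of the ball have squared distance at most 400 x^2, but at least 2500 times the complexity\<close>
      define k where "k = nat \<lfloor>(4/25) * x\<^sup>2\<rfloor>"
      have cmp: "complexity u \<le> k" if u: "u \<in> B" for u
      proof -
        obtain v where v: "v \<in> B" "v \<noteq> u" using False by blast
        have L: "t \<in> L1_plus" "u \<in> L1_plus" "v \<in> L1_plus" using t u v TL by (auto simp: B_def)
        have "2500 * real (complexity u) \<le> (hell v u)\<^sup>2" using u v by (intro sep) (auto simp: B_def)
        also have "\<dots> \<le> 2 * (hell v t)\<^sup>2 + 2 * (hell t u)\<^sup>2" using L by (intro hell_triangle_sq)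
        also have "hell v t = hell t v" using L by (intro hell_commute)
        finally have "2500 * real (complexity u) \<le> 400 * x\<^sup>2" using far[OF u] far[OF v(1)] by linarith
        then have "real (complexity u) \<le> (4/25) * x\<^sup>2" by simp
        then show ?thesis unfolding k_def by (rule le_nat_floor)
      qed
      define A where "A = {v. leaves v \<le> k \<and> tree_dist (\<lambda>z. sqrt (t z)) v \<le> 200 * x\<^sup>2}"
      have A: "finite A" "real (card A) \<le> 16 ^ k * exp (200 * x\<^sup>2 / 400)"
        unfolding A_def by (rule tree_count[OF L2_sqrt[OF t]])+
      have "B \<subseteq> tree_int ` A"
      proof
        fix u assume u: "u \<in> B"
        then obtain v where v: "tree_int v = u" "leaves v = complexity u"
          using complexity_witness[of u] TC by (auto simp: B_def C_def)
        have "tree_dist (\<lambda>z. sqrt (t z)) v \<le> 200 * x\<^sup>2"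
          using far[OF u] hell_tree_int[OF t, of v] v(1) by simp
        then have "v \<in> A" using v(2) cmp[OF u] by (simp add: A_def)
        then show "u \<in> tree_int ` A" using v(1) by blast
      qed
      then have "finite B" "card B \<le> card A"
        using A(1) by (auto intro: finite_subset surj_card_le)
      have k: "real k \<le> (4/25) * x\<^sup>2" unfolding k_def by (rule of_nat_floor) simp
      have "real (card B) \<le> 16 ^ k * exp (200 * x\<^sup>2 / 400)" using \<open>card B \<le> card A\<close> A(2) by linarith
      also have "\<dots> \<le> exp 3 ^ k * exp (200 * x\<^sup>2 / 400)"
        by (intro mult_right_mono power_mono sixteen_le_exp) auto
      also have "\<dots> = exp (real k * 3 + x\<^sup>2 / 2)" by (simp add: exp_of_nat_mult[symmetric] exp_add)
      also have "\<dots> \<le> exp (x\<^sup>2)" using k zero_le_power2[of x] by (subst exp_le_cancel_iff) linarith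
      finally show ?thesis using \<open>finite B\<close> by blast
    qed
    then show ?thesis by (simp add: B_def)
  qed
  have "D_model L1_plus hell 10 1 1 T"
    unfolding D_model_def using TL count by auto
  moreover have "T \<noteq> {}" using cover by blast
  moreover have "T \<subseteq> pos_L1" using TC tree_int_pos_L1 by (auto simp: C_def)
  ultimately show ?thesis using AEd cover by (intro exI[of _ T]) blast
qed

section \<open>Variation of functions on a grid\<close>

definition grid_TV :: "nat \<Rightarrow> (nat \<Rightarrow> nat \<Rightarrow> real) \<Rightarrow> real" where
  "grid_TV n \<alpha> = (\<Sum>j<n. \<Sum>i<n - 1. \<bar>\<alpha> (Suc i) j - \<alpha> i j\<bar>) + (\<Sum>i<n. \<Sum>j<n - 1. \<bar>\<alpha> i (Suc j) - \<alpha> i j\<bar>)"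

lemma sum_halves:
  fixes n :: nat
  shows "(\<Sum>i<2 * n. g i) = (\<Sum>a<2. \<Sum>i<n. g (i + a * n) :: 'a :: comm_monoid_add)"
proof -
  have "(\<Sum>i<n + n. g i) = (\<Sum>i<n. g i) + (\<Sum>i<n. g (n + i))"
    using sum.atLeastLessThan_concat[of 0 n "n + n" g] sum.shift_bounds_nat_ivl[of g 0 n n]
    by (simp add: lessThan_atLeast0 add.commute)
  then show ?thesis by (simp add: mult_2 numeral_2_eq_2 add.commute)
qed

text \<open>
  The one edge between the two halves is dropped.
\<close>

lemma sum_halves_gap:
  fixes x :: "nat \<Rightarrow> real"
  assumes "\<And>i. 0 \<le> x i"
  shows "(\<Sum>a<2. \<Sum>i<n - 1. x (i + a * n)) \<le> (\<Sum>i<2 * n - 1. x i)"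
proof (cases n)
  case (Suc m)
  have "(\<Sum>i<2 * n - 1. x i) + x (2 * n - 1) = (\<Sum>i<2 * n. x i)"
    using Suc by (simp add: sum.lessThan_Suc[symmetric] del: sum.lessThan_Suc)
  also have "\<dots> = (\<Sum>a<2. \<Sum>i<Suc m. x (i + a * n))"
    using sum_halves[of x n] by (simp only: Suc)
  also have "\<dots> = (\<Sum>a<2. (\<Sum>i<m. x (i + a * n)) + x (m + a * n))" by simp
  also have "\<dots> = (\<Sum>a<2. \<Sum>i<m. x (i + a * n)) + x m + x (2 * n - 1)"
    using Suc by (simp add: numeral_2_eq_2)
  finally show ?thesis using assms[of m] Suc by simp
qed simp

text \<open>
  Edges inside the four quadrants are distinct edges of the whole grid.
\<close>

lemma grid_TV_halves:
  "(\<Sum>a<2. \<Sum>b<2. grid_TV n (\<lambda>i j. \<alpha> (i + a * n) (j + b * n))) \<le> grid_TV (2 * n) \<alpha>"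
proof -
  have 1: "(\<Sum>a<2. \<Sum>b<2. \<Sum>j<n. \<Sum>i<n - 1. \<bar>\<beta> (Suc i + a * n) (j + b * n) - \<beta> (i + a * n) (j + b * n)\<bar>)
    \<le> (\<Sum>j<2 * n. \<Sum>i<2 * n - 1. \<bar>\<beta> (Suc i) j - \<beta> i j\<bar>)" for \<beta> :: "nat \<Rightarrow> nat \<Rightarrow> real"
  proof -
    have "(\<Sum>a<2. \<Sum>b<2. \<Sum>j<n. \<Sum>i<n - 1. \<bar>\<beta> (Suc i + a * n) (j + b * n) - \<beta> (i + a * n) (j + b * n)\<bar>)
      = (\<Sum>b<2. \<Sum>a<2. \<Sum>j<n. \<Sum>i<n - 1. \<bar>\<beta> (Suc (i + a * n)) (j + b * n) - \<beta> (i + a * n) (j + b * n)\<bar>)"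
      unfolding add_Suc by (rule sum.swap)
    also have "\<dots> = (\<Sum>b<2. \<Sum>j<n. \<Sum>a<2. \<Sum>i<n - 1. \<bar>\<beta> (Suc (i + a * n)) (j + b * n) - \<beta> (i + a * n) (j + b * n)\<bar>)"
      by (intro sum.cong refl sum.swap)
    also have "\<dots> \<le> (\<Sum>b<2. \<Sum>j<n. \<Sum>i<2 * n - 1. \<bar>\<beta> (Suc i) (j + b * n) - \<beta> i (j + b * n)\<bar>)"
      by (intro sum_mono sum_halves_gap[of "\<lambda>i. \<bar>\<beta> (Suc i) _ - \<beta> i _\<bar>"]) simp
    also have "\<dots> = (\<Sum>j<2 * n. \<Sum>i<2 * n - 1. \<bar>\<beta> (Suc i) j - \<beta> i j\<bar>)"
      by (rule sum_halves[symmetric])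
    finally show ?thesis .
  qed
  have "(\<Sum>a<2. \<Sum>b<2. \<Sum>i<n. \<Sum>j<n - 1. \<bar>\<alpha> (i + a * n) (Suc j + b * n) - \<alpha> (i + a * n) (j + b * n)\<bar>)
      = (\<Sum>b<2. \<Sum>a<2. \<Sum>i<n. \<Sum>j<n - 1. \<bar>\<alpha> (i + a * n) (Suc j + b * n) - \<alpha> (i + a * n) (j + b * n)\<bar>)"
    by (rule sum.swap)
  also have "\<dots> \<le> (\<Sum>i<2 * n. \<Sum>j<2 * n - 1. \<bar>\<alpha> i (Suc j) - \<alpha> i j\<bar>)"
    by (rule 1[of "\<lambda>j i. \<alpha> i j"])
  finally show ?thesis using 1[of \<alpha>] by (simp add: grid_TV_def sum.distrib)
qed

lemma variation_bound:
  fixes x :: "nat \<Rightarrow> real"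
  assumes "i < n" "k < n"
  shows "\<bar>x i - x k\<bar> \<le> (\<Sum>l<n - 1. \<bar>x (Suc l) - x l\<bar>)"
proof -
  have *: "\<bar>x i - x k\<bar> \<le> (\<Sum>l<n - 1. \<bar>x (Suc l) - x l\<bar>)" if "i \<le> k" "k < n" for i k
  proof -
    have "x k - x i = (\<Sum>l=i..<k. x (Suc l) - x l)" using that by (simp add: sum_Suc_diff')
    then have "\<bar>x i - x k\<bar> = \<bar>\<Sum>l=i..<k. x (Suc l) - x l\<bar>" by simp
    also have "\<dots> \<le> (\<Sum>l=i..<k. \<bar>x (Suc l) - x l\<bar>)" by (rule sum_abs)
    also have "\<dots> \<le> (\<Sum>l<n - 1. \<bar>x (Suc l) - x l\<bar>)" using that by (intro sum_mono2) auto
    finally show ?thesis .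
  qed
  show ?thesis using *[of i k] *[of k i] assms by (cases "i \<le> k") (auto simp: abs_minus_commute)
qed

lemma sum_pairwise_sq:
  fixes f :: "'a \<Rightarrow> real"
  assumes "finite A"
  shows "(\<Sum>p\<in>A. \<Sum>q\<in>A. (f p - f q)\<^sup>2) = 2 * real (card A) * (\<Sum>p\<in>A. (f p)\<^sup>2) - 2 * (\<Sum>p\<in>A. f p)\<^sup>2"
proof -
  have "(\<Sum>p\<in>A. \<Sum>q\<in>A. (f p - f q)\<^sup>2) = (\<Sum>p\<in>A. \<Sum>q\<in>A. (f p)\<^sup>2 + (f q)\<^sup>2 - 2 * (f p * f q))"
    by (intro sum.cong refl) (simp add: power2_eq_square algebra_simps)
  also have "\<dots> = (\<Sum>p\<in>A. \<Sum>q\<in>A. (f p)\<^sup>2) + (\<Sum>p\<in>A. \<Sum>q\<in>A. (f q)\<^sup>2) - (\<Sum>p\<in>A. \<Sum>q\<in>A. 2 * (f p * f q))"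
    by (simp only: sum.distrib sum_subtractf)
  also have "(\<Sum>p\<in>A. \<Sum>q\<in>A. (f p)\<^sup>2) = real (card A) * (\<Sum>p\<in>A. (f p)\<^sup>2)"
    by (simp add: sum_distrib_left)
  also have "(\<Sum>p\<in>A. \<Sum>q\<in>A. (f q)\<^sup>2) = real (card A) * (\<Sum>p\<in>A. (f p)\<^sup>2)" by simp
  also have "(\<Sum>p\<in>A. \<Sum>q\<in>A. 2 * (f p * f q)) = 2 * (\<Sum>p\<in>A. f p)\<^sup>2"
    by (simp only: sum_distrib_left[symmetric] sum_product power2_eq_square)
  finally show ?thesis by simp
qed

text \<open>
  Discrete form of the Sobolev inequality of Gagliardo and Nirenberg in dimension two, where \<open>BV\<close>
  embeds into \<open>L\<^sub>2\<close> without loss of scale. Two points are joined by a path that follows a row and then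
  a column, or by one that follows a column and then a row; multiplying the two bounds for the
  difference separates the variables, so that summing over all pairs only yields products of the total
  variations along rows and columns.
\<close>

lemma grid_Poincare:
  assumes "0 < n"
  shows "(\<Sum>i<n. \<Sum>j<n. (\<alpha> i j)\<^sup>2) - (\<Sum>i<n. \<Sum>j<n. \<alpha> i j)\<^sup>2 / real n ^ 2 \<le> (grid_TV n \<alpha>)\<^sup>2 / 2"
proof -
  define row where "row j = (\<Sum>i<n - 1. \<bar>\<alpha> (Suc i) j - \<alpha> i j\<bar>)" for j
  define col where "col i = (\<Sum>j<n - 1. \<bar>\<alpha> i (Suc j) - \<alpha> i j\<bar>)" for i
  define R where "R = (\<Sum>j<n. row j)"
  define S where "S = (\<Sum>i<n. col i)"
  have TV: "grid_TV n \<alpha> = R + S" by (simp add: grid_TV_def R_def S_def row_def col_def)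
  have r0: "0 \<le> row j" and c0: "0 \<le> col i" for i j by (auto simp: row_def col_def sum_nonneg)
  let ?A = "{..<n} \<times> {..<n}"
  let ?f = "\<lambda>p. \<alpha> (fst p) (snd p)"
  have pw: "(?f p - ?f q)\<^sup>2 \<le> row (snd p) * col (fst p) + row (snd p) * row (snd q)
      + col (fst p) * col (fst q) + row (snd q) * col (fst q)" if "p \<in> ?A" "q \<in> ?A" for p q
  proof -
    obtain i j k l where pq: "p = (i, j)" "q = (k, l)" by (metis prod.collapse)
    then have p: "p = (i, j)" "q = (k, l)" "i < n" "j < n" "k < n" "l < n" using that by auto
    have h: "\<bar>\<alpha> i j - \<alpha> k j\<bar> \<le> row j" "\<bar>\<alpha> i l - \<alpha> k l\<bar> \<le> row l"
      unfolding row_def using p variation_bound[of i n k "\<lambda>i. \<alpha> i _"] by auto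
    have v: "\<bar>\<alpha> k j - \<alpha> k l\<bar> \<le> col k" "\<bar>\<alpha> i j - \<alpha> i l\<bar> \<le> col i"
      unfolding col_def using p variation_bound[of j n l] by auto
    have "\<bar>\<alpha> i j - \<alpha> k l\<bar> \<le> row j + col k" "\<bar>\<alpha> i j - \<alpha> k l\<bar> \<le> col i + row l"
      using h v by linarith+
    then have "\<bar>\<alpha> i j - \<alpha> k l\<bar> * \<bar>\<alpha> i j - \<alpha> k l\<bar> \<le> (row j + col k) * (col i + row l)"
      by (intro mult_mono) (use r0 c0 in auto)
    then show ?thesis by (simp add: p power2_eq_square algebra_simps)
  qed
  have s: "(\<Sum>p\<in>?A. g (fst p) (snd p)) = (\<Sum>i<n. \<Sum>j<n. g i j)" for g :: "nat \<Rightarrow> nat \<Rightarrow> real"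
    by (simp add: sum.cartesian_product case_prod_beta')
  have s1: "(\<Sum>p\<in>?A. row (snd p) * col (fst p)) = R * S"
    using s[of "\<lambda>i j. col i * row j"] by (simp add: R_def S_def sum_product[symmetric] mult.commute)
  have s2: "(\<Sum>p\<in>?A. row (snd p)) = real n * R" "(\<Sum>p\<in>?A. col (fst p)) = real n * S"
    using s[of "\<lambda>i j. row j"] s[of "\<lambda>i j. col i"] by (simp_all add: R_def S_def sum_distrib_left)
  have "2 * real (n * n) * (\<Sum>p\<in>?A. (?f p)\<^sup>2) - 2 * (\<Sum>p\<in>?A. ?f p)\<^sup>2 = (\<Sum>p\<in>?A. \<Sum>q\<in>?A. (?f p - ?f q)\<^sup>2)"
    by (subst sum_pairwise_sq) auto
  also have "\<dots> \<le> (\<Sum>p\<in>?A. \<Sum>q\<in>?A. row (snd p) * col (fst p) + row (snd p) * row (snd q)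
      + col (fst p) * col (fst q) + row (snd q) * col (fst q))"
    by (intro sum_mono pw)
  also have "\<dots> = real (n * n) * (R * S) + (real n * R) * (real n * R) + (real n * S) * (real n * S)
      + real (n * n) * (R * S)"
    unfolding sum.distrib s2[symmetric] sum_product s1[symmetric] by (simp add: sum_distrib_left)
  also have "\<dots> = real n ^ 2 * (R + S)\<^sup>2" by (simp add: power2_eq_square algebra_simps)
  finally have "2 * real (n * n) * (\<Sum>i<n. \<Sum>j<n. (\<alpha> i j)\<^sup>2) - 2 * (\<Sum>i<n. \<Sum>j<n. \<alpha> i j)\<^sup>2
      \<le> real n ^ 2 * (R + S)\<^sup>2"
    using s[of "\<lambda>i j. (\<alpha> i j)\<^sup>2"] s[of \<alpha>] by simp
  then show ?thesis using assms by (simp add: TV field_simps power2_eq_square)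
qed

section \<open>Dyadic averages\<close>

definition cell :: "nat \<Rightarrow> nat \<Rightarrow> nat \<Rightarrow> point set" where
  "cell J i j = {real i / 2 ^ J ..< (real i + 1) / 2 ^ J} \<times> {real j / 2 ^ J ..< (real j + 1) / 2 ^ J}"

definition avg :: "nat \<Rightarrow> (point \<Rightarrow> real) \<Rightarrow> nat \<Rightarrow> nat \<Rightarrow> real" where
  "avg J f i j = 4 ^ J * (\<integral>z. indicator (cell J i j) z * f z \<partial>lam)"

lemma cell_sets [measurable]: "cell J i j \<in> sets borel"
  unfolding cell_def by (simp add: borel_prod[symmetric])

lemma cell_measurable [measurable]: "(\<lambda>z. indicator (cell J i j) z :: real) \<in> borel_measurable lam"
  unfolding lam_def by (intro measurable_restrict_space1) measurable

lemma integrable_cell: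
  assumes f: "integrable lam f"
  shows "integrable lam (\<lambda>z. indicator (cell J i j) z * f z :: real)"
proof (rule Bochner_Integration.integrable_bound[OF f])
  have [measurable]: "f \<in> borel_measurable lam" using f by auto
  show "(\<lambda>z. indicator (cell J i j) z * f z) \<in> borel_measurable lam" by measurable
qed (auto simp: indicator_def)

lemma dyadic_interval_half:
  fixes x :: real
  assumes "0 \<le> x" "x < 1" "i < 2 ^ J" "a < 2" "a' < 2"
  shows "real (i + a * 2 ^ J) / 2 ^ Suc J \<le> (x + real a') / 2 \<and> (x + real a') / 2 < (real (i + a * 2 ^ J) + 1) / 2 ^ Suc J
    \<longleftrightarrow> a' = a \<and> real i / 2 ^ J \<le> x \<and> x < (real i + 1) / 2 ^ J"
proof -
  have e: "real (i + a * 2 ^ J) / 2 ^ Suc J = (real i / 2 ^ J + real a) / 2"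
    "(real (i + a * 2 ^ J) + 1) / 2 ^ Suc J = ((real i + 1) / 2 ^ J + real a) / 2"
    by (simp_all add: field_simps)
  have "real i + 1 \<le> 2 ^ J" using assms(3) by (metis Suc_eq_plus1 Suc_leI of_nat_1 of_nat_add of_nat_le_iff of_nat_numeral of_nat_power)
  then have b: "(real i + 1) / 2 ^ J \<le> 1" "0 \<le> real i / 2 ^ J" by (simp_all add: divide_le_eq)
  have "(L + real a) / 2 \<le> (x + real a') / 2 \<and> (x + real a') / 2 < (U + real a) / 2
    \<longleftrightarrow> a' = a \<and> L \<le> x \<and> x < U" if "0 \<le> L" "U \<le> 1" for L U :: real
  proof -
    consider "a' = a" | "a = 0" "a' = 1" | "a = 1" "a' = 0" using assms(4,5) by linarith
    then show ?thesis using that assms(1,2) by cases auto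
  qed
  from this[OF b(2,1)] show ?thesis unfolding e .
qed

lemma cell_half:
  assumes z: "z \<in> unit_square" and ij: "i < 2 ^ J" "j < 2 ^ J" and ab: "a < 2" "b < 2" "a' < 2" "b' < 2"
  shows "((fst z + real a') / 2, (snd z + real b') / 2) \<in> cell (Suc J) (i + a * 2 ^ J) (j + b * 2 ^ J)
    \<longleftrightarrow> a' = a \<and> b' = b \<and> z \<in> cell J i j"
  using z dyadic_interval_half[of "fst z" i J a a'] dyadic_interval_half[of "snd z" j J b b'] ij ab
  by (cases z) (auto simp: cell_def unit_square_def simp del: power_Suc)

lemma sum_2x2_delta:
  fixes a b :: nat and X :: real
  shows "a < 2 \<Longrightarrow> b < 2 \<Longrightarrow> (\<Sum>a'<2. \<Sum>b'<2. if a' = a \<and> b' = b then X else 0) = X"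
  by (auto simp: numeral_2_eq_2 less_Suc_eq)

text \<open>
  Of the four quarters of the restriction of \<open>f\<close> to a small cell only one does not vanish.
\<close>

lemma avg_quarter:
  assumes f: "integrable lam f" and ij: "i < 2 ^ J" "j < 2 ^ J" and ab: "a < 2" "b < 2"
  shows "avg (Suc J) f (i + a * 2 ^ J) (j + b * 2 ^ J) = 2 * avg J (quarter a b f) i j"
proof -
  let ?c = "cell (Suc J) (i + a * 2 ^ J) (j + b * 2 ^ J)"
  have q: "integral\<^sup>L lam (quarter a' b' (\<lambda>z. indicator ?c z * f z))
    = (if a' = a \<and> b' = b then \<integral>z. indicator (cell J i j) z * quarter a b f z \<partial>lam else 0)"
    if "a' < 2" "b' < 2" for a' b'
  proof -
    have "integral\<^sup>L lam (quarter a' b' (\<lambda>z. indicator ?c z * f z))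
      = (\<integral>z. (if a' = a \<and> b' = b then indicator (cell J i j) z * quarter a b f z else 0) \<partial>lam)"
    proof (rule Bochner_Integration.integral_cong[OF refl])
      fix z assume "z \<in> space lam"
      then have z: "z \<in> unit_square" by (simp add: space_lam)
      show "quarter a' b' (\<lambda>z. indicator ?c z * f z) z
        = (if a' = a \<and> b' = b then indicator (cell J i j) z * quarter a b f z else 0)"
        using cell_half[OF z ij ab that] by (auto simp: quarter_def indicator_def)
    qed
    also have "\<dots> = (if a' = a \<and> b' = b then \<integral>z. indicator (cell J i j) z * quarter a b f z \<partial>lam else 0)"
      by (cases "a' = a \<and> b' = b") (simp_all only: if_True if_False simp_thms integral_zero)
    finally show ?thesis .
  qed
  have "(\<integral>z. indicator ?c z * f z \<partial>lam) = (\<Sum>a'<2. \<Sum>b'<2. integral\<^sup>L lam (quarter a' b' (\<lambda>z. indicator ?c z * f z))) / 2"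
    by (rule integral_quarters) (rule integrable_cell[OF f])
  also have "(\<Sum>a'<2. \<Sum>b'<2. integral\<^sup>L lam (quarter a' b' (\<lambda>z. indicator ?c z * f z)))
    = (\<integral>z. indicator (cell J i j) z * quarter a b f z \<partial>lam)"
  proof -
    have "(\<Sum>a'<2. \<Sum>b'<2. integral\<^sup>L lam (quarter a' b' (\<lambda>z. indicator ?c z * f z)))
      = (\<Sum>a'<2. \<Sum>b'<2. if a' = a \<and> b' = b then \<integral>z. indicator (cell J i j) z * quarter a b f z \<partial>lam else 0)"
      by (intro sum.cong refl q) simp_all
    then show ?thesis using sum_2x2_delta[OF ab] by (simp only:)
  qed
  finally show ?thesis by (simp add: avg_def)
qed

lemma sum_avg_Suc:
  fixes h :: "real \<Rightarrow> real"
  assumes f: "integrable lam f"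
  shows "(\<Sum>i<2 ^ Suc J. \<Sum>j<2 ^ Suc J. h (avg (Suc J) f i j))
    = (\<Sum>a<2. \<Sum>b<2. \<Sum>i<2 ^ J. \<Sum>j<2 ^ J. h (2 * avg J (quarter a b f) i j))"
proof -
  have "(\<Sum>i<2 ^ Suc J. \<Sum>j<2 ^ Suc J. h (avg (Suc J) f i j))
    = (\<Sum>a<2. \<Sum>i<2 ^ J. \<Sum>b<2. \<Sum>j<2 ^ J. h (avg (Suc J) f (i + a * 2 ^ J) (j + b * 2 ^ J)))"
    unfolding power_Suc sum_halves ..
  also have "\<dots> = (\<Sum>a<2. \<Sum>b<2. \<Sum>i<2 ^ J. \<Sum>j<2 ^ J. h (avg (Suc J) f (i + a * 2 ^ J) (j + b * 2 ^ J)))"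
    by (intro sum.cong refl sum.swap)
  also have "\<dots> = (\<Sum>a<2. \<Sum>b<2. \<Sum>i<2 ^ J. \<Sum>j<2 ^ J. h (2 * avg J (quarter a b f) i j))"
    by (intro sum.cong refl) (simp add: avg_quarter[OF f])
  finally show ?thesis .
qed

text \<open>
  The squared norm of the projection of \<open>f\<close> onto functions that are constant on the cells of
  level \<open>J\<close>.
\<close>

definition energy :: "nat \<Rightarrow> (point \<Rightarrow> real) \<Rightarrow> real" where
  "energy J f = (\<Sum>i<2 ^ J. \<Sum>j<2 ^ J. (avg J f i j)\<^sup>2) / 4 ^ J"

text \<open>
  The factor is the length of an edge, so this is the total variation of the piecewise constant
  projection of \<open>f\<close>, in the anisotropic sense.
\<close>

definition dyadic_TV :: "nat \<Rightarrow> (point \<Rightarrow> real) \<Rightarrow> real" where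
  "dyadic_TV J f = grid_TV (2 ^ J) (avg J f) / 2 ^ J"

lemma avg_0: "avg 0 f 0 0 = integral\<^sup>L lam f"
  unfolding avg_def by (simp, rule Bochner_Integration.integral_cong)
    (auto simp: space_lam unit_square_def cell_def indicator_def)

lemma energy_Suc:
  assumes f: "integrable lam f"
  shows "energy (Suc J) f = (\<Sum>a<2. \<Sum>b<2. energy J (quarter a b f))"
  unfolding energy_def sum_avg_Suc[OF f, of "\<lambda>x. x\<^sup>2"]
  by (simp add: power_mult_distrib sum_distrib_left[symmetric] sum_divide_distrib[symmetric])

lemma mean_avg:
  assumes f: "integrable lam f"
  shows "(\<Sum>i<2 ^ J. \<Sum>j<2 ^ J. avg J f i j) = 4 ^ J * integral\<^sup>L lam f"
  using f
proof (induction J arbitrary: f)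
  case (Suc J)
  have "(\<Sum>i<2 ^ Suc J. \<Sum>j<2 ^ Suc J. avg (Suc J) f i j)
    = (\<Sum>a<2. \<Sum>b<2. \<Sum>i<2 ^ J. \<Sum>j<2 ^ J. 2 * avg J (quarter a b f) i j)"
    by (rule sum_avg_Suc[OF Suc.prems, of "\<lambda>x. x"])
  also have "\<dots> = (\<Sum>a<2. \<Sum>b<2. 2 * (4 ^ J * integral\<^sup>L lam (quarter a b f)))"
    by (intro sum.cong refl) (simp add: sum_distrib_left[symmetric] Suc.IH[OF integrable_quarter[OF Suc.prems]])
  also have "\<dots> = 4 ^ Suc J * integral\<^sup>L lam f"
    by (simp add: integral_quarters[OF Suc.prems] sum_distrib_left[symmetric])
  finally show ?case .
qed (simp add: avg_0)

lemma dyadic_TV_nonneg: "0 \<le> dyadic_TV J f"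
  by (simp add: dyadic_TV_def grid_TV_def sum_nonneg)

lemma grid_TV_cong:
  assumes "\<And>i j. i < n \<Longrightarrow> j < n \<Longrightarrow> \<alpha> i j = \<beta> i j"
  shows "grid_TV n \<alpha> = grid_TV n \<beta>"
  unfolding grid_TV_def using assms by (intro arg_cong2[where f="(+)"] sum.cong refl) auto

lemma grid_TV_scale: "grid_TV n (\<lambda>i j. c * \<alpha> i j) = \<bar>c\<bar> * grid_TV n \<alpha>"
  by (simp add: grid_TV_def right_diff_distrib[symmetric] abs_mult sum_distrib_left[symmetric] distrib_left)

lemma dyadic_TV_Suc:
  assumes f: "integrable lam f"
  shows "(\<Sum>a<2. \<Sum>b<2. dyadic_TV J (quarter a b f)) \<le> dyadic_TV (Suc J) f"
proof -
  have "(\<Sum>a<2. \<Sum>b<2. 2 * grid_TV (2 ^ J) (avg J (quarter a b f)))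
    = (\<Sum>a<2. \<Sum>b<2. grid_TV (2 ^ J) (\<lambda>i j. avg (Suc J) f (i + a * 2 ^ J) (j + b * 2 ^ J)))"
  proof (intro sum.cong refl)
    fix a b :: nat assume ab: "a \<in> {..<2}" "b \<in> {..<2}"
    have "grid_TV (2 ^ J) (\<lambda>i j. avg (Suc J) f (i + a * 2 ^ J) (j + b * 2 ^ J))
      = grid_TV (2 ^ J) (\<lambda>i j. 2 * avg J (quarter a b f) i j)"
      using ab by (intro grid_TV_cong avg_quarter[OF f]) auto
    then show "2 * grid_TV (2 ^ J) (avg J (quarter a b f))
      = grid_TV (2 ^ J) (\<lambda>i j. avg (Suc J) f (i + a * 2 ^ J) (j + b * 2 ^ J))"
      by (simp add: grid_TV_scale)
  qed
  also have "\<dots> \<le> grid_TV (2 ^ Suc J) (avg (Suc J) f)"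
    unfolding power_Suc by (rule grid_TV_halves)
  finally have "(\<Sum>a<2. \<Sum>b<2. grid_TV (2 ^ J) (avg J (quarter a b f))) * 2 \<le> grid_TV (2 ^ Suc J) (avg (Suc J) f)"
    by (simp add: sum_distrib_left[symmetric] mult.commute)
  then have "(\<Sum>a<2. \<Sum>b<2. grid_TV (2 ^ J) (avg J (quarter a b f))) / 2 ^ J \<le> grid_TV (2 ^ Suc J) (avg (Suc J) f) / 2 ^ Suc J"
    by (simp add: field_simps)
  then show ?thesis by (simp add: dyadic_TV_def sum_divide_distrib)
qed

text \<open>
  The squared distance from \<open>f\<close> to its projection of level \<open>J\<close>, by Pythagoras.
\<close>

definition residual :: "nat \<Rightarrow> (point \<Rightarrow> real) \<Rightarrow> real" where
  "residual J f = (\<integral>z. (f z)\<^sup>2 \<partial>lam) - energy J f"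

lemma residual_Suc: "L2 f \<Longrightarrow> residual (Suc J) f = (\<Sum>a<2. \<Sum>b<2. residual J (quarter a b f))"
  by (simp add: residual_def sq_quarters energy_Suc L2_integrable sum_subtractf)

section \<open>Approximation by trees\<close>

text \<open>
  The error splits orthogonally into the part beyond level \<open>J\<close>, the oscillation of the averages
  around the mean (bounded by the discrete Sobolev inequality) and the rounding of the mean to the
  lattice, which costs at most \<open>20\<^sup>2\<close>.
\<close>

lemma leaf_approx:
  assumes f: "L2 f" "\<And>z. 0 \<le> f z"
  shows "\<exists>z. tree_dist f (Leaf z) \<le> residual J f + (dyadic_TV J f)\<^sup>2 / 2 + 400"
proof -
  define m where "m = integral\<^sup>L lam f"
  define z where "z = nat \<lfloor>m / 20\<rfloor>"
  have m0: "0 \<le> m" unfolding m_def using f by simp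
  have "real z \<le> m / 20" "m / 20 < real z + 1" 
    unfolding z_def using m0 of_int_floor_le[of "m / 20"] floor_correct[of "m / 20"] by (simp_all add: of_nat_nat)
  then have "\<bar>m - 20 * real z\<bar> \<le> 20" by linarith
  then have mz: "(m - 20 * real z)\<^sup>2 \<le> 400" using power_mono[of "\<bar>m - 20 * real z\<bar>" 20 2] by simp
  have i: "integrable lam f" by (rule L2_integrable[OF f(1)])
  have i2: "integrable lam (\<lambda>z. (f z)\<^sup>2)" using f by (simp add: L2_def)
  have "tree_dist f (Leaf z) = (\<integral>x. (f x)\<^sup>2 - 40 * real z * f x + (20 * real z)\<^sup>2 \<partial>lam)"
    unfolding tree_dist_def by (intro Bochner_Integration.integral_cong refl) (simp add: power2_eq_square algebra_simps)
  also have "\<dots> = (\<integral>x. (f x)\<^sup>2 \<partial>lam) - 40 * real z * m + (20 * real z)\<^sup>2"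
    using i i2 by (simp add: m_def lam.prob_space)
  also have "\<dots> = (\<integral>x. (f x)\<^sup>2 \<partial>lam) - m\<^sup>2 + (m - 20 * real z)\<^sup>2"
    by (simp add: power2_eq_square algebra_simps)
  finally have d: "tree_dist f (Leaf z) \<le> (\<integral>x. (f x)\<^sup>2 \<partial>lam) - m\<^sup>2 + 400" using mz by simp
  have four: "(2 ^ J) ^ 2 = (4 ^ J :: real)" by (simp add: power_mult[symmetric] power2_eq_square power_mult_distrib[symmetric])
  have "(\<Sum>i<2 ^ J. \<Sum>j<2 ^ J. (avg J f i j)\<^sup>2) - (\<Sum>i<2 ^ J. \<Sum>j<2 ^ J. avg J f i j)\<^sup>2 / real (2 ^ J) ^ 2
    \<le> (grid_TV (2 ^ J) (avg J f))\<^sup>2 / 2"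
    by (rule grid_Poincare) simp
  then have "4 ^ J * energy J f - 4 ^ J * m\<^sup>2 \<le> 4 ^ J * ((dyadic_TV J f)\<^sup>2 / 2)"
    by (simp add: mean_avg[OF i] energy_def dyadic_TV_def four m_def power_divide power_mult_distrib power2_eq_square[of "4 ^ J"])
  then have "4 ^ J * (energy J f - m\<^sup>2) \<le> 4 ^ J * ((dyadic_TV J f)\<^sup>2 / 2)" by (simp only: right_diff_distrib)
  then have "energy J f - m\<^sup>2 \<le> (dyadic_TV J f)\<^sup>2 / 2" by (rule mult_left_le_imp_le) simp
  then show ?thesis using d by (intro exI[of _ z]) (simp add: residual_def)
qed

lemma quarter_nonneg: "(\<And>z. 0 \<le> f z) \<Longrightarrow> 0 \<le> quarter a b f z"
  by (simp add: quarter_def)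

lemma sum_2x2:
  fixes h :: "nat \<Rightarrow> nat \<Rightarrow> real"
  shows "(\<Sum>a<2. \<Sum>b<2. h a b) = h 0 0 + h 0 1 + h 1 0 + h 1 1"
  by (simp add: numeral_2_eq_2)

text \<open>
  A square is split while its variation exceeds \<open>\<epsilon>\<close> and its depth is below \<open>J\<close>. On each level the
  variations of the squares add up to at most the total, so at most \<open>V/\<epsilon>\<close> squares are split per level.
  A leaf with variation \<open>V\<^sub>Q \<le> \<epsilon>\<close> contributes \<open>V\<^sub>Q\<^sup>2/2 \<le> \<epsilon> V\<^sub>Q/2\<close>, and these add up to \<open>\<epsilon> V/2\<close> whatever the number
  of leaves. The induction on \<open>J\<close> peels off the root.
\<close>

theorem tree_approx:
  assumes "L2 f" "\<And>z. 0 \<le> f z" and e: "0 < \<epsilon>"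
  shows "\<exists>v. real (leaves v) \<le> 1 + 3 * real J * dyadic_TV J f / \<epsilon> \<and>
    tree_dist f v \<le> residual J f + \<epsilon> * dyadic_TV J f / 2 + 400 * real (leaves v)"
  using assms(1,2)
proof (induction J arbitrary: f)
  case 0
  obtain z where "tree_dist f (Leaf z) \<le> residual 0 f + (dyadic_TV 0 f)\<^sup>2 / 2 + 400"
    using leaf_approx[OF 0] by blast
  moreover have "dyadic_TV 0 f = 0" by (simp add: dyadic_TV_def grid_TV_def)
  ultimately show ?case by (intro exI[of _ "Leaf z"]) simp
next
  case (Suc J)
  define V where "V = dyadic_TV (Suc J) f"
  have V0: "0 \<le> V" by (simp add: V_def dyadic_TV_nonneg)
  show ?case
  proof (cases "V \<le> \<epsilon>")
    case True
    obtain z where z: "tree_dist f (Leaf z) \<le> residual (Suc J) f + V\<^sup>2 / 2 + 400"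
      using leaf_approx[OF Suc.prems] unfolding V_def by blast
    have "V\<^sup>2 \<le> \<epsilon> * V" using True V0 by (simp add: power2_eq_square mult_right_mono)
    then have "tree_dist f (Leaf z) \<le> residual (Suc J) f + \<epsilon> * V / 2 + 400 * real (leaves (Leaf z))" using z by simp
    moreover have "0 \<le> 3 * real (Suc J) * V / \<epsilon>" using V0 e by simp
    then have "real (leaves (Leaf z)) \<le> 1 + 3 * real (Suc J) * V / \<epsilon>" by simp
    ultimately show ?thesis unfolding V_def[symmetric] by blast
  next
    case False
    have "\<exists>v. real (leaves v) \<le> 1 + 3 * real J * dyadic_TV J (quarter a b f) / \<epsilon> \<and>
      tree_dist (quarter a b f) v \<le> residual J (quarter a b f) + \<epsilon> * dyadic_TV J (quarter a b f) / 2 + 400 * real (leaves v)"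
      if "a < 2" "b < 2" for a b
      using that Suc.prems by (intro Suc.IH L2_quarter quarter_nonneg) auto
    then obtain w where w: "\<And>a b. a < 2 \<Longrightarrow> b < 2 \<Longrightarrow> real (leaves (w a b)) \<le> 1 + 3 * real J * dyadic_TV J (quarter a b f) / \<epsilon>"
      "\<And>a b. a < 2 \<Longrightarrow> b < 2 \<Longrightarrow> tree_dist (quarter a b f) (w a b)
         \<le> residual J (quarter a b f) + \<epsilon> * dyadic_TV J (quarter a b f) / 2 + 400 * real (leaves (w a b))"
      by metis
    let ?v = "Node (w 0 0) (w 0 1) (w 1 0) (w 1 1)"
    define W where "W = (\<Sum>a<2. \<Sum>b<2. dyadic_TV J (quarter a b f))"
    have WV: "W \<le> V" unfolding W_def V_def by (rule dyadic_TV_Suc[OF L2_integrable[OF Suc.prems(1)]])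
    have "real (leaves ?v) = (\<Sum>a<2. \<Sum>b<2. real (leaves (w a b)))" by (simp add: sum_2x2)
    also have "\<dots> \<le> (\<Sum>a<2. \<Sum>b<2. 1 + 3 * real J * dyadic_TV J (quarter a b f) / \<epsilon>)"
      by (intro sum_mono w) auto
    also have "\<dots> = 4 + 3 * real J * W / \<epsilon>"
      by (simp add: sum_2x2 W_def add_divide_distrib distrib_left)
    also have "\<dots> \<le> 4 + 3 * real J * V / \<epsilon>"
      using WV e by (simp add: divide_right_mono mult_left_mono)
    \<comment> \<open>splitting the root costs three more leaves, paid for by V > eps\<close>
    also have "\<dots> \<le> 1 + 3 * V / \<epsilon> + 3 * real J * V / \<epsilon>"
      using False e by (simp add: pos_le_divide_eq)
    also have "\<dots> = 1 + 3 * real (Suc J) * V / \<epsilon>"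
      by (simp add: add_divide_distrib algebra_simps)
    finally have l: "real (leaves ?v) \<le> 1 + 3 * real (Suc J) * V / \<epsilon>" .
    have "tree_dist f ?v = (\<Sum>a<2. \<Sum>b<2. tree_dist (quarter a b f) (w a b))"
      by (simp add: tree_dist_Node[OF Suc.prems(1)] sum_2x2)
    also have "\<dots> \<le> (\<Sum>a<2. \<Sum>b<2. residual J (quarter a b f) + \<epsilon> * dyadic_TV J (quarter a b f) / 2 + 400 * real (leaves (w a b)))"
      by (intro sum_mono w) auto
    also have "\<dots> = residual (Suc J) f + \<epsilon> * W / 2 + 400 * real (leaves ?v)"
      unfolding residual_Suc[OF Suc.prems(1)] W_def by (simp add: sum_2x2 field_simps)
    also have "\<dots> \<le> residual (Suc J) f + \<epsilon> * V / 2 + 400 * real (leaves ?v)" using WV e by simp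
    finally show ?thesis using l unfolding V_def[symmetric] by blast
  qed
qed

text \<open>
  At level \<open>J\<close> nothing but the part of \<open>f\<close> beyond that level and the rounding errors is lost.
\<close>

theorem full_tree_approx:
  assumes "L2 f" "\<And>z. 0 \<le> f z"
  shows "\<exists>v. leaves v = 4 ^ J \<and> tree_dist f v \<le> residual J f + 400 * 4 ^ J"
  using assms
proof (induction J arbitrary: f)
  case 0
  obtain z where "tree_dist f (Leaf z) \<le> residual 0 f + (dyadic_TV 0 f)\<^sup>2 / 2 + 400"
    using leaf_approx[OF 0] by blast
  moreover have "dyadic_TV 0 f = 0" by (simp add: dyadic_TV_def grid_TV_def)
  ultimately show ?case by (intro exI[of _ "Leaf z"]) simp
next
  case (Suc J)
  have "\<exists>v. leaves v = 4 ^ J \<and> tree_dist (quarter a b f) v \<le> residual J (quarter a b f) + 400 * 4 ^ J"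
    if "a < 2" "b < 2" for a b
    using that Suc.prems by (intro Suc.IH L2_quarter quarter_nonneg) auto
  then obtain w where w: "\<And>a b. a < 2 \<Longrightarrow> b < 2 \<Longrightarrow> leaves (w a b) = 4 ^ J"
    "\<And>a b. a < 2 \<Longrightarrow> b < 2 \<Longrightarrow> tree_dist (quarter a b f) (w a b) \<le> residual J (quarter a b f) + 400 * 4 ^ J"
    by metis
  let ?v = "Node (w 0 0) (w 0 1) (w 1 0) (w 1 1)"
  have "tree_dist f ?v = (\<Sum>a<2. \<Sum>b<2. tree_dist (quarter a b f) (w a b))"
    by (simp add: tree_dist_Node[OF Suc.prems(1)] sum_2x2)
  also have "\<dots> \<le> (\<Sum>a<2. \<Sum>b<2. residual J (quarter a b f) + 400 * 4 ^ J)" by (intro sum_mono w) auto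
  also have "\<dots> = residual (Suc J) f + 400 * 4 ^ Suc J"
    unfolding residual_Suc[OF Suc.prems(1)] by (simp add: sum_2x2)
  finally show ?case using w(1) by (intro exI[of _ ?v]) simp
qed

section \<open>Smooth cut-off functions\<close>

text \<open>
  Second antiderivative of the Heaviside function. All cut-off functions below are built from its
  translates, so their derivatives are explicit.
\<close>

definition half_sq :: "real \<Rightarrow> real" where "half_sq z = (max 0 z)\<^sup>2 / 2"

lemma half_sq_deriv: "(half_sq has_real_derivative max 0 z) (at z)"
proof (cases "z = 0")
  case True
  have "((\<lambda>y. half_sq y / y) \<longlongrightarrow> 0) (at 0)"
  proof (rule Lim_null_comparison)
    show "eventually (\<lambda>y. norm (half_sq y / y) \<le> \<bar>y\<bar>) (at (0::real))"
      by (intro always_eventually allI) (auto simp: half_sq_def max_def power2_eq_square)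
    show "((\<lambda>y. \<bar>y\<bar>) \<longlongrightarrow> 0) (at (0::real))" by (rule tendsto_eq_intros | simp)+
  qed
  then show ?thesis using True by (simp add: has_field_derivative_iff half_sq_def)
next
  case False
  then consider "z < 0" | "z > 0" by linarith
  then show ?thesis
  proof cases
    case 1
    have "((\<lambda>_. 0) has_real_derivative max 0 z) (at z)" using 1 by simp
    then show ?thesis
      by (rule has_field_derivative_transform_within_open[where S="{..<0}"])
        (use 1 in \<open>auto simp: half_sq_def max_def\<close>)
  next
    case 2
    have "((\<lambda>z. z\<^sup>2 / 2) has_real_derivative max 0 z) (at z)"
      using 2 by (auto intro!: derivative_eq_intros)
    then show ?thesis
      by (rule has_field_derivative_transform_within_open[where S="{0<..}"])
        (use 2 in \<open>auto simp: half_sq_def max_def\<close>)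
  qed
qed

definition step1 :: "real \<Rightarrow> real" where "step1 z = max 0 z - max 0 (z - 1)"
text \<open>
  A continuously differentiable step, whose derivative is a hat function on the unit interval.
\<close>

definition step2 :: "real \<Rightarrow> real" where
  "step2 z = 4 * (half_sq z - 2 * half_sq (z - 1/2) + half_sq (z - 1))"
definition step2' :: "real \<Rightarrow> real" where
  "step2' z = 4 * (max 0 z - 2 * max 0 (z - 1/2) + max 0 (z - 1))"
definition istep1 :: "real \<Rightarrow> real" where "istep1 z = half_sq z - half_sq (z - 1)"

lemma affine_deriv:
  assumes "\<And>z. (F has_real_derivative F' z) (at z)"
  shows "((\<lambda>z. F (c * z + d)) has_real_derivative c * F' (c * z + d)) (at z)"
proof -
  have "((\<lambda>z. c * z + d) has_real_derivative c) (at z)" by (auto intro!: derivative_eq_intros)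
  from DERIV_chain2[of F "F' (c * z + d)" "\<lambda>z. c * z + d" z c UNIV, OF assms this]
  show ?thesis by (simp add: mult.commute)
qed

lemma half_sq_shift_deriv: "((\<lambda>z. half_sq (z - a)) has_real_derivative max 0 (z - a)) (at z)"
  using affine_deriv[of half_sq "max 0" 1 "- a" z, OF half_sq_deriv] by simp

lemma istep1_deriv: "(istep1 has_real_derivative step1 z) (at z)"
  unfolding istep1_def[abs_def] step1_def
  by (intro DERIV_diff half_sq_deriv half_sq_shift_deriv)

lemma step2_deriv: "(step2 has_real_derivative step2' z) (at z)"
  unfolding step2_def[abs_def] step2'_def
  by (intro DERIV_cmult DERIV_add DERIV_diff half_sq_deriv half_sq_shift_deriv)

definition is_step :: "(real \<Rightarrow> real) \<Rightarrow> bool" where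
  "is_step S \<longleftrightarrow> mono S \<and> (\<forall>z\<le>0. S z = 0) \<and> (\<forall>z\<ge>1. S z = 1)"

lemma is_step1: "is_step step1"
  by (auto simp: is_step_def step1_def max_def intro!: monoI)

lemma is_step2: "is_step step2"
  unfolding is_step_def
proof (intro conjI allI impI monoI)
  fix x y :: real assume "x \<le> y"
  then show "step2 x \<le> step2 y"
  proof (rule DERIV_nonneg_imp_nondecreasing)
    fix z
    have "0 \<le> step2' z" by (auto simp: step2'_def max_def)
    then show "\<exists>D. (step2 has_real_derivative D) (at z) \<and> 0 \<le> D" using step2_deriv by blast
  qed
next
  fix z :: real assume "z \<le> 0" then show "step2 z = 0" by (simp add: step2_def half_sq_def)
next
  fix z :: real assume "z \<ge> 1"
  then show "step2 z = 1" by (simp add: step2_def half_sq_def max_def power2_eq_square field_simps)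
qed

text \<open>
  For large \<open>c\<close> this approximates the indicator of the interval from 0 to \<open>h\<close> from inside: it rises
  between \<open>1/c\<close> and \<open>2/c\<close> and falls between \<open>h - 2/c\<close> and \<open>h - 1/c\<close>.
\<close>

definition bump :: "(real \<Rightarrow> real) \<Rightarrow> real \<Rightarrow> real \<Rightarrow> real \<Rightarrow> real" where
  "bump S c h z = S (c * z - 1) - S (c * (z - h) + 2)"

lemma bump_props:
  assumes S: "is_step S" and ch: "c * h \<ge> 3"
  shows "0 \<le> bump S c h z" "bump S c h z \<le> 1"
    "c * z \<le> 1 \<Longrightarrow> bump S c h z = 0" "c * (h - z) \<le> 1 \<Longrightarrow> bump S c h z = 0"
    "c * z \<ge> 2 \<Longrightarrow> c * (h - z) \<ge> 2 \<Longrightarrow> bump S c h z = 1"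
proof -
  have m: "S a \<le> S b" if "a \<le> b" for a b using S that by (auto simp: is_step_def monoD)
  have z0: "S a = 0" if "a \<le> 0" for a using S that by (auto simp: is_step_def)
  have z1: "S a = 1" if "1 \<le> a" for a using S that by (auto simp: is_step_def)
  have b: "0 \<le> S a" "S a \<le> 1" for a
  proof -
    show "0 \<le> S a" using z0[of a] m[of 0 a] z0[of 0] by (cases "a \<le> 0") auto
    show "S a \<le> 1" using z1[of a] m[of a 1] z1[of 1] by (cases "1 \<le> a") auto
  qed
  have e: "c * (z - h) = c * z - c * h" "c * (h - z) = c * h - c * z" by (simp_all add: algebra_simps)
  show "0 \<le> bump S c h z" unfolding bump_def using m[of "c * (z - h) + 2" "c * z - 1"] ch e by simp
  show "bump S c h z \<le> 1" unfolding bump_def using b[of "c * z - 1"] b[of "c * (z - h) + 2"] by linarith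
  show "bump S c h z = 0" if "c * z \<le> 1"
    unfolding bump_def using z0[of "c * z - 1"] z0[of "c * (z - h) + 2"] that ch e by simp
  show "bump S c h z = 0" if "c * (h - z) \<le> 1"
    unfolding bump_def using z1[of "c * z - 1"] z1[of "c * (z - h) + 2"] that ch e by simp
  show "bump S c h z = 1" if "c * z \<ge> 2" "c * (h - z) \<ge> 2"
  proof -
    have "1 \<le> c * z - 1" "c * (z - h) + 2 \<le> 0" using that by (simp_all add: right_diff_distrib)
    then show ?thesis by (simp only: bump_def z0 z1)
  qed
qed

lemma bump_tendsto:
  assumes S: "is_step S" and h: "0 < h" and c: "filterlim c at_top sequentially" "\<And>m. c m * h \<ge> 3"
  shows "(\<lambda>m. bump S (c m) h z) \<longlonglongrightarrow> (if 0 < z \<and> z < h then 1 else 0)"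
proof (rule tendsto_eventually)
  have cpos: "0 < c m" for m using c(2)[of m] h by (metis less_eq_real_def linorder_not_less mult_nonpos_nonneg not_numeral_le_zero order.trans)
  \<comment> \<open>outside the interval the bump vanishes for every c, inside it is eventually 1\<close>
  show "\<forall>\<^sub>F m in sequentially. bump S (c m) h z = (if 0 < z \<and> z < h then 1 else 0)"
  proof (cases "0 < z \<and> z < h")
    case True
    have "\<forall>\<^sub>F m in sequentially. max (2 / z) (2 / (h - z)) \<le> c m"
      using c(1) unfolding filterlim_at_top by blast
    then show ?thesis
    proof eventually_elim
      case (elim m)
      then have "c m * z \<ge> 2" "c m * (h - z) \<ge> 2" using True by (auto simp: divide_le_eq)
      then show ?case using bump_props(5)[OF S c(2)] True by simp
    qed
  next
    case False
    have "bump S (c m) h z = 0" for m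
    proof (cases "z \<le> 0")
      case True
      then have "c m * z \<le> 0" using cpos[of m] by (simp add: mult_le_0_iff)
      then show ?thesis using bump_props(3)[OF S c(2)] by simp
    next
      case z: False
      then have "c m * (h - z) \<le> 0" using cpos[of m] False by (simp add: mult_le_0_iff)
      then show ?thesis using bump_props(4)[OF S c(2)] by simp
    qed
    then show ?thesis using False by simp
  qed
qed

text \<open>
  The antiderivative of \<open>bump step1 c h\<close> that vanishes on the left.
\<close>

definition ibump :: "real \<Rightarrow> real \<Rightarrow> real \<Rightarrow> real" where
  "ibump c h z = (istep1 (c * z - 1) - istep1 (c * (z - h) + 2)) / c"

lemma ibump_deriv:
  assumes "c \<noteq> 0"
  shows "(ibump c h has_real_derivative bump step1 c h z) (at z)"
proof -
  have a: "c * z + (- 1) = c * z - 1" "c * z + (2 - c * h) = c * (z - h) + 2" for z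
    by (simp_all add: right_diff_distrib)
  have "((\<lambda>z. (istep1 (c * z + (- 1)) - istep1 (c * z + (2 - c * h))) / c) has_real_derivative
    (c * step1 (c * z + (- 1)) - c * step1 (c * z + (2 - c * h))) / c) (at z)"
    by (intro DERIV_cdivide DERIV_diff affine_deriv istep1_deriv)
  moreover have "(c * x - c * y) / c = x - y" for x y using assms by (simp add: diff_divide_distrib)
  ultimately show ?thesis unfolding a ibump_def[abs_def] bump_def by simp
qed

definition dbump :: "real \<Rightarrow> real \<Rightarrow> real \<Rightarrow> real" where
  "dbump c h z = c * step2' (c * z - 1) - c * step2' (c * (z - h) + 2)"

lemma bump_deriv: "(bump step2 c h has_real_derivative dbump c h z) (at z)"
proof -
  have "((\<lambda>z. step2 (c * z + (- 1)) - step2 (c * z + (2 - c * h))) has_real_derivative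
    c * step2' (c * z + (- 1)) - c * step2' (c * z + (2 - c * h))) (at z)"
    by (intro DERIV_diff affine_deriv step2_deriv)
  moreover have "c * z + (2 - c * h) = c * (z - h) + 2" for z by (simp add: right_diff_distrib)
  ultimately show ?thesis unfolding bump_def[abs_def] dbump_def by simp
qed

lemma continuous_steps: "continuous_on UNIV (\<lambda>z. step1 (g z))" "continuous_on UNIV (\<lambda>z. step2' (g z))"
  if "continuous_on UNIV g" for g :: "'a::topological_space \<Rightarrow> real"
  using that unfolding step1_def step2'_def by (auto intro!: continuous_intros)

lemma ibump_props:
  assumes c: "0 < c" and ch: "c * h \<ge> 3"
  shows "mono (ibump c h)" "c * z \<le> 1 \<Longrightarrow> ibump c h z = 0" "c * (h - z) \<le> 1 \<Longrightarrow> ibump c h z = h - 3 / c"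
    "0 \<le> ibump c h z" "ibump c h z \<le> h"
proof -
  show m: "mono (ibump c h)"
  proof (rule monoI)
    fix x y :: real assume "x \<le> y"
    then show "ibump c h x \<le> ibump c h y"
      by (rule DERIV_nonneg_imp_nondecreasing)
        (use ibump_deriv[of c h] bump_props(1)[OF is_step1 ch] c in blast)
  qed
  have i0: "istep1 a = 0" if "a \<le> 0" for a using that by (simp add: istep1_def half_sq_def)
  have i1: "istep1 a = a - 1/2" if "1 \<le> a" for a
    using that by (simp add: istep1_def half_sq_def max_def power2_eq_square field_simps)
  have e: "c * (z - h) = c * z - c * h" "c * (h - z) = c * h - c * z" for z by (simp_all add: algebra_simps)
  show z0: "ibump c h z = 0" if "c * z \<le> 1" for z
    unfolding ibump_def using i0[of "c * z - 1"] i0[of "c * (z - h) + 2"] that ch e[of z] by simp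
  show z1: "ibump c h z = h - 3 / c" if "c * (h - z) \<le> 1" for z
    unfolding ibump_def using i1[of "c * z - 1"] i1[of "c * (z - h) + 2"] that ch e[of z] c
    by (simp add: field_simps)
  have "c * min z 0 \<le> 0" using c by (simp add: mult_le_0_iff)
  then have "ibump c h (min z 0) = 0" by (intro z0) simp
  then show "0 \<le> ibump c h z" using monoD[OF m, of "min z 0" z] by simp
  have "ibump c h z \<le> ibump c h (max z h)" by (rule monoD[OF m]) simp
  also have "\<dots> = h - 3 / c"
  proof (rule z1)
    have "c * (h - max z h) \<le> 0" using c by (simp add: mult_le_0_iff)
    then show "c * (h - max z h) \<le> 1" by simp
  qed
  also have "\<dots> \<le> h" using c by simp
  finally show "ibump c h z \<le> h" .
qed

section \<open>Discrete variation of BV functions\<close>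

lemma total_variation_ge:
  assumes f: "f \<in> BV" and v: "v \<in> test_fields"
  shows "(\<integral>x. f x * divergence v x \<partial>lam) \<le> BV_seminorm f"
proof -
  have "ereal (\<integral>x. f x * divergence v x \<partial>lam) \<le> total_variation f"
    unfolding total_variation_def by (rule SUP_upper[OF v])
  moreover have "total_variation f < \<infinity>" using f by (simp add: BV_def)
  ultimately show ?thesis unfolding BV_seminorm_def by (cases "total_variation f") auto
qed

text \<open>
  A compactly supported function bounded by 1, multiplied with a coordinate vector, is a test field
  whose divergence is the corresponding partial derivative.
\<close>

lemma scalar_test:
  fixes \<phi> P Q :: "point \<Rightarrow> real"
  assumes f: "f \<in> BV"
    and d: "\<And>z. (\<phi> has_derivative (\<lambda>d. P z * fst d + Q z * snd d)) (at z)"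
    and c: "continuous_on UNIV P" "continuous_on UNIV Q"
    and K: "compact K" "K \<subseteq> {0<..<1} \<times> {0<..<1}" "\<And>z. z \<notin> K \<Longrightarrow> \<phi> z = 0"
    and b: "\<And>z. \<bar>\<phi> z\<bar> \<le> 1"
  shows "(\<integral>z. f z * P z \<partial>lam) \<le> BV_seminorm f" "(\<integral>z. f z * Q z \<partial>lam) \<le> BV_seminorm f"
proof -
  have *: "(\<integral>z. f z * (P z * fst e + Q z * snd e) \<partial>lam) \<le> BV_seminorm f"
    if e: "e \<in> (Basis :: point set)" for e :: point
  proof -
    define v where "v z = \<phi> z *\<^sub>R e" for z
    define b1 where "b1 = Blinfun (\<lambda>d::point. fst d *\<^sub>R e)"
    define b2 where "b2 = Blinfun (\<lambda>d::point. snd d *\<^sub>R e)"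
    define v' where "v' z = P z *\<^sub>R b1 + Q z *\<^sub>R b2" for z
    have "bounded_linear (\<lambda>d::point. fst d *\<^sub>R e)" "bounded_linear (\<lambda>d::point. snd d *\<^sub>R e)"
      by (intro bounded_linear_scaleR_left[THEN bounded_linear_compose] bounded_linear_fst bounded_linear_snd)+
    then have ba: "blinfun_apply b1 d = fst d *\<^sub>R e" "blinfun_apply b2 d = snd d *\<^sub>R e" for d
      unfolding b1_def b2_def by (simp_all add: bounded_linear_Blinfun_apply)
    have va: "blinfun_apply (v' z) = (\<lambda>d. (P z * fst d + Q z * snd d) *\<^sub>R e)" for z
      by (rule ext) (simp add: v'_def blinfun.add_left blinfun.scaleR_left ba scaleR_add_left)
    have vd: "(v has_derivative blinfun_apply (v' z)) (at z)" for z
      unfolding va v_def[abs_def] by (intro has_derivative_scaleR_left d)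
    have vc: "continuous_on UNIV v'" unfolding v'_def[abs_def] by (intro continuous_intros c)
    have vt: "v \<in> test_fields"
      unfolding test_fields_def
    proof (intro CollectI conjI exI[of _ v'] exI[of _ K] allI impI)
      show "norm (v z) \<le> 1" for z using b[of z] e by (simp add: v_def)
    qed (use vd vc K in \<open>auto simp: v_def\<close>)
    have "divergence v z = P z * fst e + Q z * snd e" for z
    proof -
      have "frechet_derivative v (at z) = blinfun_apply (v' z)"
        by (rule frechet_derivative_at[OF vd, symmetric])
      then have "divergence v z = (\<Sum>b\<in>Basis. ((P z * fst b + Q z * snd b) *\<^sub>R e) \<bullet> b)"
        by (simp add: divergence_def va)
      also have "\<dots> = (\<Sum>b\<in>Basis. if b = e then P z * fst b + Q z * snd b else 0)"
        by (intro sum.cong refl) (use e in \<open>auto simp: inner_Basis\<close>)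
      also have "\<dots> = P z * fst e + Q z * snd e" using e by simp
      finally show ?thesis .
    qed
    then show ?thesis using total_variation_ge[OF f vt] by simp
  qed
  have "(1, 0) \<in> (Basis :: point set)" "(0, 1) \<in> (Basis :: point set)" by (auto simp: Basis_prod_def)
  from *[OF this(1)] *[OF this(2)]
  show "(\<integral>z. f z * P z \<partial>lam) \<le> BV_seminorm f" "(\<integral>z. f z * Q z \<partial>lam) \<le> BV_seminorm f" by simp_all
qed


text \<open>
  The bumps converge to indicators of open intervals, whereas cells are half open; the difference
  lies on the grid lines.
\<close>

lemma AE_lam_off_lines:
  "AE z in lam. \<forall>l::nat. fst z \<noteq> real l * h \<and> snd z \<noteq> real l * h"
proof -
  have "AE z in lborel. z \<bullet> b \<noteq> c" if "b \<in> Basis" for b :: point and c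
  proof (rule AE_I)
    show "{z \<in> space lborel. \<not> z \<bullet> b \<noteq> c} \<subseteq> {z. z \<bullet> b = c}" by auto
    have "closed {z. z \<bullet> b = c}" by (rule closed_hyperplane[of b c, simplified inner_commute])
    then show "{z. z \<bullet> b = c} \<in> sets lborel" by simp
    have "negligible {z. z \<bullet> b = c}" by (rule negligible_standard_hyperplane[OF that])
    then have "emeasure lebesgue {z. z \<bullet> b = c} = 0"
      by (simp add: negligible_iff_null_sets null_sets_def)
    then show "emeasure lborel {z. z \<bullet> b = c} = 0"
      using \<open>closed {z. z \<bullet> b = c}\<close> by (simp add: emeasure_completion)
  qed
  from this[of "(1, 0)"] this[of "(0, 1)"]
  have "AE z::point in lborel. fst z \<noteq> c" "AE z::point in lborel. snd z \<noteq> c" for c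
    by (auto simp: Basis_prod_def inner_prod_def)
  then have "AE z::point in lborel. \<forall>l::nat. fst z \<noteq> real l * h \<and> snd z \<noteq> real l * h"
    by (subst AE_all_countable) auto
  then show ?thesis
    unfolding lam_def by (subst AE_restrict_space_iff) (auto simp: unit_square_def borel_prod[symmetric])
qed

lemma sum_at_most_one:
  fixes g :: "'a \<Rightarrow> real"
  assumes "finite A" "\<And>j. j \<in> A \<Longrightarrow> 0 \<le> g j \<and> g j \<le> 1"
    and u: "\<And>i j. i \<in> A \<Longrightarrow> j \<in> A \<Longrightarrow> g i \<noteq> 0 \<Longrightarrow> g j \<noteq> 0 \<Longrightarrow> i = j"
  shows "0 \<le> sum g A" "sum g A \<le> 1"
proof -
  show "0 \<le> sum g A" using assms by (intro sum_nonneg) auto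
  show "sum g A \<le> 1"
  proof (cases "\<exists>j\<in>A. g j \<noteq> 0")
    case True
    then obtain j where j: "j \<in> A" "g j \<noteq> 0" by blast
    have "sum g A = g j + sum g (A - {j})" by (rule sum.remove[OF assms(1) j(1)])
    also have "sum g (A - {j}) = 0" using u j by (intro sum.neutral) blast
    finally show ?thesis using assms(2)[OF j(1)] by simp
  next
    case False then show ?thesis by simp
  qed
qed

text \<open>
  Differences along the rows and along the columns are treated at once: \<open>p\<close> is the coordinate in
  which differences are taken and \<open>q\<close> is the other one.
\<close>

locale grid_test =
  fixes n :: nat and h :: real and p q :: "point \<Rightarrow> real"
  assumes n: "1 \<le> n" and h: "h = 1 / real n"
    and pq: "(p = fst \<and> q = snd) \<or> (p = snd \<and> q = fst)"
begin

lemma h_pos: "0 < h" using n by (simp add: h)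

lemma hn: "real n * h = 1" using n by (simp add: h)

definition box :: "nat \<Rightarrow> nat \<Rightarrow> point set" where
  "box i j = {z. real i * h \<le> p z \<and> p z < (real i + 1) * h \<and> real j * h \<le> q z \<and> q z < (real j + 1) * h}"

text \<open>
  A smooth hat of height at most 1 over two neighbouring intervals, with negative sign: its derivative
  \<open>hat'\<close> approximates \<open>n\<close> times the indicator of the right interval minus that of the left one.
\<close>

definition hat :: "real \<Rightarrow> nat \<Rightarrow> real \<Rightarrow> real" where
  "hat c i x = real n * (ibump c h (x - (real i + 1) * h) - ibump c h (x - real i * h))"

definition hat' :: "real \<Rightarrow> nat \<Rightarrow> real \<Rightarrow> real" where
  "hat' c i x = real n * (bump step1 c h (x - (real i + 1) * h) - bump step1 c h (x - real i * h))"

definition strip :: "real \<Rightarrow> nat \<Rightarrow> real \<Rightarrow> real" where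
  "strip c j y = bump step2 c h (y - real j * h)"

definition strip' :: "real \<Rightarrow> nat \<Rightarrow> real \<Rightarrow> real" where
  "strip' c j y = dbump c h (y - real j * h)"

lemma shift_deriv:
  assumes "\<And>z. (F has_real_derivative F' z) (at z)"
  shows "((\<lambda>z. F (z - d)) has_real_derivative F' (z - d)) (at z)"
  using affine_deriv[of F F' 1 "- d" z, OF assms] by simp

lemma hat_deriv: "c \<noteq> 0 \<Longrightarrow> (hat c i has_real_derivative hat' c i x) (at x)"
  unfolding hat_def[abs_def] hat'_def
  by (intro DERIV_cmult DERIV_diff shift_deriv ibump_deriv)

lemma strip_deriv: "(strip c j has_real_derivative strip' c j x) (at x)"
  unfolding strip_def[abs_def] strip'_def by (intro shift_deriv bump_deriv)

lemma hat_nonzero: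
  assumes c: "0 < c" "c * h \<ge> 3" and x: "hat c i x \<noteq> 0"
  shows "real i * h + 1 / c \<le> x" "x \<le> (real i + 2) * h - 1 / c"
proof -
  note z0 = ibump_props(2)[OF c] and z1 = ibump_props(3)[OF c]
  show "real i * h + 1 / c \<le> x"
  proof (rule ccontr)
    assume "\<not> ?thesis"
    then have a: "x - real i * h < 1 / c" by simp
    then have "c * (x - real i * h) \<le> 1" using c(1) by (simp add: pos_less_divide_eq mult.commute)
    moreover have "c * (x - (real i + 1) * h) \<le> c * (x - real i * h)"
      using c(1) h_pos by (intro mult_left_mono) (auto simp: algebra_simps)
    ultimately show False using x z0 by (simp add: hat_def)
  qed
  show "x \<le> (real i + 2) * h - 1 / c"
  proof (rule ccontr)
    assume "\<not> ?thesis"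
    then have a: "h - (x - (real i + 1) * h) < 1 / c" by (simp add: algebra_simps)
    then have "c * (h - (x - (real i + 1) * h)) \<le> 1" using c(1) by (simp add: pos_less_divide_eq mult.commute)
    moreover have "c * (h - (x - real i * h)) \<le> c * (h - (x - (real i + 1) * h))"
      using c(1) h_pos by (intro mult_left_mono) (auto simp: algebra_simps)
    ultimately show False using x z1 by (simp add: hat_def)
  qed
qed

lemma strip_nonzero:
  assumes c: "0 < c" "c * h \<ge> 3" and y: "strip c j y \<noteq> 0"
  shows "real j * h + 1 / c \<le> y" "y \<le> (real j + 1) * h - 1 / c"
proof -
  note b = bump_props[OF is_step2 c(2)]
  show "real j * h + 1 / c \<le> y"
  proof (rule ccontr)
    assume "\<not> ?thesis"
    then have "y - real j * h < 1 / c" by simp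
    then have "c * (y - real j * h) \<le> 1" using c(1) by (simp add: pos_less_divide_eq mult.commute)
    then show False using y b(3) by (simp add: strip_def)
  qed
  show "y \<le> (real j + 1) * h - 1 / c"
  proof (rule ccontr)
    assume "\<not> ?thesis"
    then have "h - (y - real j * h) < 1 / c" by (simp add: algebra_simps)
    then have "c * (h - (y - real j * h)) \<le> 1" using c(1) by (simp add: pos_less_divide_eq mult.commute)
    then show False using y b(4) by (simp add: strip_def)
  qed
qed

text \<open>The hats overlap, but their sum telescopes.\<close>

lemma hat_sum:
  assumes c: "0 < c" "c * h \<ge> 3"
  shows "(\<Sum>i<n - 1. \<bar>hat c i x\<bar>) \<le> 1"
proof -
  have "\<bar>hat c i x\<bar> = real n * (ibump c h (x - real i * h) - ibump c h (x - real (Suc i) * h))" for i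
  proof -
    have "ibump c h (x - real (Suc i) * h) \<le> ibump c h (x - real i * h)"
      using h_pos by (intro monoD[OF ibump_props(1)[OF c]]) (simp add: algebra_simps)
    moreover have "real (Suc i) = real i + 1" by simp
    ultimately show ?thesis unfolding hat_def
      by (metis abs_minus_commute abs_mult abs_of_nat abs_of_nonneg diff_ge_0_iff_ge)
  qed
  then have "(\<Sum>i<n - 1. \<bar>hat c i x\<bar>)
    = real n * (\<Sum>i<n - 1. ibump c h (x - real i * h) - ibump c h (x - real (Suc i) * h))"
    by (simp add: sum_distrib_left)
  also have "(\<Sum>i<n - 1. ibump c h (x - real i * h) - ibump c h (x - real (Suc i) * h))
    = ibump c h (x - real 0 * h) - ibump c h (x - real (n - 1) * h)"
    by (rule sum_lessThan_telescope')
  also have "\<dots> \<le> h" using ibump_props(4,5)[OF c] by (smt (verit))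
  finally show ?thesis using hn by (simp add: mult_left_mono)
qed

lemma strip_sum:
  assumes c: "0 < c" "c * h \<ge> 3"
  shows "(\<Sum>j<n. strip c j y) \<le> 1"
proof (rule sum_at_most_one(2))
  show "0 \<le> strip c j y \<and> strip c j y \<le> 1" for j
    using bump_props(1,2)[OF is_step2 c(2)] by (simp add: strip_def)
  fix i j assume "strip c i y \<noteq> 0" "strip c j y \<noteq> 0"
  then have "real i * h < (real j + 1) * h" "real j * h < (real i + 1) * h"
    using strip_nonzero[OF c, of i y] strip_nonzero[OF c, of j y] c(1)
    by (smt (verit) divide_pos_pos)+
  then have "real i < real j + 1" "real j < real i + 1" using h_pos by (simp_all add: mult_less_cancel_right)
  then show "i = j" by linarith
qed simp

text \<open>
  For signs \<open>\<epsilon>\<close> the derivative of this function in the direction \<open>p\<close> approximates the signed sum of the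
  differences between neighbouring cells.
\<close>

definition probe :: "(nat \<Rightarrow> nat \<Rightarrow> real) \<Rightarrow> real \<Rightarrow> point \<Rightarrow> real" where
  "probe \<epsilon> c z = (\<Sum>i<n - 1. \<Sum>j<n. \<epsilon> i j * (hat c i (p z) * strip c j (q z)))"

definition probe_p :: "(nat \<Rightarrow> nat \<Rightarrow> real) \<Rightarrow> real \<Rightarrow> point \<Rightarrow> real" where
  "probe_p \<epsilon> c z = (\<Sum>i<n - 1. \<Sum>j<n. \<epsilon> i j * (hat' c i (p z) * strip c j (q z)))"

definition probe_q :: "(nat \<Rightarrow> nat \<Rightarrow> real) \<Rightarrow> real \<Rightarrow> point \<Rightarrow> real" where
  "probe_q \<epsilon> c z = (\<Sum>i<n - 1. \<Sum>j<n. \<epsilon> i j * (hat c i (p z) * strip' c j (q z)))"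

lemma pq_derivative: "(p has_derivative p) (at z)" "(q has_derivative q) (at z)"
  using pq by (auto intro!: bounded_linear_imp_has_derivative bounded_linear_fst bounded_linear_snd)

lemma probe_derivative:
  assumes c: "c \<noteq> 0"
  shows "(probe \<epsilon> c has_derivative (\<lambda>d. probe_p \<epsilon> c z * p d + probe_q \<epsilon> c z * q d)) (at z)"
proof -
  have H: "((\<lambda>z. hat c i (p z)) has_derivative (\<lambda>d. hat' c i (p z) * p d)) (at z)" for i
    using has_derivative_compose[OF pq_derivative(1) hat_deriv[OF c, unfolded has_field_derivative_def]]
    by simp
  have S: "((\<lambda>z. strip c j (q z)) has_derivative (\<lambda>d. strip' c j (q z) * q d)) (at z)" for j
    using has_derivative_compose[OF pq_derivative(2) strip_deriv[unfolded has_field_derivative_def]]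
    by simp
  have "(probe \<epsilon> c has_derivative (\<lambda>d. \<Sum>i<n - 1. \<Sum>j<n. \<epsilon> i j * (hat c i (p z) * (strip' c j (q z) * q d)
      + (hat' c i (p z) * p d) * strip c j (q z)))) (at z)"
    unfolding probe_def[abs_def]
    by (intro has_derivative_sum has_derivative_mult_right has_derivative_mult H S)
  moreover have "(\<Sum>i<n - 1. \<Sum>j<n. \<epsilon> i j * (hat c i (p z) * (strip' c j (q z) * q d)
      + (hat' c i (p z) * p d) * strip c j (q z))) = probe_p \<epsilon> c z * p d + probe_q \<epsilon> c z * q d" for d
  proof -
    have "(\<Sum>i<n - 1. \<Sum>j<n. \<epsilon> i j * (hat c i (p z) * (strip' c j (q z) * q d)
        + (hat' c i (p z) * p d) * strip c j (q z)))
      = (\<Sum>i<n - 1. \<Sum>j<n. \<epsilon> i j * (hat' c i (p z) * strip c j (q z)) * p d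
        + \<epsilon> i j * (hat c i (p z) * strip' c j (q z)) * q d)"
      by (intro sum.cong refl) (simp add: algebra_simps)
    then show ?thesis
      by (simp only: probe_p_def probe_q_def sum_distrib_right sum.distrib)
  qed
  ultimately show ?thesis by simp
qed

lemma probe_continuous:
  "continuous_on UNIV (probe_p \<epsilon> c)" "continuous_on UNIV (probe_q \<epsilon> c)" if c: "c \<noteq> 0"
proof -
  have pc: "continuous_on UNIV p" "continuous_on UNIV q"
    using pq by (auto intro!: continuous_intros)
  have hc: "continuous_on UNIV (hat c i)" for i
    using hat_deriv[OF c] by (intro continuous_at_imp_continuous_on ballI DERIV_isCont)
  have sc: "continuous_on UNIV (strip c j)" for j
    using strip_deriv by (intro continuous_at_imp_continuous_on ballI DERIV_isCont)
  have hc': "continuous_on UNIV (hat' c i)" for i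
    unfolding hat'_def[abs_def] bump_def by (intro continuous_intros continuous_steps)
  have sc': "continuous_on UNIV (strip' c j)" for j
    unfolding strip'_def[abs_def] dbump_def by (intro continuous_intros continuous_steps)
  note comp = continuous_on_compose2[OF _ _ subset_UNIV]
  show "continuous_on UNIV (probe_p \<epsilon> c)" "continuous_on UNIV (probe_q \<epsilon> c)"
    unfolding probe_p_def[abs_def] probe_q_def[abs_def]
    by (intro continuous_on_sum continuous_on_mult continuous_on_const comp[OF hc pc(1)] comp[OF sc pc(2)]
      comp[OF hc' pc(1)] comp[OF sc' pc(2)])+
qed

lemma probe_bound:
  assumes c: "0 < c" "c * h \<ge> 3" and e: "\<And>i j. \<bar>\<epsilon> i j\<bar> \<le> 1"
  shows "\<bar>probe \<epsilon> c z\<bar> \<le> 1"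
proof -
  have s0: "0 \<le> strip c j y" for j y using bump_props(1)[OF is_step2 c(2)] by (simp add: strip_def)
  have "\<bar>probe \<epsilon> c z\<bar> \<le> (\<Sum>i<n - 1. \<bar>\<Sum>j<n. \<epsilon> i j * (hat c i (p z) * strip c j (q z))\<bar>)"
    unfolding probe_def by (rule sum_abs)
  also have "\<dots> \<le> (\<Sum>i<n - 1. \<Sum>j<n. \<bar>\<epsilon> i j * (hat c i (p z) * strip c j (q z))\<bar>)"
    by (intro sum_mono sum_abs)
  also have "\<dots> \<le> (\<Sum>i<n - 1. \<Sum>j<n. \<bar>hat c i (p z)\<bar> * strip c j (q z))"
  proof (intro sum_mono)
    fix i j
    have "\<bar>\<epsilon> i j\<bar> * (\<bar>hat c i (p z)\<bar> * strip c j (q z)) \<le> 1 * (\<bar>hat c i (p z)\<bar> * strip c j (q z))"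
      using e s0 by (intro mult_right_mono) auto
    then show "\<bar>\<epsilon> i j * (hat c i (p z) * strip c j (q z))\<bar> \<le> \<bar>hat c i (p z)\<bar> * strip c j (q z)"
      using s0 by (simp add: abs_mult)
  qed
  also have "\<dots> = (\<Sum>i<n - 1. \<bar>hat c i (p z)\<bar>) * (\<Sum>j<n. strip c j (q z))"
    by (simp add: sum_product)
  also have "\<dots> \<le> 1 * 1"
    using hat_sum[OF c] strip_sum[OF c] s0 by (intro mult_mono sum_nonneg) auto
  finally show ?thesis by simp
qed

lemma probe_support:
  assumes c: "0 < c" "c * h \<ge> 3" and z: "probe \<epsilon> c z \<noteq> 0"
  shows "z \<in> cbox (1 / c, 1 / c) (1 - 1 / c, 1 - 1 / c)"
proof -
  obtain i j where ij: "i < n - 1" "j < n" "\<epsilon> i j * (hat c i (p z) * strip c j (q z)) \<noteq> 0"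
    using z unfolding probe_def by (metis (no_types, lifting) lessThan_iff sum.neutral)
  then have nz: "hat c i (p z) \<noteq> 0" "strip c j (q z) \<noteq> 0" by auto
  have 1: "real i * h + 1 / c \<le> p z" "p z \<le> (real i + 2) * h - 1 / c"
    using hat_nonzero[OF c nz(1)] by auto
  have 2: "real j * h + 1 / c \<le> q z" "q z \<le> (real j + 1) * h - 1 / c"
    using strip_nonzero[OF c nz(2)] by auto
  have "real i + 2 \<le> real n" "real j + 1 \<le> real n" using ij(1,2) by linarith+
  then have "(real i + 2) * h \<le> real n * h" "(real j + 1) * h \<le> real n * h"
    using h_pos by (intro mult_right_mono; simp)+
  moreover have "0 \<le> real i * h" "0 \<le> real j * h" using h_pos by auto
  ultimately have "1 / c \<le> p z" "p z \<le> 1 - 1 / c" "1 / c \<le> q z" "q z \<le> 1 - 1 / c"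
    using 1 2 hn by linarith+
  then show ?thesis using pq by (cases z) (auto simp: cbox_Pair_eq)
qed

lemma probe_test:
  assumes f: "f \<in> BV" and c: "0 < c" "c * h \<ge> 3" and e: "\<And>i j. \<bar>\<epsilon> i j\<bar> \<le> 1"
  shows "(\<integral>z. f z * probe_p \<epsilon> c z \<partial>lam) \<le> BV_seminorm f"
proof -
  let ?K = "cbox (1 / c, 1 / c) (1 - 1 / c, 1 - 1 / c) :: point set"
  have K: "compact ?K" by (rule compact_cbox)
  have "cbox (r, r) (1 - r, 1 - r) \<subseteq> {0<..<1} \<times> {0<..<1}" if "0 < r" for r :: real
    using that by (auto simp: cbox_Pair_eq)
  then have K': "?K \<subseteq> {0<..<1} \<times> {0<..<1}" using c(1) by simp
  have Kz: "probe \<epsilon> c z = 0" if "z \<notin> ?K" for z using probe_support[OF c] that by blast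
  have c0: "c \<noteq> 0" using c by simp
  note b = probe_bound[OF c e]
  from pq show ?thesis
  proof
    assume a: "p = fst \<and> q = snd"
    show ?thesis
      by (rule scalar_test(1)[OF f _ probe_continuous[OF c0] K K' Kz b])
         (use probe_derivative[OF c0] a in simp)
  next
    assume a: "p = snd \<and> q = fst"
    show ?thesis
      by (rule scalar_test(2)[OF f _ probe_continuous(2,1)[OF c0] K K' Kz b])
         (use probe_derivative[OF c0] a in \<open>simp add: add.commute\<close>)
  qed
qed

lemma box_sets: "box i j \<in> sets borel"
proof -
  have [measurable]: "p \<in> borel_measurable borel" "q \<in> borel_measurable borel"
    using pq by (auto simp: borel_prod[symmetric])
  show ?thesis unfolding box_def by measurable
qed

text \<open>
  The probes are admissible test functions for every large \<open>c\<close>; dominated convergence turns the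
  integrals of \<open>f\<close> against their derivatives into differences of integrals over neighbouring cells.
\<close>

lemma grid_variation:
  assumes f: "f \<in> BV" and e: "\<And>i j. \<bar>\<epsilon> i j\<bar> \<le> 1"
  defines "\<alpha> \<equiv> \<lambda>i j. \<integral>z. indicator (box i j) z * f z \<partial>lam"
  shows "real n * (\<Sum>i<n - 1. \<Sum>j<n. \<epsilon> i j * (\<alpha> (Suc i) j - \<alpha> i j)) \<le> BV_seminorm f"
proof -
  have fi: "integrable lam f" using f by (simp add: BV_def)
  have fm[measurable]: "f \<in> borel_measurable lam" using fi by auto
  have lamm: "g \<in> borel_measurable lam" if "g \<in> borel_measurable borel" for g :: "point \<Rightarrow> real"
    using that unfolding lam_def by (intro measurable_restrict_space1) simp
  have ind[measurable]: "(\<lambda>z. indicator (box i j) z :: real) \<in> borel_measurable lam" for i j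
    by (intro lamm borel_measurable_indicator box_sets)
  have bi: "integrable lam (\<lambda>z. indicator (box i j) z * f z)" for i j
    by (rule Bochner_Integration.integrable_bound[OF fi]) (measurable, auto simp: indicator_def)
  \<comment> \<open>the shift by 3 guarantees c h >= 3, the room needed by the rising and the falling part\<close>
  define c where "c m = real (m + 3) * real n" for m :: nat
  have c: "0 < c m" "c m * h \<ge> 3" for m using n hn by (auto simp: c_def mult.assoc)
  have clim: "filterlim c at_top sequentially"
  proof (rule filterlim_at_top_mono)
    show "filterlim real at_top sequentially" by (rule filterlim_real_sequentially)
    have "real m * 1 \<le> c m" for m unfolding c_def using n by (intro mult_mono) auto
    then show "\<forall>\<^sub>F m in sequentially. real m \<le> c m" by simp
  qed
  define I where "I x = (if 0 < x \<and> x < h then 1 else 0 :: real)" for x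
  define G where "G z = (\<Sum>i<n - 1. \<Sum>j<n. \<epsilon> i j * (real n * (I (p z - (real i + 1) * h) - I (p z - real i * h)) * I (q z - real j * h)))" for z
  define H where "H z = (\<Sum>i<n - 1. \<Sum>j<n. \<epsilon> i j * (real n * (indicator (box (Suc i) j) z - indicator (box i j) z)))" for z
  have lim: "(\<lambda>m. probe_p \<epsilon> (c m) z) \<longlonglongrightarrow> G z" for z
  proof -
    have 1: "(\<lambda>m. bump step1 (c m) h x) \<longlonglongrightarrow> I x" for x
      unfolding I_def by (rule bump_tendsto[OF is_step1 h_pos clim c(2)])
    have 2: "(\<lambda>m. bump step2 (c m) h x) \<longlonglongrightarrow> I x" for x
      unfolding I_def by (rule bump_tendsto[OF is_step2 h_pos clim c(2)])
    show ?thesis unfolding probe_p_def G_def hat'_def strip_def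
      by (intro tendsto_sum tendsto_mult tendsto_diff tendsto_const 1 2)
  qed
  have bound: "\<bar>probe_p \<epsilon> (c m) z\<bar> \<le> real (n - 1) * (real n * real n)" for m z
  proof -
    have "\<bar>probe_p \<epsilon> (c m) z\<bar> \<le> (\<Sum>i<n - 1. \<bar>\<Sum>j<n. \<epsilon> i j * (hat' (c m) i (p z) * strip (c m) j (q z))\<bar>)"
      unfolding probe_p_def by (rule sum_abs)
    also have "\<dots> \<le> (\<Sum>i<n - 1. \<Sum>j<n. \<bar>\<epsilon> i j * (hat' (c m) i (p z) * strip (c m) j (q z))\<bar>)"
      by (intro sum_mono sum_abs)
    also have "\<dots> \<le> (\<Sum>i<n - 1. \<Sum>j<n. real n)"
    proof (intro sum_mono)
      fix i j
      have "\<bar>hat' (c m) i (p z)\<bar> \<le> real n * 1"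
        unfolding hat'_def abs_mult abs_of_nat
        using bump_props(1,2)[OF is_step1 c(2), of m "p z - (real i + 1) * h"]
          bump_props(1,2)[OF is_step1 c(2), of m "p z - real i * h"]
        by (intro mult_left_mono) (simp_all add: abs_le_iff)
      moreover have "\<bar>strip (c m) j (q z)\<bar> \<le> 1"
        unfolding strip_def using bump_props(1,2)[OF is_step2 c(2), of m "q z - real j * h"] by simp
      ultimately have "\<bar>hat' (c m) i (p z)\<bar> * \<bar>strip (c m) j (q z)\<bar> \<le> real n * 1"
        by (intro mult_mono) auto
      then have "\<bar>\<epsilon> i j\<bar> * (\<bar>hat' (c m) i (p z)\<bar> * \<bar>strip (c m) j (q z)\<bar>) \<le> 1 * real n"
        using e by (intro mult_mono) auto
      then show "\<bar>\<epsilon> i j * (hat' (c m) i (p z) * strip (c m) j (q z))\<bar> \<le> real n"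
        by (simp add: abs_mult)
    qed
    also have "\<dots> = real (n - 1) * (real n * real n)" by simp
    finally show ?thesis .
  qed
  have fpm[measurable]: "probe_p \<epsilon> (c m) \<in> borel_measurable lam" for m
    using c(1)[of m] by (intro lamm borel_measurable_continuous_onI probe_continuous) simp
  have Gm: "G \<in> borel_measurable lam"
    by (rule borel_measurable_LIMSEQ_real[OF lim fpm])
  have conv: "(\<lambda>m. \<integral>z. f z * probe_p \<epsilon> (c m) z \<partial>lam) \<longlonglongrightarrow> (\<integral>z. f z * G z \<partial>lam)"
  proof (rule integral_dominated_convergence[where w="\<lambda>z. \<bar>f z\<bar> * (real (n - 1) * (real n * real n))"])
    show "AE z in lam. (\<lambda>m. f z * probe_p \<epsilon> (c m) z) \<longlonglongrightarrow> f z * G z"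
      by (intro AE_I2 tendsto_mult tendsto_const lim)
    show "AE z in lam. norm (f z * probe_p \<epsilon> (c m) z) \<le> \<bar>f z\<bar> * (real (n - 1) * (real n * real n))" for m
      by (intro AE_I2) (simp only: real_norm_def abs_mult, intro mult_left_mono bound abs_ge_zero)
  qed (use Gm fi in auto)
  have le: "(\<integral>z. f z * G z \<partial>lam) \<le> BV_seminorm f"
    by (rule LIMSEQ_le_const2[OF conv]) (intro exI[of _ 0] allI impI probe_test[OF f c e])
  have "(\<integral>z. f z * G z \<partial>lam) = (\<integral>z. f z * H z \<partial>lam)"
  proof (rule integral_cong_AE)
    show "AE z in lam. f z * G z = f z * H z"
      using AE_lam_off_lines[of h]
    proof eventually_elim
      case (elim z)
      then have off: "p z \<noteq> real l * h" "q z \<noteq> real l * h" for l :: nat using pq by auto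
      have "I (p z - real i * h) * I (q z - real j * h) = indicator (box i j) z" for i j
        using off(1)[of i] off(2)[of j] by (auto simp: I_def box_def indicator_def algebra_simps)
      from this[of "Suc _"] this have "G z = H z"
        by (simp add: G_def H_def left_diff_distrib right_diff_distrib mult.assoc add.commute)
      then show ?case by simp
    qed
  qed (use Gm in \<open>auto simp: H_def[abs_def]\<close>)
  also have "\<dots> = (\<integral>z. (\<Sum>i<n - 1. \<Sum>j<n. \<epsilon> i j * (real n * (indicator (box (Suc i) j) z * f z - indicator (box i j) z * f z))) \<partial>lam)"
    by (intro Bochner_Integration.integral_cong refl) (simp add: H_def sum_distrib_left algebra_simps)
  also have "\<dots> = (\<Sum>i<n - 1. \<Sum>j<n. \<epsilon> i j * (real n * (\<alpha> (Suc i) j - \<alpha> i j)))"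
    unfolding \<alpha>_def using bi by (simp add: Bochner_Integration.integral_sum Bochner_Integration.integral_diff)
  also have "\<dots> = real n * (\<Sum>i<n - 1. \<Sum>j<n. \<epsilon> i j * (\<alpha> (Suc i) j - \<alpha> i j))"
    by (simp add: sum_distrib_left algebra_simps)
  finally show ?thesis using le by simp
qed

lemma grid_variation_abs:
  assumes f: "f \<in> BV"
  defines "\<alpha> \<equiv> \<lambda>i j. \<integral>z. indicator (box i j) z * f z \<partial>lam"
  shows "real n * (\<Sum>i<n - 1. \<Sum>j<n. \<bar>\<alpha> (Suc i) j - \<alpha> i j\<bar>) \<le> BV_seminorm f"
proof -
  have "real n * (\<Sum>i<n - 1. \<Sum>j<n. sgn (\<alpha> (Suc i) j - \<alpha> i j) * (\<alpha> (Suc i) j - \<alpha> i j)) \<le> BV_seminorm f"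
    unfolding \<alpha>_def by (rule grid_variation[OF f]) (simp add: abs_sgn_eq)
  then show ?thesis by (simp add: mult.commute[of "sgn _"] abs_sgn[symmetric])
qed

end

text \<open>
  One factor for each of the two directions.
\<close>

lemma BV_dyadic_TV:
  assumes f: "f \<in> BV"
  shows "dyadic_TV J f \<le> 2 * BV_seminorm f"
proof -
  define n :: nat where "n = 2 ^ J"
  define h :: real where "h = 1 / real n"
  interpret X: grid_test n h fst snd by unfold_locales (auto simp: n_def h_def)
  interpret Y: grid_test n h snd fst by unfold_locales (auto simp: n_def h_def)
  define \<alpha> where "\<alpha> i j = (\<integral>z. indicator (cell J i j) z * f z \<partial>lam)" for i j
  have bX: "X.box i j = cell J i j" and bY: "Y.box i j = cell J j i" for i j
    unfolding X.box_def Y.box_def cell_def by (auto simp: h_def n_def field_simps)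
  have nn: "real n * real n = 4 ^ J" by (simp add: n_def power_mult_distrib[symmetric])
  have a: "avg J f i j = real n * real n * \<alpha> i j" for i j
    unfolding nn by (simp add: avg_def \<alpha>_def)
  have 1: "real n * (\<Sum>i<n - 1. \<Sum>j<n. \<bar>\<alpha> (Suc i) j - \<alpha> i j\<bar>) \<le> BV_seminorm f"
    using X.grid_variation_abs[OF f] by (simp add: bX \<alpha>_def)
  have 2: "real n * (\<Sum>j<n - 1. \<Sum>i<n. \<bar>\<alpha> i (Suc j) - \<alpha> i j\<bar>) \<le> BV_seminorm f"
    using Y.grid_variation_abs[OF f] by (simp add: bY \<alpha>_def)
  have "grid_TV n (avg J f) = real n * real n * ((\<Sum>j<n. \<Sum>i<n - 1. \<bar>\<alpha> (Suc i) j - \<alpha> i j\<bar>)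
      + (\<Sum>i<n. \<Sum>j<n - 1. \<bar>\<alpha> i (Suc j) - \<alpha> i j\<bar>))"
    by (simp add: grid_TV_def a right_diff_distrib[symmetric] abs_mult sum_distrib_left distrib_left)
  also have "(\<Sum>j<n. \<Sum>i<n - 1. \<bar>\<alpha> (Suc i) j - \<alpha> i j\<bar>) = (\<Sum>i<n - 1. \<Sum>j<n. \<bar>\<alpha> (Suc i) j - \<alpha> i j\<bar>)"
    by (rule sum.swap)
  also have "(\<Sum>i<n. \<Sum>j<n - 1. \<bar>\<alpha> i (Suc j) - \<alpha> i j\<bar>) = (\<Sum>j<n - 1. \<Sum>i<n. \<bar>\<alpha> i (Suc j) - \<alpha> i j\<bar>)"
    by (rule sum.swap)
  finally have "grid_TV n (avg J f) = real n * (real n * (\<Sum>i<n - 1. \<Sum>j<n. \<bar>\<alpha> (Suc i) j - \<alpha> i j\<bar>)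
      + real n * (\<Sum>j<n - 1. \<Sum>i<n. \<bar>\<alpha> i (Suc j) - \<alpha> i j\<bar>))"
    by (simp add: algebra_simps)
  also have "\<dots> \<le> real n * (2 * BV_seminorm f)" using 1 2 by (intro mult_left_mono) auto
  finally have "grid_TV n (avg J f) / real n \<le> 2 * BV_seminorm f"
    by (simp add: n_def divide_le_eq mult.commute)
  then show ?thesis by (simp add: dyadic_TV_def n_def)
qed

section \<open>Haar coefficients and dyadic averages\<close>

definition haar_sign :: "orientation \<Rightarrow> nat \<Rightarrow> nat \<Rightarrow> real" where
  "haar_sign e a b = (case e of Horizontal \<Rightarrow> (-1) ^ a | Vertical \<Rightarrow> (-1) ^ b | Diagonal \<Rightarrow> (-1) ^ (a + b))"

definition dyadic_ind :: "nat \<Rightarrow> nat \<Rightarrow> real \<Rightarrow> real" where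
  "dyadic_ind J i x = indicator {real i / 2 ^ J ..< (real i + 1) / 2 ^ J} x"

lemma indicator_cell: "indicator (cell J i j) z = dyadic_ind J i (fst z) * dyadic_ind J j (snd z)"
  by (cases z) (auto simp: cell_def dyadic_ind_def indicator_def)

lemma dyadic_ind_shift: "dyadic_ind J i x = indicator {0..<1} (2 ^ J * x - real i)"
  by (auto simp: dyadic_ind_def indicator_def field_simps)

lemma father_split: "haar_father (2 ^ J * x - real k) = dyadic_ind (Suc J) (2 * k) x + dyadic_ind (Suc J) (2 * k + 1) x"
  and mother_split: "haar_mother (2 ^ J * x - real k) = dyadic_ind (Suc J) (2 * k) x - dyadic_ind (Suc J) (2 * k + 1) x"
  unfolding dyadic_ind_shift haar_father_def haar_mother_def
  by (auto simp: indicator_def algebra_simps)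

lemma dyadic_ind_split: "dyadic_ind J k x = dyadic_ind (Suc J) (2 * k) x + dyadic_ind (Suc J) (2 * k + 1) x"
  using father_split[of J x k] by (simp add: dyadic_ind_shift[of J] haar_father_def)

lemma haar_wavelet_cells:
  "haar (Wavelet J k l e) z = 2 ^ J * (\<Sum>a<2. \<Sum>b<2. haar_sign e a b * indicator (cell (Suc J) (2 * k + a) (2 * l + b)) z)"
proof (cases z)
  case (Pair x y)
  define A where "A a = dyadic_ind (Suc J) (2 * k + a) x" for a
  define B where "B b = dyadic_ind (Suc J) (2 * l + b) y" for b
  have "haar (Wavelet J k l e) z = 2 ^ J * (case e of Horizontal \<Rightarrow> (A 0 - A 1) * (B 0 + B 1)
    | Vertical \<Rightarrow> (A 0 + A 1) * (B 0 - B 1) | Diagonal \<Rightarrow> (A 0 - A 1) * (B 0 - B 1))"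
    by (cases e) (simp_all add: Pair father_split mother_split A_def B_def)
  also have "\<dots> = 2 ^ J * (\<Sum>a<2. \<Sum>b<2. haar_sign e a b * (A a * B b))"
    by (cases e) (simp_all add: haar_sign_def numeral_2_eq_2 algebra_simps)
  finally show ?thesis by (simp add: Pair indicator_cell A_def B_def)
qed

lemma integral_sum_2x2:
  fixes g :: "nat \<Rightarrow> nat \<Rightarrow> point \<Rightarrow> real"
  assumes "\<And>a b. integrable lam (g a b)"
  shows "(\<integral>z. (\<Sum>a<2. \<Sum>b<2. g a b z) \<partial>lam) = (\<Sum>a<2. \<Sum>b<2. integral\<^sup>L lam (g a b))"
proof -
  have "(\<integral>z. (\<Sum>a<2. \<Sum>b<2. g a b z) \<partial>lam) = (\<Sum>a<2. \<integral>z. (\<Sum>b<2. g a b z) \<partial>lam)"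
    by (rule Bochner_Integration.integral_sum) (intro Bochner_Integration.integrable_sum assms)
  also have "\<dots> = (\<Sum>a<2. \<Sum>b<2. integral\<^sup>L lam (g a b))"
    by (intro sum.cong refl Bochner_Integration.integral_sum assms)
  finally show ?thesis .
qed

lemma avg_parent:
  assumes f: "integrable lam f"
  shows "4 * avg J f k l = (\<Sum>a<2. \<Sum>b<2. avg (Suc J) f (2 * k + a) (2 * l + b))"
proof -
  have "indicator (cell J k l) z = (\<Sum>a<2. \<Sum>b<2. indicator (cell (Suc J) (2 * k + a) (2 * l + b)) z :: real)" for z
    by (simp add: indicator_cell dyadic_ind_split[of J] numeral_2_eq_2 algebra_simps)
  then have "(\<integral>z. indicator (cell J k l) z * f z \<partial>lam)
    = (\<integral>z. (\<Sum>a<2. \<Sum>b<2. indicator (cell (Suc J) (2 * k + a) (2 * l + b)) z * f z) \<partial>lam)"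
    by (simp only: sum_distrib_right)
  also have "\<dots> = (\<Sum>a<2. \<Sum>b<2. \<integral>z. indicator (cell (Suc J) (2 * k + a) (2 * l + b)) z * f z \<partial>lam)"
    by (rule integral_sum_2x2) (rule integrable_cell[OF f])
  finally show ?thesis by (simp add: avg_def sum_distrib_left mult.assoc)
qed

definition haar_coef :: "(point \<Rightarrow> real) \<Rightarrow> haar_index \<Rightarrow> real" where
  "haar_coef f x = (\<integral>z. f z * haar x z \<partial>lam)"

lemma haar_coef_wavelet:
  assumes f: "integrable lam f"
  shows "haar_coef f (Wavelet J k l e) = 2 ^ J / 4 ^ Suc J * (\<Sum>a<2. \<Sum>b<2. haar_sign e a b * avg (Suc J) f (2 * k + a) (2 * l + b))"
proof -
  have "haar_coef f (Wavelet J k l e) = (\<integral>z. 2 ^ J * (\<Sum>a<2. \<Sum>b<2. haar_sign e a b * (indicator (cell (Suc J) (2 * k + a) (2 * l + b)) z * f z)) \<partial>lam)"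
    unfolding haar_coef_def haar_wavelet_cells
  proof (intro Bochner_Integration.integral_cong refl)
    fix z
    have "(\<Sum>a<2. \<Sum>b<2. haar_sign e a b * (indicator (cell (Suc J) (2 * k + a) (2 * l + b)) z * f z))
      = (\<Sum>a<2. \<Sum>b<2. haar_sign e a b * indicator (cell (Suc J) (2 * k + a) (2 * l + b)) z) * f z"
      by (simp only: sum_distrib_right mult.assoc)
    then show "f z * (2 ^ J * (\<Sum>a<2. \<Sum>b<2. haar_sign e a b * indicator (cell (Suc J) (2 * k + a) (2 * l + b)) z))
      = 2 ^ J * (\<Sum>a<2. \<Sum>b<2. haar_sign e a b * (indicator (cell (Suc J) (2 * k + a) (2 * l + b)) z * f z))"
      by (simp only: mult.left_commute mult.commute)
  qed
  also have "\<dots> = 2 ^ J * (\<integral>z. (\<Sum>a<2. \<Sum>b<2. haar_sign e a b * (indicator (cell (Suc J) (2 * k + a) (2 * l + b)) z * f z)) \<partial>lam)"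
    by (rule integral_mult_right_zero)
  also have "\<dots> = 2 ^ J * (\<Sum>a<2. \<Sum>b<2. \<integral>z. haar_sign e a b * (indicator (cell (Suc J) (2 * k + a) (2 * l + b)) z * f z) \<partial>lam)"
    by (subst integral_sum_2x2) (use integrable_cell[OF f] in simp_all)
  finally show ?thesis by (simp add: avg_def sum_distrib_left mult.assoc)
qed

lemma haar_coef_scaling: "haar_coef f Scaling = integral\<^sup>L lam f"
  unfolding haar_coef_def
  by (intro Bochner_Integration.integral_cong refl) (auto simp: space_lam unit_square_def haar_father_def)

lemma UNIV_orientation: "UNIV = {Horizontal, Vertical, Diagonal}"
  using orientation.exhaust by auto

lemma sum_orientation: "(\<Sum>e\<in>UNIV. g e) = g Horizontal + g Vertical + (g Diagonal :: 'a :: comm_monoid_add)"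
  by (simp add: UNIV_orientation add.assoc)

text \<open>
  The three signs and the constant form an orthogonal \<open>4 \<times> 4\<close> Hadamard matrix.
\<close>

lemma haar_coef_block_sq:
  assumes f: "integrable lam f"
  shows "(\<Sum>e\<in>UNIV. (haar_coef f (Wavelet J k l e))\<^sup>2)
    = (\<Sum>a<2. \<Sum>b<2. (avg (Suc J) f (2 * k + a) (2 * l + b))\<^sup>2) / 4 ^ Suc J - (avg J f k l)\<^sup>2 / 4 ^ J"
proof -
  have s: "(2 ^ J / 4 ^ Suc J :: real)\<^sup>2 = 1 / (4 * 4 ^ Suc J)"
    by (simp add: power2_eq_square power_mult_distrib[symmetric])
  have p: "avg J f k l = (\<Sum>a<2. \<Sum>b<2. avg (Suc J) f (2 * k + a) (2 * l + b)) / 4"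
    using avg_parent[OF f, of J k l] by simp
  show ?thesis
    unfolding sum_orientation haar_coef_wavelet[OF f] power_mult_distrib s p
    by (simp add: numeral_2_eq_2 haar_sign_def) (simp add: power2_eq_square field_simps)
qed

lemma sum_pairs: 
  fixes n :: nat
  shows "(\<Sum>i<2 * n. g i) = (\<Sum>k<n. \<Sum>a<2. g (2 * k + a) :: 'a :: comm_monoid_add)"
proof (induction n)
  case (Suc n)
  have "(\<Sum>i<2 * Suc n. g i) = (\<Sum>i<2 * n. g i) + (g (2 * n) + g (Suc (2 * n)))"
    by (simp add: add.assoc)
  then show ?case using Suc by (simp add: numeral_2_eq_2)
qed simp

lemma level_sum_sq:
  assumes f: "integrable lam f"
  shows "(\<Sum>k<2 ^ J. \<Sum>l<2 ^ J. \<Sum>e\<in>UNIV. (haar_coef f (Wavelet J k l e))\<^sup>2) = energy (Suc J) f - energy J f"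
proof -
  have "(\<Sum>k<2 ^ J. \<Sum>l<2 ^ J. \<Sum>a<2. \<Sum>b<2. (avg (Suc J) f (2 * k + a) (2 * l + b))\<^sup>2)
    = (\<Sum>k<2 ^ J. \<Sum>a<2. \<Sum>l<2 ^ J. \<Sum>b<2. (avg (Suc J) f (2 * k + a) (2 * l + b))\<^sup>2)"
    by (intro sum.cong refl sum.swap)
  also have "\<dots> = (\<Sum>i<2 ^ Suc J. \<Sum>j<2 ^ Suc J. (avg (Suc J) f i j)\<^sup>2)"
    unfolding power_Suc sum_pairs ..
  finally show ?thesis
    unfolding haar_coef_block_sq[OF f] energy_def by (simp only: sum_subtractf sum_divide_distrib[symmetric])
qed

definition level_set :: "nat \<Rightarrow> haar_index set" where
  "level_set J = (\<lambda>(k, l, e). Wavelet J k l e) ` ({..<2 ^ J} \<times> {..<2 ^ J} \<times> UNIV)"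

text \<open>
  The indices that span the functions constant on the cells of level \<open>J\<close>.
\<close>

definition below :: "nat \<Rightarrow> haar_index set" where
  "below J = {x \<in> haar_indices. level x < int J}"

lemma finite_level_set: "finite (level_set J)"
  by (simp add: level_set_def UNIV_orientation)

lemma inj_Wavelet: "inj_on (\<lambda>(k, l, e). Wavelet J k l e) A"
  by (auto intro!: inj_onI)

lemma sum_level_set: "(\<Sum>x\<in>level_set J. g x) = (\<Sum>k<2 ^ J. \<Sum>l<2 ^ J. \<Sum>e\<in>UNIV. g (Wavelet J k l e))"
  unfolding level_set_def sum.reindex[OF inj_Wavelet]
  by (simp add: sum.cartesian_product case_prod_beta' comp_def)

lemma below_0: "below 0 = {Scaling}"
  by (auto simp: below_def haar_indices_def)

lemma below_Suc: "below (Suc J) = below J \<union> level_set J" "below J \<inter> level_set J = {}"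
proof -
  show "below (Suc J) = below J \<union> level_set J"
  proof (intro set_eqI iffI)
    fix x assume "x \<in> below (Suc J)"
    then have x: "x \<in> haar_indices" "level x < int (Suc J)" by (auto simp: below_def)
    show "x \<in> below J \<union> level_set J"
    proof (cases "level x < int J")
      case True then show ?thesis using x by (simp add: below_def)
    next
      case False
      then have "level x = int J" using x by simp
      then show ?thesis using x by (auto simp: haar_indices_def level_set_def image_iff)
    qed
  next
    fix x assume "x \<in> below J \<union> level_set J"
    then show "x \<in> below (Suc J)"
      by (auto simp: below_def haar_indices_def level_set_def)
  qed
  show "below J \<inter> level_set J = {}" by (auto simp: below_def level_set_def)
qed

lemma finite_below: "finite (below J)"
  by (induction J) (simp_all add: below_0 below_Suc finite_level_set)

lemma card_below: "card (below J) = 4 ^ J"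
proof (induction J)
  case (Suc J)
  have "card (level_set J) = 2 ^ J * (2 ^ J * 3)"
    unfolding level_set_def card_image[OF inj_Wavelet] by (simp add: UNIV_orientation)
  also have "\<dots> = 3 * 4 ^ J" by (simp add: power_mult_distrib[symmetric])
  finally show ?case
    unfolding below_Suc(1) using Suc by (subst card_Un_disjoint) (auto simp: finite_below finite_level_set below_Suc(2))
qed (simp add: below_0)

lemma sum_below_sq:
  assumes f: "integrable lam f"
  shows "(\<Sum>x\<in>below J. (haar_coef f x)\<^sup>2) = energy J f"
proof (induction J)
  case 0
  then show ?case by (simp add: below_0 haar_coef_scaling energy_def avg_0)
next
  case (Suc J)
  then show ?case
    unfolding below_Suc(1)
    by (subst sum.union_disjoint[OF finite_below finite_level_set below_Suc(2)])
       (simp add: sum_level_set level_sum_sq[OF f])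
qed

text \<open>
  Any enumeration by levels lists the \<open>4\<^sup>J\<close> indices of level less than \<open>J\<close> first.
\<close>

lemma enumeration_below:
  assumes io: "haar_enumeration \<iota>" and j: "1 \<le> j"
  shows "\<iota> j \<in> below J \<longleftrightarrow> j \<le> 4 ^ J"
proof -
  have bij: "bij_betw \<iota> {1..} haar_indices" and mon: "\<And>i j. 1 \<le> i \<Longrightarrow> i \<le> j \<Longrightarrow> level (\<iota> i) \<le> level (\<iota> j)"
    using io by (auto simp: haar_enumeration_def)
  define A where "A = {j. 1 \<le> j \<and> \<iota> j \<in> below J}"
  have inj: "inj_on \<iota> A" using bij by (auto simp: bij_betw_def A_def intro: inj_on_subset)
  have im: "\<iota> ` A = below J"
  proof
    show "below J \<subseteq> \<iota> ` A"
    proof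
      fix x assume x: "x \<in> below J"
      then have "x \<in> \<iota> ` {1..}" using bij by (simp add: bij_betw_def below_def)
      then show "x \<in> \<iota> ` A" using x by (auto simp: A_def)
    qed
  qed (auto simp: A_def)
  have finA: "finite A" using finite_below inj im finite_image_iff by metis
  have cA: "card A = 4 ^ J" using card_image[OF inj] im card_below by simp
  have down: "i \<in> A" if "j \<in> A" "1 \<le> i" "i \<le> j" for i j
  proof -
    have "\<iota> i \<in> haar_indices" using bij that by (auto simp: bij_betw_def)
    moreover have "level (\<iota> i) < int J" using mon[OF that(2,3)] that(1) by (auto simp: A_def below_def)
    ultimately show ?thesis using that by (simp add: A_def below_def)
  qed
  have "A \<noteq> {}" using cA by auto
  then have "Max A \<in> A" using finA by (rule Max_in[rotated])
  have "A = {1..Max A}"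
  proof (intro set_eqI iffI)
    fix i assume "i \<in> A"
    then show "i \<in> {1..Max A}" using Max_ge[OF finA, of i] by (simp add: A_def)
  next
    fix i assume "i \<in> {1..Max A}"
    then show "i \<in> A" using down[OF \<open>Max A \<in> A\<close>, of i] by simp
  qed
  moreover from this have "card A = Max A" by (metis card_atLeastAtMost diff_Suc_1)
  ultimately have "A = {1..4 ^ J}" using cA by metis
  then have "j \<in> A \<longleftrightarrow> j \<in> {1..4 ^ J}" by simp
  then show ?thesis using j by (simp add: A_def)
qed

lemma haar_coeff_sum:
  assumes io: "haar_enumeration \<iota>" and f: "integrable lam f" and JK: "J \<le> K"
  shows "(\<Sum>j\<in>{4 ^ J<..4 ^ K}. (haar_coeff \<iota> f j)\<^sup>2) = energy K f - energy J f"
proof -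
  have bij: "bij_betw \<iota> {1..} haar_indices" using io by (simp add: haar_enumeration_def)
  have e: "(\<Sum>j\<in>{1..4 ^ J}. (haar_coeff \<iota> f j)\<^sup>2) = energy J f" for J
  proof -
    have "\<iota> ` {1..4 ^ J} = below J"
    proof
      show "below J \<subseteq> \<iota> ` {1..4 ^ J}"
      proof
        fix x assume x: "x \<in> below J"
        then have "x \<in> \<iota> ` {1..}" using bij by (simp add: bij_betw_def below_def)
        then show "x \<in> \<iota> ` {1..4 ^ J}" using enumeration_below[OF io] x by auto
      qed
    qed (use enumeration_below[OF io] in auto)
    moreover have "inj_on \<iota> {1..4 ^ J}" using bij by (auto simp: bij_betw_def intro: inj_on_subset)
    ultimately have "(\<Sum>x\<in>below J. (haar_coef f x)\<^sup>2) = (\<Sum>j\<in>{1..4 ^ J}. (haar_coef f (\<iota> j))\<^sup>2)"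
      by (metis (no_types, lifting) comp_apply sum.cong sum.reindex)
    then show ?thesis using sum_below_sq[OF f] by (simp add: haar_coeff_def haar_coef_def)
  qed
  have "(\<Sum>j\<in>{1..M}. (haar_coeff \<iota> f j)\<^sup>2)
    = (\<Sum>j\<in>{1..N}. (haar_coeff \<iota> f j)\<^sup>2) + (\<Sum>j\<in>{N<..M}. (haar_coeff \<iota> f j)\<^sup>2)" if "N \<le> M" for N M
  proof -
    have "{1..M} = {1..N} \<union> {N<..M}" using that by auto
    then show ?thesis by (simp only:) (rule sum.union_disjoint, auto)
  qed
  from this[of "4 ^ J" "4 ^ K"] e[of J] e[of K] JK show ?thesis by (simp add: power_increasing)
qed

section \<open>Completeness of the Haar system\<close>

lemma energy_le:
  assumes "L2 f"
  shows "energy J f \<le> (\<integral>z. (f z)\<^sup>2 \<partial>lam)"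
  using assms
proof (induction J arbitrary: f)
  case 0
  then show ?case using mean_sq_le[OF 0] by (simp add: energy_def avg_0)
next
  case (Suc J)
  have "energy (Suc J) f = (\<Sum>a<2. \<Sum>b<2. energy J (quarter a b f))"
    by (rule energy_Suc[OF L2_integrable[OF Suc.prems]])
  also have "\<dots> \<le> (\<Sum>a<2. \<Sum>b<2. \<integral>z. (quarter a b f z)\<^sup>2 \<partial>lam)"
    by (intro sum_mono Suc.IH L2_quarter Suc.prems) auto
  also have "\<dots> = (\<integral>z. (f z)\<^sup>2 \<partial>lam)" by (rule sq_quarters[OF Suc.prems, symmetric])
  finally show ?case .
qed

text \<open>
  The step function with the values of \<open>g\<close> at the lower left corners of the cells. For continuous
  \<open>g\<close> it converges pointwise to \<open>g\<close>.
\<close>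

definition step_fun :: "nat \<Rightarrow> (point \<Rightarrow> real) \<Rightarrow> point \<Rightarrow> real" where
  "step_fun K g z = (\<Sum>i<2 ^ K. \<Sum>j<2 ^ K. g (real i / 2 ^ K, real j / 2 ^ K) * indicator (cell K i j) z)"

lemma dyadic_floor:
  fixes x :: real
  assumes "0 \<le> x" "x < 1"
  shows "nat \<lfloor>2 ^ K * x\<rfloor> < 2 ^ K"
    "real i / 2 ^ K \<le> x \<and> x < (real i + 1) / 2 ^ K \<longleftrightarrow> i = nat \<lfloor>2 ^ K * x\<rfloor>"
    "\<bar>real (nat \<lfloor>2 ^ K * x\<rfloor>) / 2 ^ K - x\<bar> \<le> 1 / 2 ^ K"
proof -
  define y where "y = 2 ^ K * x"
  have y: "0 \<le> y" "y < 2 ^ K" using assms by (auto simp: y_def)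
  have fl: "real (nat \<lfloor>y\<rfloor>) \<le> y" "y < real (nat \<lfloor>y\<rfloor>) + 1"
    using y of_int_floor_le[of y] floor_correct[of y] by (simp_all add: of_nat_nat)
  have "real (nat \<lfloor>y\<rfloor>) < 2 ^ K" using fl y by linarith
  then show "nat \<lfloor>2 ^ K * x\<rfloor> < 2 ^ K" unfolding y_def[symmetric] by simp
  have "real i / 2 ^ K \<le> x \<and> x < (real i + 1) / 2 ^ K \<longleftrightarrow> real i \<le> y \<and> y < real i + 1"
    by (simp add: y_def divide_le_eq less_divide_eq mult.commute)
  also have "\<dots> \<longleftrightarrow> i = nat \<lfloor>y\<rfloor>"
  proof
    assume "real i \<le> y \<and> y < real i + 1"
    then have "\<lfloor>y\<rfloor> = int i" by (intro floor_unique) auto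
    then show "i = nat \<lfloor>y\<rfloor>" by simp
  qed (use fl in simp)
  finally show "real i / 2 ^ K \<le> x \<and> x < (real i + 1) / 2 ^ K \<longleftrightarrow> i = nat \<lfloor>2 ^ K * x\<rfloor>"
    unfolding y_def .
  have x: "x = y / 2 ^ K" by (simp add: y_def)
  have "\<bar>real (nat \<lfloor>y\<rfloor>) / 2 ^ K - y / 2 ^ K\<bar> = \<bar>real (nat \<lfloor>y\<rfloor>) - y\<bar> / 2 ^ K"
    by (simp add: diff_divide_distrib[symmetric] abs_divide)
  also have "\<bar>real (nat \<lfloor>y\<rfloor>) - y\<bar> \<le> 1" using fl by linarith
  finally have "\<bar>real (nat \<lfloor>y\<rfloor>) / 2 ^ K - y / 2 ^ K\<bar> \<le> 1 / 2 ^ K" by (simp add: divide_right_mono)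
  then show "\<bar>real (nat \<lfloor>2 ^ K * x\<rfloor>) / 2 ^ K - x\<bar> \<le> 1 / 2 ^ K" unfolding y_def[symmetric] x[symmetric] .
qed

definition corner :: "nat \<Rightarrow> point \<Rightarrow> point" where
  "corner K z = (real (nat \<lfloor>2 ^ K * fst z\<rfloor>) / 2 ^ K, real (nat \<lfloor>2 ^ K * snd z\<rfloor>) / 2 ^ K)"

lemma step_fun_corner:
  assumes "z \<in> unit_square"
  shows "step_fun K g z = g (corner K z)" "step_fun K (\<lambda>w. (g w)\<^sup>2) z = (step_fun K g z)\<^sup>2"
proof -
  have z: "0 \<le> fst z" "fst z < 1" "0 \<le> snd z" "snd z < 1" using assms by (auto simp: unit_square_def)
  have s: "step_fun K g z = g (corner K z)" for g
  proof -
    let ?I = "nat \<lfloor>2 ^ K * fst z\<rfloor>" and ?J = "nat \<lfloor>2 ^ K * snd z\<rfloor>"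
    have "indicator (cell K i j) z = (if i = ?I then if j = ?J then 1 else 0 else 0 :: real)" for i j
      using dyadic_floor(2)[OF z(1,2), of i K] dyadic_floor(2)[OF z(3,4), of j K]
      by (cases z) (auto simp: cell_def indicator_def)
    then have "step_fun K g z = (\<Sum>i<2 ^ K. \<Sum>j<2 ^ K. if i = ?I then if j = ?J then g (real i / 2 ^ K, real j / 2 ^ K) else 0 else 0)"
      unfolding step_fun_def by (intro sum.cong refl) simp
    also have "\<dots> = (\<Sum>i<2 ^ K. if i = ?I then (\<Sum>j<2 ^ K. if j = ?J then g (real i / 2 ^ K, real j / 2 ^ K) else 0) else 0)"
      by (intro sum.cong refl) simp
    also have "\<dots> = g (real ?I / 2 ^ K, real ?J / 2 ^ K)"
      using dyadic_floor(1)[OF z(1,2), of K] dyadic_floor(1)[OF z(3,4), of K] by simp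
    finally show ?thesis by (simp add: corner_def)
  qed
  then show "step_fun K g z = g (corner K z)" "step_fun K (\<lambda>w. (g w)\<^sup>2) z = (step_fun K g z)\<^sup>2" by simp_all
qed

lemma corner_tendsto:
  assumes "z \<in> unit_square"
  shows "(\<lambda>K. corner K z) \<longlonglongrightarrow> z"
proof -
  have *: "(\<lambda>K. real (nat \<lfloor>2 ^ K * x\<rfloor>) / 2 ^ K) \<longlonglongrightarrow> x" if "0 \<le> x" "x < 1" for x :: real
  proof -
    have "(\<lambda>K. real (nat \<lfloor>2 ^ K * x\<rfloor>) / 2 ^ K - x) \<longlonglongrightarrow> 0"
    proof (rule Lim_null_comparison)
      show "\<forall>\<^sub>F K in sequentially. norm (real (nat \<lfloor>2 ^ K * x\<rfloor>) / 2 ^ K - x) \<le> (1/2) ^ K"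
        using dyadic_floor(3)[OF that] by (simp add: power_divide)
      show "(\<lambda>K. (1/2) ^ K :: real) \<longlonglongrightarrow> 0" by (rule LIMSEQ_power_zero) simp
    qed
    then show ?thesis by (simp add: LIM_zero_iff)
  qed
  have "(\<lambda>K. corner K z) \<longlonglongrightarrow> (fst z, snd z)"
    unfolding corner_def using assms by (intro tendsto_Pair *) (auto simp: unit_square_def)
  then show ?thesis by simp
qed

lemma step_fun_measurable: "step_fun K g \<in> borel_measurable lam"
  unfolding step_fun_def[abs_def] by measurable

lemma integral_cell: "i < 2 ^ K \<Longrightarrow> j < 2 ^ K \<Longrightarrow> (\<integral>z. indicator (cell K i j) z \<partial>lam) = (1 / 4 ^ K :: real)"
proof (induction K arbitrary: i j)
  case 0
  have "(\<integral>z. indicator (cell 0 0 0) z \<partial>lam) = (\<integral>z. (1::real) \<partial>lam)"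
    by (rule Bochner_Integration.integral_cong) (auto simp: space_lam unit_square_def cell_def indicator_def)
  also have "\<dots> = 1" by (simp add: lam.prob_space)
  finally show ?case using 0 by simp
next
  case (Suc K)
  define a where "a = i div 2 ^ K"
  define b where "b = j div 2 ^ K"
  have ab: "a < 2" "b < 2" using Suc.prems unfolding a_def b_def by (simp_all add: less_mult_imp_div_less)
  define i' where "i' = i mod 2 ^ K"
  define j' where "j' = j mod 2 ^ K"
  have ij: "i' < 2 ^ K" "j' < 2 ^ K" by (simp_all add: i'_def j'_def)
  have e: "i = i' + a * 2 ^ K" "j = j' + b * 2 ^ K" by (simp_all only: a_def b_def i'_def j'_def mod_div_mult_eq)
  have "avg (Suc K) (\<lambda>_. 1) i j = 2 * avg K (quarter a b (\<lambda>_. 1)) i' j'"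
    unfolding e by (rule avg_quarter[OF _ ij ab]) simp
  also have "quarter a b (\<lambda>_. 1) = (\<lambda>_. 1/2)" by (rule ext) (simp add: quarter_def)
  finally have "4 ^ Suc K * (\<integral>z. indicator (cell (Suc K) i j) z \<partial>lam) = (4 ^ K * (\<integral>z. indicator (cell K i' j') z \<partial>lam) :: real)"
    by (simp add: avg_def)
  also have "\<dots> = 1" unfolding Suc.IH[OF ij] by simp
  finally have e1: "4 ^ Suc K * (\<integral>z. indicator (cell (Suc K) i j) z \<partial>lam) = (1::real)" .
  have "y = 1 / c" if "c * y = 1" for c y :: real
  proof -
    have "c \<noteq> 0" using that by auto
    then show ?thesis using that by (metis nonzero_mult_div_cancel_left)
  qed
  from this[OF e1] show ?case .
qed

text \<open>
  The integral only depends on the averages of \<open>f\<close>; then \<open>2xy \<le> x\<^sup>2 + y\<^sup>2\<close>.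
\<close>

lemma integral_step_fun_le:
  assumes f: "integrable lam f" and B: "energy K f \<le> B"
  shows "(\<integral>z. f z * step_fun K g z \<partial>lam) \<le> (B + (\<integral>z. (step_fun K g z)\<^sup>2 \<partial>lam)) / 2"
proof -
  define \<gamma> where "\<gamma> i j = g (real i / 2 ^ K, real j / 2 ^ K)" for i j :: nat
  have sums: "(\<integral>z. (\<Sum>i<2 ^ K. \<Sum>j<2 ^ K. u i j z) \<partial>lam) = (\<Sum>i<2 ^ K. \<Sum>j<2 ^ K. integral\<^sup>L lam (u i j))"
    if "\<And>i j. integrable lam (u i j)" for u :: "nat \<Rightarrow> nat \<Rightarrow> point \<Rightarrow> real"
  proof -
    have "(\<integral>z. (\<Sum>i<2 ^ K. \<Sum>j<2 ^ K. u i j z) \<partial>lam) = (\<Sum>i<2 ^ K. \<integral>z. (\<Sum>j<2 ^ K. u i j z) \<partial>lam)"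
      by (rule Bochner_Integration.integral_sum) (intro Bochner_Integration.integrable_sum that)
    also have "\<dots> = (\<Sum>i<2 ^ K. \<Sum>j<2 ^ K. integral\<^sup>L lam (u i j))"
      by (intro sum.cong refl Bochner_Integration.integral_sum that)
    finally show ?thesis .
  qed
  have ic: "integrable lam (\<lambda>z. indicator (cell K i j) z :: real)" for i j
    using integrable_cell[of "\<lambda>_. 1" K i j] by simp
  have "(\<integral>z. f z * step_fun K g z \<partial>lam) = (\<integral>z. (\<Sum>i<2 ^ K. \<Sum>j<2 ^ K. \<gamma> i j * (indicator (cell K i j) z * f z)) \<partial>lam)"
    unfolding step_fun_def \<gamma>_def sum_distrib_left
    by (intro Bochner_Integration.integral_cong sum.cong refl) (simp only: mult_ac)
  also have "\<dots> = (\<Sum>i<2 ^ K. \<Sum>j<2 ^ K. \<integral>z. \<gamma> i j * (indicator (cell K i j) z * f z) \<partial>lam)"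
    by (rule sums) (intro integrable_mult_right integrable_cell f)
  also have "\<dots> = (\<Sum>i<2 ^ K. \<Sum>j<2 ^ K. \<gamma> i j * avg K f i j / 4 ^ K)"
    by (simp add: avg_def)
  also have "\<dots> \<le> (\<Sum>i<2 ^ K. \<Sum>j<2 ^ K. ((avg K f i j)\<^sup>2 / 4 ^ K + (\<gamma> i j)\<^sup>2 / 4 ^ K) / 2)"
  proof (intro sum_mono)
    fix i j
    have "2 * (\<gamma> i j * avg K f i j) \<le> (avg K f i j)\<^sup>2 + (\<gamma> i j)\<^sup>2"
      using sum_squares_bound[of "\<gamma> i j" "avg K f i j"] by (simp add: mult.assoc)
    then have "2 * (\<gamma> i j * avg K f i j) / 4 ^ K \<le> ((avg K f i j)\<^sup>2 + (\<gamma> i j)\<^sup>2) / 4 ^ K"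
      by (rule divide_right_mono) simp
    then show "\<gamma> i j * avg K f i j / 4 ^ K \<le> ((avg K f i j)\<^sup>2 / 4 ^ K + (\<gamma> i j)\<^sup>2 / 4 ^ K) / 2"
      by (simp add: add_divide_distrib)
  qed
  also have "\<dots> = (energy K f + (\<Sum>i<2 ^ K. \<Sum>j<2 ^ K. (\<gamma> i j)\<^sup>2 / 4 ^ K)) / 2"
    by (simp add: energy_def sum_divide_distrib[symmetric] sum.distrib)
  also have "(\<Sum>i<2 ^ K. \<Sum>j<2 ^ K. (\<gamma> i j)\<^sup>2 / 4 ^ K) = (\<Sum>i<2 ^ K. \<Sum>j<2 ^ K. \<integral>z. (\<gamma> i j)\<^sup>2 * indicator (cell K i j) z \<partial>lam)"
    by (intro sum.cong refl) (simp only: integral_mult_right_zero integral_cell lessThan_iff times_divide_eq_right mult_1_right)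
  also have "\<dots> = (\<integral>z. step_fun K (\<lambda>w. (g w)\<^sup>2) z \<partial>lam)"
    unfolding step_fun_def \<gamma>_def by (rule sums[symmetric]) (use ic in simp)
  also have "\<dots> = (\<integral>z. (step_fun K g z)\<^sup>2 \<partial>lam)"
    by (intro Bochner_Integration.integral_cong refl step_fun_corner(2)) (simp add: space_lam)
  finally show ?thesis using B by simp
qed

lemma integral_continuous_le:
  assumes f: "integrable lam f" and B: "\<And>K. energy K f \<le> B"
    and g: "continuous_on UNIV g" "\<And>z. \<bar>g z\<bar> \<le> M"
  shows "(\<integral>z. f z * g z \<partial>lam) \<le> (B + (\<integral>z. (g z)\<^sup>2 \<partial>lam)) / 2"
proof -
  have [measurable]: "f \<in> borel_measurable lam" using f by auto
  have gm[measurable]: "g \<in> borel_measurable lam"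
    unfolding lam_def by (intro measurable_restrict_space1) (simp add: borel_measurable_continuous_onI g)
  note [measurable] = step_fun_measurable
  have M: "0 \<le> M" using g(2)[of 0] by (rule order_trans[OF abs_ge_zero])
  have lim: "(\<lambda>K. step_fun K g z) \<longlonglongrightarrow> g z" if "z \<in> space lam" for z
  proof -
    have z: "z \<in> unit_square" using that by (simp add: space_lam)
    have "isCont g z" using g(1) continuous_on_eq_continuous_at[OF open_UNIV] by blast
    then have "(\<lambda>K. g (corner K z)) \<longlonglongrightarrow> g z" by (rule isCont_tendsto_compose[OF _ corner_tendsto[OF z]])
    then show ?thesis by (simp add: step_fun_corner[OF z])
  qed
  have bd: "\<bar>step_fun K g z\<bar> \<le> M" if "z \<in> space lam" for K z
    using g(2) that by (simp add: step_fun_corner space_lam)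
  have 1: "(\<lambda>K. \<integral>z. f z * step_fun K g z \<partial>lam) \<longlonglongrightarrow> (\<integral>z. f z * g z \<partial>lam)"
  proof (rule integral_dominated_convergence[where w="\<lambda>z. \<bar>f z\<bar> * M"])
    show "AE z in lam. (\<lambda>K. f z * step_fun K g z) \<longlonglongrightarrow> f z * g z"
      by (intro AE_I2 tendsto_mult tendsto_const lim)
    show "AE z in lam. norm (f z * step_fun K g z) \<le> \<bar>f z\<bar> * M" for K
      by (intro AE_I2) (simp only: real_norm_def abs_mult, intro mult_left_mono bd abs_ge_zero)
  qed (use f in auto)
  have 2: "(\<lambda>K. \<integral>z. (step_fun K g z)\<^sup>2 \<partial>lam) \<longlonglongrightarrow> (\<integral>z. (g z)\<^sup>2 \<partial>lam)"
  proof (rule integral_dominated_convergence[where w="\<lambda>z. M\<^sup>2"])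
    show "AE z in lam. (\<lambda>K. (step_fun K g z)\<^sup>2) \<longlonglongrightarrow> (g z)\<^sup>2"
      by (intro AE_I2 tendsto_power lim)
    show "AE z in lam. norm ((step_fun K g z)\<^sup>2) \<le> M\<^sup>2" for K
      using bd M by (intro AE_I2) (simp add: abs_le_square_iff[symmetric])
  qed auto
  show ?thesis
    by (rule LIMSEQ_le[OF 1 tendsto_divide[OF tendsto_add[OF tendsto_const 2] tendsto_const]])
      (use integral_step_fun_le[OF f B] in auto)
qed

definition clip :: "real \<Rightarrow> real \<Rightarrow> real" where "clip M x = max (- M) (min M x)"

lemma clip_bound: "0 \<le> M \<Longrightarrow> \<bar>clip M x\<bar> \<le> M" by (auto simp: clip_def)
lemma clip_le: "0 \<le> M \<Longrightarrow> \<bar>clip M x\<bar> \<le> \<bar>x\<bar>" by (auto simp: clip_def)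

text \<open>
  A Borel function is almost everywhere a limit of continuous functions, which may be clipped as well.
\<close>

lemma integral_clip_le:
  assumes f: "integrable lam f" and B: "\<And>K. energy K f \<le> B" and M: "0 \<le> M"
  shows "(\<integral>z. f z * clip M (f z) \<partial>lam) \<le> (B + (\<integral>z. (clip M (f z))\<^sup>2 \<partial>lam)) / 2"
proof -
  have fm[measurable]: "f \<in> borel_measurable lam" using f by auto
  \<comment> \<open>functions on the square are extended by zero, as the approximation by continuous functions lives on the plane\<close>
  define F where "F z = indicator unit_square z * f z" for z
  have Fm: "F \<in> borel_measurable borel" using fm unfolding lam_measurable_iff F_def by simp
  then have "F \<in> borel_measurable lborel" by simp
  then have "F \<in> borel_measurable lebesgue" by (rule measurable_completion)
  then have "F \<in> borel_measurable (lebesgue_on UNIV)" by (rule measurable_restrict_space1)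
  then have "F measurable_on UNIV" by (simp add: lebesgue_measurable_imp_measurable_on)
  then obtain N g where N: "negligible N" and gc: "\<And>n. continuous_on UNIV (g n)"
    and gl: "\<And>z. z \<notin> N \<Longrightarrow> (\<lambda>n. g n z) \<longlonglongrightarrow> F z"
    unfolding measurable_on_def by auto
  have "AE z in lebesgue. z \<notin> N"
    using N by (intro AE_not_in) (simp add: negligible_iff_null_sets)
  then have "AE z in lborel. z \<notin> N" by (simp add: AE_completion_iff)
  then have ae: "AE z in lam. z \<notin> N"
    unfolding lam_def by (subst AE_restrict_space_iff) auto
  define G where "G n z = clip M (g n z)" for n z
  have Gc: "continuous_on UNIV (G n)" for n
    unfolding G_def[abs_def] clip_def by (intro continuous_intros gc)
  have Gm[measurable]: "G n \<in> borel_measurable lam" for n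
    unfolding lam_def by (intro measurable_restrict_space1) (simp add: borel_measurable_continuous_onI Gc)
  have Gb: "\<bar>G n z\<bar> \<le> M" for n z unfolding G_def by (rule clip_bound[OF M])
  have cm[measurable]: "(\<lambda>z. clip M (f z)) \<in> borel_measurable lam" unfolding clip_def by measurable
  have lim: "AE z in lam. (\<lambda>n. G n z) \<longlonglongrightarrow> clip M (f z)"
    using ae AE_space
  proof eventually_elim
    case (elim z)
    then have "(\<lambda>n. g n z) \<longlonglongrightarrow> f z" using gl[of z] by (simp add: F_def space_lam)
    then show ?case unfolding G_def clip_def by (intro tendsto_intros)
  qed
  have 1: "(\<lambda>n. \<integral>z. f z * G n z \<partial>lam) \<longlonglongrightarrow> (\<integral>z. f z * clip M (f z) \<partial>lam)"
  proof (rule integral_dominated_convergence[where w="\<lambda>z. \<bar>f z\<bar> * M"])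
    show "AE z in lam. (\<lambda>n. f z * G n z) \<longlonglongrightarrow> f z * clip M (f z)"
      using lim by eventually_elim (intro tendsto_mult tendsto_const)
    show "AE z in lam. norm (f z * G n z) \<le> \<bar>f z\<bar> * M" for n
      by (intro AE_I2) (simp only: real_norm_def abs_mult, intro mult_left_mono Gb abs_ge_zero)
  qed (use f in auto)
  have 2: "(\<lambda>n. \<integral>z. (G n z)\<^sup>2 \<partial>lam) \<longlonglongrightarrow> (\<integral>z. (clip M (f z))\<^sup>2 \<partial>lam)"
  proof (rule integral_dominated_convergence[where w="\<lambda>z. M\<^sup>2"])
    show "AE z in lam. (\<lambda>n. (G n z)\<^sup>2) \<longlonglongrightarrow> (clip M (f z))\<^sup>2"
      using lim by eventually_elim (intro tendsto_power)
    show "AE z in lam. norm ((G n z)\<^sup>2) \<le> M\<^sup>2" for n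
      using Gb M by (intro AE_I2) (simp add: abs_le_square_iff[symmetric])
  qed auto
  show ?thesis
    by (rule LIMSEQ_le[OF 1 tendsto_divide[OF tendsto_add[OF tendsto_const 2] tendsto_const]])
      (use integral_continuous_le[OF f B Gc Gb] in auto)
qed

text \<open>
  Completeness by duality. The inequality \<open>\<integral> f g \<le> (B + \<integral> g\<^sup>2) / 2\<close> holds for step functions \<open>g\<close>
  and passes, by dominated convergence, to bounded continuous \<open>g\<close>, to \<open>g = clip M f\<close> and
  finally to \<open>g = f\<close>, where it reads \<open>\<integral> f\<^sup>2 \<le> B\<close>.
\<close>

theorem energy_bound_imp_L2_bound:
  assumes f: "L2 f" and B: "\<And>K. energy K f \<le> B"
  shows "(\<integral>z. (f z)\<^sup>2 \<partial>lam) \<le> B"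
proof -
  have fm[measurable]: "f \<in> borel_measurable lam" and f2: "integrable lam (\<lambda>z. (f z)\<^sup>2)" using f by (auto simp: L2_def)
  have cm[measurable]: "(\<lambda>z. clip M (f z)) \<in> borel_measurable lam" for M unfolding clip_def by measurable
  have lim: "(\<lambda>n. clip (real n) x) \<longlonglongrightarrow> x" for x
  proof (rule tendsto_eventually)
    obtain N :: nat where "\<bar>x\<bar> \<le> real N" using real_arch_simple by blast
    then have "clip (real n) x = x" if "n \<ge> N" for n
    proof -
      have "\<bar>x\<bar> \<le> real n" using that \<open>\<bar>x\<bar> \<le> real N\<close> by (meson of_nat_mono order_trans)
      then show ?thesis by (auto simp: clip_def)
    qed
    then show "\<forall>\<^sub>F n in sequentially. clip (real n) x = x" by (auto simp: eventually_sequentially)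
  qed
  have 1: "(\<lambda>n. \<integral>z. f z * clip (real n) (f z) \<partial>lam) \<longlonglongrightarrow> (\<integral>z. f z * f z \<partial>lam)"
  proof (rule integral_dominated_convergence[where w="\<lambda>z. (f z)\<^sup>2"])
    show "AE z in lam. (\<lambda>n. f z * clip (real n) (f z)) \<longlonglongrightarrow> f z * f z"
      by (intro AE_I2 tendsto_mult tendsto_const lim)
    have "\<bar>f z\<bar> * \<bar>clip (real n) (f z)\<bar> \<le> \<bar>f z\<bar> * \<bar>f z\<bar>" for n z
      by (intro mult_left_mono clip_le) auto
    then show "AE z in lam. norm (f z * clip (real n) (f z)) \<le> (f z)\<^sup>2" for n
      by (intro AE_I2) (simp add: abs_mult power2_eq_square)
  qed (use f2 in auto)
  have 2: "(\<lambda>n. \<integral>z. (clip (real n) (f z))\<^sup>2 \<partial>lam) \<longlonglongrightarrow> (\<integral>z. (f z)\<^sup>2 \<partial>lam)"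
  proof (rule integral_dominated_convergence[where w="\<lambda>z. (f z)\<^sup>2"])
    show "AE z in lam. (\<lambda>n. (clip (real n) (f z))\<^sup>2) \<longlonglongrightarrow> (f z)\<^sup>2"
      by (intro AE_I2 tendsto_power lim)
    show "AE z in lam. norm ((clip (real n) (f z))\<^sup>2) \<le> (f z)\<^sup>2" for n
      by (intro AE_I2) (simp add: abs_le_square_iff[symmetric] clip_le)
  qed (use f2 in auto)
  have "(\<integral>z. f z * f z \<partial>lam) \<le> (B + (\<integral>z. (f z)\<^sup>2 \<partial>lam)) / 2"
    by (rule LIMSEQ_le[OF 1 tendsto_divide[OF tendsto_add[OF tendsto_const 2] tendsto_const]])
      (use integral_clip_le[OF L2_integrable[OF f] B] in auto)
  then show ?thesis by (simp add: power2_eq_square)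
qed

section \<open>Decay of the Haar coefficients\<close>

lemma haar_partial_sum:
  assumes io: "haar_enumeration \<iota>" and f: "integrable lam f" and F: "finite F" "F \<subseteq> {4 ^ J<..}"
  shows "\<exists>K. (\<Sum>j\<in>F. (haar_coeff \<iota> f j)\<^sup>2) \<le> energy K f - energy J f"
proof -
  define K where "K = max J (Max (insert 0 F))"
  have "F \<subseteq> {4 ^ J<..4 ^ K}"
  proof
    fix j assume j: "j \<in> F"
    have "j \<le> K" using F j by (simp add: K_def le_max_iff_disj)
    also have "K < 4 ^ K" by (rule less_exp[of K, THEN order.strict_trans2]) (simp add: power_mono)
    finally show "j \<in> {4 ^ J<..4 ^ K}" using F j by auto
  qed
  then have "(\<Sum>j\<in>F. (haar_coeff \<iota> f j)\<^sup>2) \<le> (\<Sum>j\<in>{4 ^ J<..4 ^ K}. (haar_coeff \<iota> f j)\<^sup>2)"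
    by (intro sum_mono2) auto
  also have "\<dots> = energy K f - energy J f" by (rule haar_coeff_sum[OF io f]) (simp add: K_def)
  finally show ?thesis by blast
qed

lemma haar_coeff_summable:
  assumes io: "haar_enumeration \<iota>" and f: "L2 f"
  shows "(\<lambda>j. (haar_coeff \<iota> f j)\<^sup>2) summable_on {4 ^ J<..}"
proof (rule nonneg_bdd_above_summable_on)
  show "bdd_above (sum (\<lambda>j. (haar_coeff \<iota> f j)\<^sup>2) ` {F. F \<subseteq> {4 ^ J<..} \<and> finite F})"
  proof (rule bdd_aboveI2)
    fix F assume "F \<in> {F. F \<subseteq> {(4::nat) ^ J<..} \<and> finite F}"
    then obtain K where "(\<Sum>j\<in>F. (haar_coeff \<iota> f j)\<^sup>2) \<le> energy K f - energy J f"
      using haar_partial_sum[OF io L2_integrable[OF f]] by blast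
    then show "(\<Sum>j\<in>F. (haar_coeff \<iota> f j)\<^sup>2) \<le> (\<integral>z. (f z)\<^sup>2 \<partial>lam) - energy J f"
      using energy_le[OF f, of K] by linarith
  qed
qed simp

text \<open>
  Parseval: the energies increase to the squared norm, and their increments are sums of squared
  coefficients.
\<close>

lemma residual_le_tail:
  assumes io: "haar_enumeration \<iota>" and f: "L2 f"
  shows "residual J f \<le> (\<Sum>\<^sub>\<infinity>j\<in>{4 ^ J<..}. (haar_coeff \<iota> f j)\<^sup>2)"
proof -
  let ?S = "\<Sum>\<^sub>\<infinity>j\<in>{4 ^ J<..}. (haar_coeff \<iota> f j)\<^sup>2"
  have S0: "0 \<le> ?S" by (rule infsum_nonneg) simp
  have "energy K f \<le> energy J f + ?S" for K
  proof (cases "J \<le> K")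
    case True
    have "(\<Sum>j\<in>{4 ^ J<..4 ^ K}. (haar_coeff \<iota> f j)\<^sup>2) \<le> ?S"
      by (rule finite_sum_le_infsum[OF haar_coeff_summable[OF io f]]) auto
    then show ?thesis using haar_coeff_sum[OF io L2_integrable[OF f] True] by simp
  next
    case False
    have "0 \<le> (\<Sum>j\<in>{4 ^ K<..4 ^ J}. (haar_coeff \<iota> f j)\<^sup>2)" by (intro sum_nonneg) simp
    then show ?thesis using haar_coeff_sum[OF io L2_integrable[OF f], of K J] False S0 by simp
  qed
  then have "(\<integral>z. (f z)\<^sup>2 \<partial>lam) \<le> energy J f + ?S" by (rule energy_bound_imp_L2_bound[OF f])
  then show ?thesis by (simp add: residual_def)
qed

lemma sum_even_le:
  fixes x :: "nat \<Rightarrow> real"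
  assumes "\<And>i. 0 \<le> x i"
  shows "(\<Sum>k<n. x (2 * k)) \<le> (\<Sum>i<2 * n - 1. x i)"
proof -
  have "(\<Sum>k<n. x (2 * k)) = (\<Sum>i\<in>(\<lambda>k. 2 * k) ` {..<n}. x i)"
    by (subst sum.reindex) (auto intro: inj_onI)
  also have "\<dots> \<le> (\<Sum>i<2 * n - 1. x i)" using assms by (intro sum_mono2) auto
  finally show ?thesis .
qed

text \<open>
  Each coefficient is a combination of differences between neighbouring cells of the next level, and
  different coefficients of one orientation use different edges.
\<close>

lemma level_abs_sum:
  assumes f: "integrable lam f"
  shows "(\<Sum>k<2 ^ J. \<Sum>l<2 ^ J. \<Sum>e\<in>UNIV. \<bar>haar_coef f (Wavelet J k l e)\<bar>) \<le> 3/2 * dyadic_TV (Suc J) f"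
proof -
  define \<alpha> where "\<alpha> = avg (Suc J) f"
  define H where "H k l = (\<Sum>b<2. \<bar>\<alpha> (Suc (2 * k)) (2 * l + b) - \<alpha> (2 * k) (2 * l + b)\<bar>)" for k l
  define V where "V k l = (\<Sum>a<2. \<bar>\<alpha> (2 * k + a) (Suc (2 * l)) - \<alpha> (2 * k + a) (2 * l)\<bar>)" for k l
  let ?c = "2 ^ J / 4 ^ Suc J :: real"
  have one: "\<bar>haar_coef f (Wavelet J k l e)\<bar> \<le> ?c * (H k l + V k l)" for k l e
  proof -
    have "\<bar>\<Sum>a<2. \<Sum>b<2. haar_sign e a b * \<alpha> (2 * k + a) (2 * l + b)\<bar> \<le> H k l + V k l"
      by (cases e) (simp_all add: haar_sign_def H_def V_def numeral_2_eq_2)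
    then have "?c * \<bar>\<Sum>a<2. \<Sum>b<2. haar_sign e a b * \<alpha> (2 * k + a) (2 * l + b)\<bar> \<le> ?c * (H k l + V k l)"
      by (rule mult_left_mono) simp
    moreover have "\<bar>?c\<bar> = ?c" by simp
    ultimately show ?thesis unfolding haar_coef_wavelet[OF f] abs_mult \<alpha>_def by simp
  qed
  have sumH: "(\<Sum>k<2 ^ J. \<Sum>l<2 ^ J. H k l) \<le> (\<Sum>j<2 ^ Suc J. \<Sum>i<2 ^ Suc J - 1. \<bar>\<alpha> (Suc i) j - \<alpha> i j\<bar>)"
  proof -
    have "(\<Sum>k<2 ^ J. \<Sum>l<2 ^ J. H k l) = (\<Sum>k<2 ^ J. \<Sum>j<2 * 2 ^ J. \<bar>\<alpha> (Suc (2 * k)) j - \<alpha> (2 * k) j\<bar>)"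
      unfolding sum_pairs H_def ..
    also have "\<dots> = (\<Sum>j<2 * 2 ^ J. \<Sum>k<2 ^ J. \<bar>\<alpha> (Suc (2 * k)) j - \<alpha> (2 * k) j\<bar>)" by (rule sum.swap)
    also have "\<dots> \<le> (\<Sum>j<2 * 2 ^ J. \<Sum>i<2 * 2 ^ J - 1. \<bar>\<alpha> (Suc i) j - \<alpha> i j\<bar>)"
      by (intro sum_mono sum_even_le[of "\<lambda>i. \<bar>\<alpha> (Suc i) _ - \<alpha> i _\<bar>"]) simp
    finally show ?thesis by simp
  qed
  have sumV: "(\<Sum>k<2 ^ J. \<Sum>l<2 ^ J. V k l) \<le> (\<Sum>i<2 ^ Suc J. \<Sum>j<2 ^ Suc J - 1. \<bar>\<alpha> i (Suc j) - \<alpha> i j\<bar>)"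
  proof -
    have "(\<Sum>k<2 ^ J. \<Sum>l<2 ^ J. V k l) = (\<Sum>l<2 ^ J. \<Sum>k<2 ^ J. V k l)" by (rule sum.swap)
    also have "\<dots> = (\<Sum>l<2 ^ J. \<Sum>i<2 * 2 ^ J. \<bar>\<alpha> i (Suc (2 * l)) - \<alpha> i (2 * l)\<bar>)"
      unfolding sum_pairs V_def ..
    also have "\<dots> = (\<Sum>i<2 * 2 ^ J. \<Sum>l<2 ^ J. \<bar>\<alpha> i (Suc (2 * l)) - \<alpha> i (2 * l)\<bar>)" by (rule sum.swap)
    also have "\<dots> \<le> (\<Sum>i<2 * 2 ^ J. \<Sum>j<2 * 2 ^ J - 1. \<bar>\<alpha> i (Suc j) - \<alpha> i j\<bar>)"
      by (intro sum_mono sum_even_le[of "\<lambda>j. \<bar>\<alpha> _ (Suc j) - \<alpha> _ j\<bar>"]) simp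
    finally show ?thesis by simp
  qed
  have "(\<Sum>k<2 ^ J. \<Sum>l<2 ^ J. \<Sum>e\<in>UNIV. \<bar>haar_coef f (Wavelet J k l e)\<bar>)
    \<le> (\<Sum>k<2 ^ J. \<Sum>l<2 ^ J. \<Sum>e\<in>(UNIV :: orientation set). ?c * (H k l + V k l))"
    by (intro sum_mono one)
  also have "\<dots> = 3 * ?c * ((\<Sum>k<2 ^ J. \<Sum>l<2 ^ J. H k l) + (\<Sum>k<2 ^ J. \<Sum>l<2 ^ J. V k l))"
  proof -
    have "(\<Sum>k<2 ^ J. \<Sum>l<2 ^ J. \<Sum>e\<in>(UNIV :: orientation set). c * (H k l + V k l))
      = 3 * c * ((\<Sum>k<2 ^ J. \<Sum>l<2 ^ J. H k l) + (\<Sum>k<2 ^ J. \<Sum>l<2 ^ J. V k l))" for c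
    proof -
      have "(\<Sum>e\<in>(UNIV :: orientation set). c * (H k l + V k l)) = 3 * c * (H k l + V k l)" for k l
        unfolding sum_orientation by simp
      then show ?thesis by (simp only: sum_distrib_left[symmetric] sum.distrib)
    qed
    then show ?thesis .
  qed
  also have "\<dots> \<le> 3 * ?c * grid_TV (2 ^ Suc J) \<alpha>"
    unfolding grid_TV_def using sumH sumV by (intro mult_left_mono add_mono) auto
  also have "\<dots> = 3/2 * dyadic_TV (Suc J) f"
  proof -
    have "(4::real) ^ Suc J = 2 ^ Suc J * 2 ^ Suc J" by (simp add: power_mult_distrib[symmetric])
    then have "?c = 1 / (2 * 2 ^ Suc J)" by (simp add: field_simps)
    then show ?thesis by (simp add: dyadic_TV_def \<alpha>_def)
  qed
  finally show ?thesis .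
qed

lemma haar_le_cell: "\<bar>haar (Wavelet J k l e) z\<bar> \<le> 2 ^ J * indicator (cell J k l) z"
proof -
  have "\<bar>\<Sum>a<2. \<Sum>b<2. haar_sign e a b * (A a * B b)\<bar> \<le> (A 0 + A 1) * (B 0 + B 1)"
    if "\<And>a. 0 \<le> A a" "\<And>a. 0 \<le> B a" for A B :: "nat \<Rightarrow> real"
  proof -
    have "0 \<le> A i * B j" for i j using that by simp
    from this[of 0 0] this[of 0 1] this[of 1 0] this[of 1 1] show ?thesis
      by (cases e) (simp_all add: haar_sign_def numeral_2_eq_2 algebra_simps)
  qed
  from this[of "\<lambda>a. dyadic_ind (Suc J) (2 * k + a) (fst z)" "\<lambda>b. dyadic_ind (Suc J) (2 * l + b) (snd z)"]
  have "\<bar>\<Sum>a<2. \<Sum>b<2. haar_sign e a b * indicator (cell (Suc J) (2 * k + a) (2 * l + b)) z\<bar> \<le> indicator (cell J k l) z"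
    unfolding indicator_cell dyadic_ind_split[of J] by (simp add: dyadic_ind_def)
  then show ?thesis unfolding haar_wavelet_cells abs_mult by simp
qed

text \<open>
  Instead of Hoelder's inequality, \<open>|f| \<le> M + M\<^sup>1\<^sup>-\<^sup>p |f|\<^sup>p\<close> is integrated over the cell, and \<open>M = 4\<^sup>J\<^sup>/\<^sup>p\<close>
  balances the two terms.
\<close>

lemma haar_coef_sup:
  assumes fi: "integrable lam f" and fp: "in_Lp p f" and p: "2 < p" and kl: "k < 2 ^ J" "l < 2 ^ J"
  shows "\<bar>haar_coef f (Wavelet J k l e)\<bar> \<le> (1 + (\<integral>z. \<bar>f z\<bar> powr p \<partial>lam)) * (4 powr (- (1/2 - 1/p))) ^ J"
proof -
  have [measurable]: "f \<in> borel_measurable lam" using fi by auto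
  have ip: "integrable lam (\<lambda>z. \<bar>f z\<bar> powr p)" using fp by (simp add: in_Lp_def)
  define M where "M = 4 powr (real J / p)"
  have M: "0 < M" by (simp add: M_def)
  have ic: "integrable lam (\<lambda>z. indicator (cell J k l) z :: real)"
    using integrable_cell[of "\<lambda>_. 1" J k l] by simp
  have pw: "\<bar>f z * haar (Wavelet J k l e) z\<bar> \<le> 2 ^ J * (M * indicator (cell J k l) z + M powr (1 - p) * \<bar>f z\<bar> powr p)" for z
  proof -
    have fM: "\<bar>f z\<bar> \<le> M + M powr (1 - p) * \<bar>f z\<bar> powr p"
    proof (cases "\<bar>f z\<bar> \<le> M")
      case True then show ?thesis by (simp add: add_increasing2)
    next
      case False
      then have "\<bar>f z\<bar> powr (1 - p) \<le> M powr (1 - p)" using M p by (intro powr_mono2') auto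
      then have "\<bar>f z\<bar> powr (1 - p) * \<bar>f z\<bar> powr p \<le> M powr (1 - p) * \<bar>f z\<bar> powr p"
        by (rule mult_right_mono) simp
      moreover have "\<bar>f z\<bar> powr (1 - p) * \<bar>f z\<bar> powr p = \<bar>f z\<bar>"
        using False M by (simp add: powr_add[symmetric])
      ultimately show ?thesis using M by linarith
    qed
    have "\<bar>f z * haar (Wavelet J k l e) z\<bar> \<le> \<bar>f z\<bar> * (2 ^ J * indicator (cell J k l) z)"
      unfolding abs_mult by (intro mult_left_mono haar_le_cell) simp
    also have "\<dots> = 2 ^ J * (\<bar>f z\<bar> * indicator (cell J k l) z)" by simp
    also have "\<bar>f z\<bar> * indicator (cell J k l) z \<le> M * indicator (cell J k l) z + M powr (1 - p) * \<bar>f z\<bar> powr p"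
      using fM by (auto simp: indicator_def)
    finally show ?thesis by (simp add: mult_left_mono)
  qed
  have "\<bar>haar_coef f (Wavelet J k l e)\<bar> \<le> (\<integral>z. \<bar>f z * haar (Wavelet J k l e) z\<bar> \<partial>lam)"
    unfolding haar_coef_def by (rule integral_abs_bound)
  also have "\<dots> \<le> (\<integral>z. 2 ^ J * (M * indicator (cell J k l) z + M powr (1 - p) * \<bar>f z\<bar> powr p) \<partial>lam)"
  proof (rule integral_mono')
    show "integrable lam (\<lambda>z. 2 ^ J * (M * indicator (cell J k l) z + M powr (1 - p) * \<bar>f z\<bar> powr p))"
      using ic ip by simp
  qed (rule order_trans[OF abs_ge_zero pw] pw)+
  also have "\<dots> = 2 ^ J * (M * (1 / 4 ^ J) + M powr (1 - p) * (\<integral>z. \<bar>f z\<bar> powr p \<partial>lam))"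
    using ic ip integral_cell[OF kl] by (simp only: integral_mult_right_zero Bochner_Integration.integral_add integrable_mult_right)
  also have "\<dots> = (1 + (\<integral>z. \<bar>f z\<bar> powr p \<partial>lam)) * (4 powr (- (1/2 - 1/p))) ^ J"
  proof -
    define E where "E = (4 powr (- (1/2 - 1/p))) ^ J"
    have E: "E = 4 powr (real J * (1/p - 1/2))"
      unfolding E_def by (subst powr_realpow[symmetric], simp) (simp add: powr_powr mult.commute)
    have two: "(2::real) ^ J = 4 powr (real J / 2)"
    proof -
      have "(4::real) powr (real J / 2) = (4 powr (1/2)) powr real J" by (simp add: powr_powr)
      also have "(4::real) powr (1/2) = 2" by (simp add: powr_half_sqrt)
      finally show ?thesis by (simp add: powr_realpow)
    qed
    have four: "1 / (4::real) ^ J = 4 powr (- real J)" by (simp add: powr_minus powr_realpow divide_inverse)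
    have "2 ^ J * (M * (1 / 4 ^ J)) = 4 powr (real J / 2 + (real J / p + (- real J)))"
      unfolding two four M_def by (simp only: powr_add)
    also have "real J / 2 + (real J / p + (- real J)) = real J * (1/p - 1/2)" by (simp add: algebra_simps)
    finally have 1: "2 ^ J * (M * (1 / 4 ^ J)) = E" by (simp only: E)
    have "2 ^ J * M powr (1 - p) = 4 powr (real J / 2 + real J / p * (1 - p))"
      unfolding two M_def powr_powr by (simp only: powr_add)
    also have "real J / 2 + real J / p * (1 - p) = real J * (1/p - 1/2)" using p by (simp add: field_simps)
    finally have 2: "2 ^ J * M powr (1 - p) = E" by (simp only: E)
    show ?thesis unfolding E_def[symmetric] distrib_left mult.assoc[symmetric] 2
      using 1 by (simp add: mult.assoc distrib_right)
  qed
  finally show ?thesis .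
qed

text \<open>
  The sum of squares is at most the largest coefficient times the sum of absolute values.
\<close>

lemma level_energy_decay:
  assumes f: "L2 f" "f \<in> BV" and fp: "in_Lp p f" and p: "2 < p"
  shows "energy (Suc J) f - energy J f
    \<le> 3 * BV_seminorm f * (1 + (\<integral>z. \<bar>f z\<bar> powr p \<partial>lam)) * (4 powr (- (1/2 - 1/p))) ^ J"
proof -
  let ?E = "(1 + (\<integral>z. \<bar>f z\<bar> powr p \<partial>lam)) * (4 powr (- (1/2 - 1/p))) ^ J"
  have fi: "integrable lam f" by (rule L2_integrable[OF f(1)])
  have E0: "0 \<le> ?E" by (intro mult_nonneg_nonneg add_nonneg_nonneg) auto
  have "energy (Suc J) f - energy J f = (\<Sum>k<2 ^ J. \<Sum>l<2 ^ J. \<Sum>e\<in>UNIV. (haar_coef f (Wavelet J k l e))\<^sup>2)"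
    by (rule level_sum_sq[OF fi, symmetric])
  also have "\<dots> \<le> (\<Sum>k<2 ^ J. \<Sum>l<2 ^ J. \<Sum>e\<in>UNIV. ?E * \<bar>haar_coef f (Wavelet J k l e)\<bar>)"
  proof (intro sum_mono)
    fix k l e assume "k \<in> {..<(2::nat) ^ J}" "l \<in> {..<(2::nat) ^ J}"
    then have "\<bar>haar_coef f (Wavelet J k l e)\<bar> * \<bar>haar_coef f (Wavelet J k l e)\<bar> \<le> ?E * \<bar>haar_coef f (Wavelet J k l e)\<bar>"
      using haar_coef_sup[OF fi fp p] by (intro mult_right_mono) auto
    then show "(haar_coef f (Wavelet J k l e))\<^sup>2 \<le> ?E * \<bar>haar_coef f (Wavelet J k l e)\<bar>"
      by (simp add: power2_eq_square)
  qed
  also have "\<dots> = ?E * (\<Sum>k<2 ^ J. \<Sum>l<2 ^ J. \<Sum>e\<in>UNIV. \<bar>haar_coef f (Wavelet J k l e)\<bar>)"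
    by (simp only: sum_distrib_left)
  also have "\<dots> \<le> ?E * (3 * BV_seminorm f)"
  proof (intro mult_left_mono E0)
    show "(\<Sum>k<2 ^ J. \<Sum>l<2 ^ J. \<Sum>e\<in>UNIV. \<bar>haar_coef f (Wavelet J k l e)\<bar>) \<le> 3 * BV_seminorm f"
      using level_abs_sum[OF fi, of J] BV_dyadic_TV[OF f(2), of "Suc J"] by linarith
  qed
  finally show ?thesis by (simp only: mult_ac)
qed

lemma BV_seminorm_nonneg: "f \<in> BV \<Longrightarrow> 0 \<le> BV_seminorm f"
  using BV_dyadic_TV[of f 0] dyadic_TV_nonneg[of 0 f] by linarith

lemma dyadic_floor_exponent:
  fixes y :: real
  assumes "1 \<le> y"
  shows "\<exists>J. 4 ^ J \<le> y \<and> y < 4 ^ Suc J"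
proof -
  obtain m where m: "y < 4 ^ m" using real_arch_pow[of 4 y] by auto
  define K where "K = (LEAST m. y < 4 ^ m)"
  have K: "y < 4 ^ K" unfolding K_def using m by (rule LeastI)
  then have "K \<noteq> 0" using assms by (cases "K = 0") auto
  then obtain J where J: "K = Suc J" by (cases K) auto
  have "\<not> y < 4 ^ J" using not_less_Least[of J "\<lambda>m. y < 4 ^ m"] J K_def by auto
  then show ?thesis using K J by (intro exI[of _ J]) simp
qed

text \<open>
  The energies of the levels decay geometrically; an index \<open>n\<close> between \<open>4\<^sup>J\<close> and \<open>4\<^sup>J\<^sup>+\<^sup>1\<close> only loses the
  factor \<open>4\<^sup>\<delta>\<close>.
\<close>

theorem haar_tail_exists:
  assumes io: "haar_enumeration \<iota>" and f: "L2 f" "f \<in> BV" and fp: "in_Lp p f" and p: "2 < p"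
  shows "\<exists>A\<ge>1. \<forall>n\<ge>1. (\<Sum>\<^sub>\<infinity>j\<in>{n<..}. (haar_coeff \<iota> f j)\<^sup>2) \<le> A\<^sup>2 * real n powr (- (1/2 - 1/p))"
proof -
  define \<delta> where "\<delta> = 1/2 - 1/p"
  have d: "0 < \<delta>" using p by (simp add: \<delta>_def field_simps)
  define q where "q = 4 powr (- \<delta>)"
  have q: "0 < q" "q < 1" using d by (auto simp: q_def powr_less_one)
  define G where "G = 3 * BV_seminorm f * (1 + (\<integral>z. \<bar>f z\<bar> powr p \<partial>lam))"
  have G0: "0 \<le> G" unfolding G_def using BV_seminorm_nonneg[OF f(2)] by (intro mult_nonneg_nonneg add_nonneg_nonneg) auto
  have step: "energy (Suc J) f \<le> energy J f + G * q ^ J" for J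
    using level_energy_decay[OF f fp p, of J] unfolding G_def q_def \<delta>_def by linarith
  \<comment> \<open>summed geometric series in a form suited to induction on the number of levels\<close>
  have dec: "energy (J + m) f - energy J f \<le> G * q ^ J / (1 - q) - G * q ^ (J + m) / (1 - q)" for J m
  proof (induction m)
    case (Suc m)
    have "G * q ^ (J + m) / (1 - q) - G * q ^ (J + Suc m) / (1 - q) = G * q ^ (J + m) * (1 - q) / (1 - q)"
      by (simp add: diff_divide_distrib[symmetric] algebra_simps)
    also have "\<dots> = G * q ^ (J + m)" using q by simp
    finally show ?case using Suc step[of "J + m"] by simp
  qed simp
  have dec': "energy K f - energy J f \<le> G * q ^ J / (1 - q)" for J K
  proof (cases "J \<le> K")
    case True
    have "0 \<le> G * q ^ K / (1 - q)" using G0 q by simp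
    then show ?thesis using dec[of J "K - J"] True by simp
  next
    case False
    have "0 \<le> (\<Sum>j\<in>{4 ^ K<..4 ^ J}. (haar_coeff \<iota> f j)\<^sup>2)" by (intro sum_nonneg) simp
    then have "energy K f \<le> energy J f"
      using haar_coeff_sum[OF io L2_integrable[OF f(1)], of K J] False by simp
    moreover have "0 \<le> G * q ^ J / (1 - q)" using G0 q by simp
    ultimately show ?thesis by linarith
  qed
  define B where "B = G / ((1 - q) * q)"
  have B0: "0 \<le> B" using G0 q by (simp add: B_def)
  define A where "A = max 1 (sqrt B)"
  have A: "1 \<le> A" by (simp add: A_def)
  have A2: "B \<le> A\<^sup>2"
  proof -
    have "(sqrt B)\<^sup>2 \<le> A\<^sup>2" by (intro power_mono) (auto simp: A_def B0)
    then show ?thesis using B0 by simp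
  qed
  have "(\<Sum>\<^sub>\<infinity>j\<in>{n<..}. (haar_coeff \<iota> f j)\<^sup>2) \<le> A\<^sup>2 * real n powr (- \<delta>)" if n: "1 \<le> n" for n
  proof -
    obtain J where J: "4 ^ J \<le> real n" "real n < 4 ^ Suc J"
      using dyadic_floor_exponent[of "real n"] n by auto
    have "real (4 ^ J) \<le> real n" using J(1) by simp
    then have Jn: "4 ^ J \<le> n" by (simp only: of_nat_le_iff)
    then have sub: "{n<..} \<subseteq> {4 ^ J<..}" by auto
    have "(\<Sum>\<^sub>\<infinity>j\<in>{n<..}. (haar_coeff \<iota> f j)\<^sup>2) \<le> G * q ^ J / (1 - q)"
    proof (rule infsum_le_finite_sums)
      show "(\<lambda>j. (haar_coeff \<iota> f j)\<^sup>2) summable_on {n<..}"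
        by (rule summable_on_subset_banach[OF haar_coeff_summable[OF io f(1)] sub])
      fix F assume F: "finite F" "F \<subseteq> {n<..}"
      obtain K where "(\<Sum>j\<in>F. (haar_coeff \<iota> f j)\<^sup>2) \<le> energy K f - energy J f"
        using haar_partial_sum[OF io L2_integrable[OF f(1)] F(1) order_trans[OF F(2) sub]] by (elim exE)
      then show "(\<Sum>j\<in>F. (haar_coeff \<iota> f j)\<^sup>2) \<le> G * q ^ J / (1 - q)" using dec'[of K J] by linarith
    qed
    also have "\<dots> = B * q ^ Suc J" using q by (simp add: B_def field_simps)
    also have "q ^ Suc J = (4 ^ Suc J) powr (- \<delta>)"
    proof -
      have "q ^ Suc J = q powr real (Suc J)" by (rule powr_realpow[OF q(1), symmetric])
      also have "\<dots> = (4 powr real (Suc J)) powr (- \<delta>)" by (simp add: q_def powr_powr mult.commute)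
      also have "4 powr real (Suc J) = (4::real) ^ Suc J" by (rule powr_realpow) simp
      finally show ?thesis .
    qed
    also have "B * (4 ^ Suc J) powr (- \<delta>) \<le> A\<^sup>2 * real n powr (- \<delta>)"
      using A2 J(2) n d by (intro mult_mono powr_mono2') auto
    finally show ?thesis .
  qed
  then show ?thesis using A unfolding \<delta>_def by blast
qed

section \<open>The two risk bounds\<close>

lemma tree_dist_AE:
  assumes "f \<in> borel_measurable lam" "g \<in> borel_measurable lam" "AE z in lam. f z = g z"
  shows "tree_dist f v = tree_dist g v"
proof -
  have [measurable]: "tree_fun v \<in> borel_measurable lam" using tree_fun_L2[of v] by (simp add: L2_def)
  note [measurable] = assms(1,2)
  show ?thesis unfolding tree_dist_def
    by (rule integral_cong_AE) (use assms(3) in \<open>auto elim!: eventually_mono\<close>)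
qed

lemma avg_AE:
  assumes "f \<in> borel_measurable lam" "g \<in> borel_measurable lam" "AE z in lam. f z = g z"
  shows "avg J f = avg J g"
proof (intro ext)
  note [measurable] = assms(1,2)
  fix i j
  have "(\<integral>z. indicator (cell J i j) z * f z \<partial>lam) = (\<integral>z. indicator (cell J i j) z * g z \<partial>lam)"
    by (rule integral_cong_AE) (use assms(3) in \<open>auto elim!: eventually_mono\<close>)
  then show "avg J f i j = avg J g i j" by (simp add: avg_def)
qed

lemma residual_AE:
  assumes "f \<in> borel_measurable lam" "g \<in> borel_measurable lam" "AE z in lam. f z = g z"
  shows "residual J f = residual J g"
proof -
  note [measurable] = assms(1,2)
  have "(\<integral>z. (f z)\<^sup>2 \<partial>lam) = (\<integral>z. (g z)\<^sup>2 \<partial>lam)"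
    by (rule integral_cong_AE) (use assms(3) in \<open>auto elim!: eventually_mono\<close>)
  then show ?thesis by (simp add: residual_def energy_def avg_AE[OF assms])
qed

text \<open>
  The tree approximations need a function that is nonnegative everywhere; averages and distances
  only see it almost everywhere.
\<close>

lemma sqrt_approx:
  assumes s: "s \<in> L1_plus"
  defines "f \<equiv> \<lambda>z. sqrt (s z)"
  shows "0 < \<epsilon> \<Longrightarrow> \<exists>v. real (leaves v) \<le> 1 + 3 * real J * dyadic_TV J f / \<epsilon> \<and>
      tree_dist f v \<le> residual J f + \<epsilon> * dyadic_TV J f / 2 + 400 * real (leaves v)"
    and "\<exists>v. leaves v = 4 ^ J \<and> tree_dist f v \<le> residual J f + 400 * 4 ^ J"
proof -
  define g where "g z = max 0 (f z)" for z
  have fL: "L2 f" unfolding f_def by (rule L2_sqrt[OF s])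
  then have fm[measurable]: "f \<in> borel_measurable lam" by (simp add: L2_def)
  have gm[measurable]: "g \<in> borel_measurable lam" unfolding g_def by measurable
  have ae: "AE z in lam. g z = f z"
    using s by (auto simp: L1_plus_def g_def f_def elim!: eventually_mono)
  have gL: "L2 g"
  proof -
    have "integrable lam (\<lambda>z. (g z)\<^sup>2) \<longleftrightarrow> integrable lam (\<lambda>z. (f z)\<^sup>2)"
      by (rule integrable_cong_AE) (use ae in \<open>auto elim!: eventually_mono\<close>)
    then show ?thesis using fL gm by (simp add: L2_def)
  qed
  have g0: "0 \<le> g z" for z by (simp add: g_def)
  note e = tree_dist_AE[OF gm fm ae] residual_AE[OF gm fm ae] avg_AE[OF gm fm ae]
  show "\<exists>v. real (leaves v) \<le> 1 + 3 * real J * dyadic_TV J f / \<epsilon> \<and>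
      tree_dist f v \<le> residual J f + \<epsilon> * dyadic_TV J f / 2 + 400 * real (leaves v)" if "0 < \<epsilon>"
    using tree_approx[OF gL g0 that, of J] by (simp add: dyadic_TV_def e)
  show "\<exists>v. leaves v = 4 ^ J \<and> tree_dist f v \<le> residual J f + 400 * 4 ^ J"
    using full_tree_approx[OF gL g0, of J] by (simp add: e)
qed

text \<open>
  With depth \<open>J\<close> of order \<open>\<gamma>\<close> and \<open>\<epsilon> = sqrt J\<close> the number of leaves and the error from the leaves are both of order
  \<open>sqrt J R\<close>.
\<close>

lemma adaptive_bound:
  assumes s: "s \<in> L1_plus" "(\<lambda>z. sqrt (s z)) \<in> BV" and \<gamma>: "1 \<le> \<gamma>"
    and residual: "\<And>J. \<gamma> \<le> real J \<Longrightarrow> residual J (\<lambda>z. sqrt (s z)) \<le> \<gamma>"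
  defines "R \<equiv> BV_seminorm (\<lambda>z. sqrt (s z))"
  shows "\<exists>v. tree_dist (\<lambda>z. sqrt (s z)) v + real (leaves v) \<le> 6000 * sqrt (\<gamma> * max (R\<^sup>2) \<gamma>)"
proof -
  let ?f = "\<lambda>z. sqrt (s z)"
  define X where "X = sqrt (\<gamma> * max (R\<^sup>2) \<gamma>)"
  have R0: "0 \<le> R" unfolding R_def by (rule BV_seminorm_nonneg[OF s(2)])
  define J where "J = nat \<lceil>\<gamma>\<rceil>"
  have J: "\<gamma> \<le> real J" "real J \<le> 2 * \<gamma>" "1 \<le> real J"
    using \<gamma> le_of_int_ceiling[of \<gamma>] ceiling_correct[of \<gamma>] by (simp_all add: J_def of_nat_nat)
  define \<epsilon> where "\<epsilon> = sqrt (real J)"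
  have e: "0 < \<epsilon>" using J by (simp add: \<epsilon>_def)
  have e2: "real J / \<epsilon> = \<epsilon>" using J by (simp add: \<epsilon>_def real_div_sqrt)
  define V where "V = dyadic_TV J ?f"
  have V: "0 \<le> V" "V \<le> 2 * R" unfolding V_def R_def using dyadic_TV_nonneg BV_dyadic_TV[OF s(2)] by auto
  obtain v where v: "real (leaves v) \<le> 1 + 3 * real J * V / \<epsilon>"
    "tree_dist ?f v \<le> residual J ?f + \<epsilon> * V / 2 + 400 * real (leaves v)"
    using sqrt_approx(1)[OF s(1) e, of J] unfolding V_def by blast
  have "3 * real J * V / \<epsilon> = 3 * V * (real J / \<epsilon>)" by simp
  then have l: "real (leaves v) \<le> 1 + 3 * (\<epsilon> * V)" using v(1) by (simp add: e2 mult_ac)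
  \<comment> \<open>X dominates both gamma and sqrt gamma * R\<close>
  have gX: "\<gamma> \<le> X"
  proof -
    have "\<gamma> = sqrt (\<gamma> * \<gamma>)" using \<gamma> by simp
    also have "\<dots> \<le> X" unfolding X_def using \<gamma> by (intro real_sqrt_le_mono mult_left_mono) auto
    finally show ?thesis .
  qed
  have eV: "\<epsilon> * V \<le> 4 * X"
  proof -
    have "\<epsilon> \<le> sqrt (4 * \<gamma>)" unfolding \<epsilon>_def using J \<gamma> by (intro real_sqrt_le_mono) linarith
    then have "\<epsilon> * V \<le> sqrt (4 * \<gamma>) * (2 * R)" using V e \<gamma> by (intro mult_mono) auto
    also have "\<dots> = 4 * sqrt (\<gamma> * R\<^sup>2)" using R0 by (simp add: real_sqrt_mult)
    also have "\<dots> \<le> 4 * X" unfolding X_def using \<gamma> by (intro mult_left_mono real_sqrt_le_mono) auto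
    finally show ?thesis .
  qed
  have "d + n \<le> 6000 * x"
    if "d \<le> t + w / 2 + 400 * n" "n \<le> 1 + 3 * w" "t \<le> g" "g \<le> x" "w \<le> 4 * x" "1 \<le> g"
    for d n t w g x :: real
    using that by linarith
  from this[OF v(2) l residual[OF J(1)] gX eV \<gamma>] show ?thesis unfolding X_def by blast
qed

text \<open>
  The full tree of depth \<open>J\<close> balances \<open>4\<^sup>J\<close> leaves against the residual \<open>A\<^sup>2 4\<^sup>-\<^sup>J\<^sup>\<delta>\<close> if \<open>4\<^sup>J\<close> is close to
  \<open>A\<close> to the power \<open>2/(1 + \<delta>)\<close>.
\<close>

lemma linear_bound:
  assumes s: "s \<in> L1_plus" and A: "1 \<le> A" and \<delta>: "0 < \<delta>" "\<delta> \<le> 1/2"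
    and residual: "\<And>J. residual J (\<lambda>z. sqrt (s z)) \<le> A\<^sup>2 * (4 ^ J) powr (- \<delta>)"
  shows "\<exists>v. tree_dist (\<lambda>z. sqrt (s z)) v + real (leaves v) \<le> 6000 * A powr (2 / (1 + \<delta>))"
proof -
  let ?f = "\<lambda>z. sqrt (s z)"
  define Y where "Y = A powr (2 / (1 + \<delta>))"
  have Y: "1 \<le> Y" unfolding Y_def using A \<delta> by (intro ge_one_powr_ge_zero) auto
  obtain J where J: "4 ^ J \<le> Y" "Y < 4 ^ Suc J" using dyadic_floor_exponent[OF Y] by blast
  obtain v where v: "leaves v = 4 ^ J" "tree_dist ?f v \<le> residual J ?f + 400 * 4 ^ J"
    using sqrt_approx(2)[OF s, of J] by blast
  have A2: "A\<^sup>2 = Y * Y powr \<delta>"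
  proof -
    have "Y * Y powr \<delta> = Y powr (1 + \<delta>)" using Y by (simp add: powr_add)
    also have "\<dots> = A powr (2 / (1 + \<delta>) * (1 + \<delta>))" unfolding Y_def by (rule powr_powr)
    also have "2 / (1 + \<delta>) * (1 + \<delta>) = 2"
    proof -
      have "1 + \<delta> \<noteq> 0" using \<delta> by linarith
      then show ?thesis by (metis nonzero_mult_div_cancel_right times_divide_eq_left)
    qed
    finally show ?thesis using A by simp
  qed
  have "residual J ?f \<le> A\<^sup>2 * (4 ^ J) powr (- \<delta>)" by (rule residual)
  also have "\<dots> \<le> A\<^sup>2 * (Y / 4) powr (- \<delta>)"
    using J Y \<delta> by (intro mult_left_mono powr_mono2') auto
  also have "\<dots> = Y * (4 powr \<delta>)"
  proof -
    have "(Y / 4) powr (- \<delta>) = 4 powr \<delta> / Y powr \<delta>"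
      using Y by (simp add: powr_minus powr_divide)
    moreover have "Y powr \<delta> \<noteq> 0" using Y by simp
    ultimately show ?thesis unfolding A2 by simp
  qed
  also have "\<dots> \<le> Y * (4 powr 1)" using \<delta> Y by (intro mult_left_mono powr_mono) auto
  finally have "residual J ?f \<le> 4 * Y" by simp
  then have "tree_dist ?f v + real (leaves v) \<le> 6000 * Y" using v J by simp
  then show ?thesis unfolding Y_def by blast
qed

text \<open>
  The logarithm in \<open>\<gamma>\<close> is chosen so that \<open>2\<close> to the power \<open>-\<delta>\<gamma>\<close> is at most \<open>1 / (\<delta> (max A R)\<^sup>2)\<close>, hence the
  residual at most \<open>1/\<delta>\<close>.
\<close>

lemma tail_at_gamma:
  assumes A: "1 \<le> A" and \<delta>: "0 < \<delta>" and J: "\<gamma> \<le> real J"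
    and \<gamma>: "\<gamma> = (1 / \<delta>) * max (ln (\<delta> * (max A R)\<^sup>2) / ln 2) 1"
  shows "A\<^sup>2 * (4 ^ J) powr (- \<delta>) \<le> \<gamma>"
proof -
  define L where "L = \<delta> * (max A R)\<^sup>2"
  have A2: "A\<^sup>2 \<le> (max A R)\<^sup>2" using A by (intro power_mono) auto
  have A0: "0 < A\<^sup>2" using A by simp
  have L: "0 < L" unfolding L_def using A2 A0 \<delta> by (intro mult_pos_pos) auto
  have dg: "\<delta> * \<gamma> = max (ln L / ln 2) 1" using \<delta> by (simp add: \<gamma> L_def)
  have "ln L / ln 2 \<le> \<delta> * \<gamma>" unfolding dg by simp
  also have "\<dots> \<le> \<delta> * (2 * real J)" using J \<delta> by (intro mult_left_mono) auto
  finally have "ln L \<le> \<delta> * (2 * real J) * ln 2" by (simp add: divide_le_eq)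
  moreover have "ln 4 = 2 * ln (2::real)" using ln_realpow[of 2 2] by simp
  ultimately have ll: "ln L \<le> \<delta> * (real J * ln 4)" by (simp add: mult_ac)
  have "(4 ^ J) powr (- \<delta>) = exp (- (\<delta> * (real J * ln 4)))"
    by (simp add: powr_def ln_realpow)
  also have "\<dots> \<le> exp (- ln L)" using ll by simp
  also have "\<dots> = 1 / L" using L by (simp add: exp_minus divide_inverse)
  finally have "A\<^sup>2 * (4 ^ J) powr (- \<delta>) \<le> A\<^sup>2 * (1 / L)" using A0 by (intro mult_left_mono) auto
  also have "\<dots> = A\<^sup>2 / (max A R)\<^sup>2 / \<delta>" by (simp add: L_def)
  also have "\<dots> \<le> 1 / \<delta>"
  proof (intro divide_right_mono)
    have "0 < (max A R)\<^sup>2" using A2 A0 by linarith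
    then show "A\<^sup>2 / (max A R)\<^sup>2 \<le> 1" using A2 by (simp only: divide_le_eq_1_pos)
  qed (use \<delta> in simp)
  also have "\<dots> \<le> \<gamma>" unfolding \<gamma> using \<delta> by (simp add: divide_right_mono)
  finally show ?thesis .
qed

text \<open>
  The estimator only depends on the separated model. It remains to insert the two trees into the
  risk bound for the point of the model that is close to the tree.
\<close>

theorem corollary4:
  shows "\<exists>C>0. \<forall>\<iota>. haar_enumeration \<iota> \<longrightarrow>
    (\<exists>est. T_estimator est \<and>
      (\<forall>s (p :: real). s \<in> L1_plus \<longrightarrow> p > 2 \<longrightarrow>
        (\<lambda>x. sqrt (s x)) \<in> BV \<longrightarrow> in_Lp p (\<lambda>x. sqrt (s x)) \<longrightarrow>
        (let \<beta> = haar_coeff \<iota> (\<lambda>x. sqrt (s x));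
             \<delta> = 1/2 - 1/p;
             R = BV_seminorm (\<lambda>x. sqrt (s x));
             tail_bound = (\<lambda>A. \<forall>n\<ge>1. (\<Sum>\<^sub>\<infinity>j\<in>{n<..}. (\<beta> j)\<^sup>2) \<le> A\<^sup>2 * real n powr (- \<delta>))
         in (\<exists>A\<ge>1. tail_bound A) \<and>
            (\<forall>A\<ge>1. tail_bound A \<longrightarrow>
              (let \<gamma> = (1 / \<delta>) * max (ln (\<delta> * (max A R)\<^sup>2) / ln 2) 1
               in (\<integral>\<^sup>+X. ennreal ((hell s (est X))\<^sup>2) \<partial>poisson_process (intensity_measure s))
                    \<le> ennreal (C * min (sqrt (\<gamma> * max (R\<^sup>2) \<gamma>)) (A powr (2 / (1 + \<delta>)))))))))"
proof -
  obtain T where T: "T \<noteq> {}" "T \<subseteq> pos_L1" "D_model L1_plus hell 10 1 1 T"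
    and AEd: "\<And>t u. t \<in> T \<Longrightarrow> u \<in> T \<Longrightarrow> (AE x in lam. t x = u x) \<Longrightarrow> t = u"
    and cover: "\<And>v. \<exists>u\<in>T. (hell (tree_int v) u)\<^sup>2 \<le> 2500 * real (leaves v)"
    using model_exists by blast
  have TL: "T \<subseteq> L1_plus" using T(2) pos_L1_subset by auto
  define \<psi> where "\<psi> = lr_test (to_nat_on T)"
  have psi: "test_family T (\<lambda>_. 10) \<psi>"
    unfolding \<psi>_def by (rule lr_test_family[OF T(2)]) (rule inj_on_to_nat_on[OF D_model_countable[OF T(3)]])
  obtain est where est: "T_estimator est" "est \<in> config_space \<rightarrow>\<^sub>M count_space T"
    and opt: "\<forall>X\<in>space config_space. \<forall>t\<in>T. T_criterion T \<psi> X (est X) \<le> T_criterion T \<psi> X t"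
    using T_estimator_exists[OF T(3,1) psi AEd] by blast
  \<comment> \<open>large enough for 4000 + 200 * (5000 * 6000), the constants of the risk bound, of the distance from
    the tree to the model and of the two tree approximations\<close>
  define C :: real where "C = 10 ^ 10"
  have risk: "(\<integral>\<^sup>+X. ennreal ((hell s (est X))\<^sup>2) \<partial>poisson_process (intensity_measure s)) \<le> ennreal (C * b)"
    if s: "s \<in> L1_plus" and v: "tree_dist (\<lambda>z. sqrt (s z)) v + real (leaves v) \<le> 6000 * b" and b: "1 \<le> b" for s v b
  proof -
    obtain u where u: "u \<in> T" "(hell (tree_int v) u)\<^sup>2 \<le> 2500 * real (leaves v)" using cover by blast
    have vL: "tree_int v \<in> L1_plus" using tree_int_pos_L1 pos_L1_subset by blast
    have "(hell s u)\<^sup>2 \<le> 2 * (hell s (tree_int v))\<^sup>2 + 2 * (hell (tree_int v) u)\<^sup>2"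
      using u(1) TL by (intro hell_triangle_sq[OF s vL]) auto
    also have "\<dots> \<le> tree_dist (\<lambda>z. sqrt (s z)) v + 5000 * real (leaves v)"
      using u(2) hell_tree_int[OF s, of v] by simp
    finally have h: "(hell s u)\<^sup>2 \<le> tree_dist (\<lambda>z. sqrt (s z)) v + 5000 * real (leaves v)" .
    have "0 \<le> tree_dist (\<lambda>z. sqrt (s z)) v" by (simp add: tree_dist_def)
    then have "(hell s u)\<^sup>2 \<le> 5000 * (6000 * b)" using h v by linarith
    then have "4000 + 200 * (hell s u)\<^sup>2 \<le> C * b" using b by (simp add: C_def)
    then show ?thesis
      using T_criterion_risk[OF T(3) psi est(2) opt s u(1)] by (meson ennreal_leI order_trans)
  qed
  show ?thesis
  proof (intro exI[of _ C] conjI allI impI)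
    show "0 < C" by (simp add: C_def)
    fix \<iota> assume io: "haar_enumeration \<iota>"
    show "\<exists>est. T_estimator est \<and>
      (\<forall>s (p :: real). s \<in> L1_plus \<longrightarrow> p > 2 \<longrightarrow>
        (\<lambda>x. sqrt (s x)) \<in> BV \<longrightarrow> in_Lp p (\<lambda>x. sqrt (s x)) \<longrightarrow>
        (let \<beta> = haar_coeff \<iota> (\<lambda>x. sqrt (s x));
             \<delta> = 1/2 - 1/p;
             R = BV_seminorm (\<lambda>x. sqrt (s x));
             tail_bound = (\<lambda>A. \<forall>n\<ge>1. (\<Sum>\<^sub>\<infinity>j\<in>{n<..}. (\<beta> j)\<^sup>2) \<le> A\<^sup>2 * real n powr (- \<delta>))
         in (\<exists>A\<ge>1. tail_bound A) \<and>
            (\<forall>A\<ge>1. tail_bound A \<longrightarrow>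
              (let \<gamma> = (1 / \<delta>) * max (ln (\<delta> * (max A R)\<^sup>2) / ln 2) 1
               in (\<integral>\<^sup>+X. ennreal ((hell s (est X))\<^sup>2) \<partial>poisson_process (intensity_measure s))
                    \<le> ennreal (C * min (sqrt (\<gamma> * max (R\<^sup>2) \<gamma>)) (A powr (2 / (1 + \<delta>))))))))"
    proof (intro exI[of _ est] conjI allI impI est(1))
      fix s and p :: real
      assume s: "s \<in> L1_plus" and p: "2 < p" and bv: "(\<lambda>x. sqrt (s x)) \<in> BV" and lp: "in_Lp p (\<lambda>x. sqrt (s x))"
      let ?f = "\<lambda>x. sqrt (s x)"
      define \<delta> where "\<delta> = 1/2 - 1/p"
      define R where "R = BV_seminorm ?f"
      have fL: "L2 ?f" by (rule L2_sqrt[OF s])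
      have d: "0 < \<delta>" "\<delta> \<le> 1/2" using p by (auto simp: \<delta>_def field_simps)
      have bound: "(\<integral>\<^sup>+X. ennreal ((hell s (est X))\<^sup>2) \<partial>poisson_process (intensity_measure s))
          \<le> ennreal (C * min (sqrt (\<gamma> * max (R\<^sup>2) \<gamma>)) (A powr (2 / (1 + \<delta>))))"
        if A: "1 \<le> A"
          and tail: "\<forall>n\<ge>1. (\<Sum>\<^sub>\<infinity>j\<in>{n<..}. (haar_coeff \<iota> ?f j)\<^sup>2) \<le> A\<^sup>2 * real n powr (- \<delta>)"
          and \<gamma>: "\<gamma> = (1 / \<delta>) * max (ln (\<delta> * (max A R)\<^sup>2) / ln 2) 1" for A \<gamma>
      proof -
        have tauA: "residual J ?f \<le> A\<^sup>2 * (4 ^ J) powr (- \<delta>)" for J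
        proof -
          have "(1::nat) \<le> 4 ^ J" by simp
          then have "(\<Sum>\<^sub>\<infinity>j\<in>{4 ^ J<..}. (haar_coeff \<iota> ?f j)\<^sup>2) \<le> A\<^sup>2 * real (4 ^ J) powr (- \<delta>)"
            using tail by blast
          then show ?thesis using residual_le_tail[OF io fL, of J] by simp
        qed
        have g1: "1 \<le> \<gamma>"
        proof -
          have "1 \<le> 1 / \<delta>" using d by simp
          also have "1 / \<delta> * 1 \<le> \<gamma>" unfolding \<gamma> using d by (intro mult_left_mono) auto
          finally show ?thesis by simp
        qed
        have "residual J ?f \<le> \<gamma>" if "\<gamma> \<le> real J" for J
          using tauA[of J] tail_at_gamma[OF A d(1) that \<gamma>] by linarith
        then obtain v where v: "tree_dist ?f v + real (leaves v) \<le> 6000 * sqrt (\<gamma> * max (R\<^sup>2) \<gamma>)"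
          using adaptive_bound[OF s bv g1] unfolding R_def by blast
        obtain w where w: "tree_dist ?f w + real (leaves w) \<le> 6000 * A powr (2 / (1 + \<delta>))"
          using linear_bound[OF s A d tauA] by blast
        have "1 * 1 \<le> \<gamma> * max (R\<^sup>2) \<gamma>" using g1 by (intro mult_mono) auto
        then have X1: "1 \<le> sqrt (\<gamma> * max (R\<^sup>2) \<gamma>)" by simp
        have Y1: "1 \<le> A powr (2 / (1 + \<delta>))" using A d by (intro ge_one_powr_ge_zero) auto
        show ?thesis using risk[OF s v X1] risk[OF s w Y1] by (simp add: min_def)
      qed
      show "let \<beta> = haar_coeff \<iota> ?f; \<delta> = 1/2 - 1/p; R = BV_seminorm ?f;
             tail_bound = (\<lambda>A. \<forall>n\<ge>1. (\<Sum>\<^sub>\<infinity>j\<in>{n<..}. (\<beta> j)\<^sup>2) \<le> A\<^sup>2 * real n powr (- \<delta>))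
         in (\<exists>A\<ge>1. tail_bound A) \<and>
            (\<forall>A\<ge>1. tail_bound A \<longrightarrow>
              (let \<gamma> = (1 / \<delta>) * max (ln (\<delta> * (max A R)\<^sup>2) / ln 2) 1
               in (\<integral>\<^sup>+X. ennreal ((hell s (est X))\<^sup>2) \<partial>poisson_process (intensity_measure s))
                    \<le> ennreal (C * min (sqrt (\<gamma> * max (R\<^sup>2) \<gamma>)) (A powr (2 / (1 + \<delta>))))))"
        unfolding Let_def
      proof (intro conjI allI impI)
        show "\<exists>A\<ge>1. \<forall>n\<ge>1. (\<Sum>\<^sub>\<infinity>j\<in>{n<..}. (haar_coeff \<iota> ?f j)\<^sup>2) \<le> A\<^sup>2 * real n powr (- (1/2 - 1/p))"
          by (rule haar_tail_exists[OF io fL bv lp p])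
      qed (rule bound[unfolded \<delta>_def R_def, OF _ _ refl])
    qed
  qed
qed

end
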